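(* Let $\mathcal A$ be an S-ring over a CG-ring $R$ and let $I\in\mathcal I_{max}(\mathcal A)$ be a maximal $\mathcal A$-ideal. Suppose that every basic set of $\mathcal A$ contained in $R\setminus I$ is $Q$-rational, where $Q=\mathcal P(R/I)$. Let $I^\star$ be the intersection of all $\mathcal A$-ideals containing $R_Q$. Then $\mathcal A$ satisfies the $I/J$-condition where $J=I\cap I^\star$. Moreover, if $J=0$, then $\mathcal A=\mathcal A_{I}\otimes\mathcal A_{I^\star}$.
   Context: All rings are finite, commutative, with identity. For a ring $R$, $R^+$ is the additive group, $R^\times$ the group of units, $\mathcal P(R)$ the set of primes dividing $|R|$; $R_p$ is the $p$-component of $R$ (the subring whose additive group is the Sylow $p$-subgroup of $R^+$), and $R_Q=\prod_{p\in Q}R_p$ for $Q\subset\mathcal P(R)$. $R$ is a CG-ring if for every $p\in\mathcal P(R)$ the ring $R_p$ is a Galois ring, i.e. a local ring with radical $pR_p$. S-ring over a finite group $G$: a subring $\mathcal A$ of $\mathbb Z G$ having a $\mathbb Z$-basis consisting of the elements $\sum_{x\in X}x$, where $X$ runs over a partition $\mathcal S(\mathcal A)$ of $G$ into non-empty sets (basic sets) such that $\{1\}\in\mathcal S(\mathcal A)$ and $X\in\mathcal S(\mathcal A)\Rightarrow X^{-1}\in\mathcal S(\mathcal A)$. S-ring over the ring $R$: an S-ring $\mathcal A$ over $R^+$ such that $uX\in\mathcal S(\mathcal A)$ for all $X\in\mathcal S(\mathcal A)$, $u\in R^\times$. An $\mathcal A$-ideal is an ideal of $R$ that is a union of basic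 sets; $\mathcal I_{max}(\mathcal A)$ is the set of $\mathcal A$-ideals maximal by inclusion among those different from $R$. For an $\mathcal A$-ideal $I$, $\mathcal A_I$ is the S-ring over $I^+$ whose basic sets are the basic sets of $\mathcal A$ contained in $I$. A set $X\subset R$ is $Q$-rational if $R_Q^\times X=X$, where $R_Q^\times$ is viewed as the subgroup of $R^\times=\prod_pR_p^\times$ of elements with $p$-component $1$ for $p\notin Q$. For $X\subset R$, $I_{\rm L}(X)$ is the largest ideal $I'$ of $R$ with $X+I'=X$. For $\mathcal A$-ideals $J\subset I$, $\mathcal A$ satisfies the $I/J$-condition if $J\subset I_{\rm L}(X)$ for every basic set $X\subset R\setminus I$. $\mathcal A=\mathcal A_I\otimes\mathcal A_{I^\star}$ means that $R^+=I^+\oplus (I^{\star})^+$ and the basic sets of $\mathcal A$ are exactly the sets $X_1+X_2$ with $X_1\in\mathcal S(\mathcal A_I)$, $X_2\in\mathcal S(\mathcal A_{I^\star})$. *)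

theory Defs
  imports "HOL-Algebra.QuotRing" "HOL-Algebra.Subrings" "HOL-Algebra.Sylow"
    "HOL-Algebra.Multiplicative_Group" "HOL-Library.Disjoint_Sets" "HOL-Library.Indicator_Function"
begin

section \<open>Integral group rings and S-rings over a finite group\<close>

text \<open>
  An element of the group ring is its coefficient function, extended by \<open>0\<close> outside the group.
  In particular the group ring of a subgroup is a subset of the group ring of the group.
\<close>

definition group_ring :: "('a, 'b) monoid_scheme \<Rightarrow> ('a \<Rightarrow> int) ring" where
  "group_ring G =
    \<lparr>carrier = {f. \<forall>x. x \<notin> carrier G \<longrightarrow> f x = 0},
     monoid.mult = (\<lambda>f g x. if x \<in> carrier G
                     then \<Sum>y\<in>carrier G. f y * g (inv\<^bsub>G\<^esub> y \<otimes>\<^bsub>G\<^esub> x) else 0),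
     monoid.one = indicator {\<one>\<^bsub>G\<^esub>},
     ring.zero = (\<lambda>_. 0),
     ring.add = (\<lambda>f g x. f x + g x)\<rparr>"

lemma ring_group_ring:
  assumes "group G" and fin: "finite (carrier G)"
  shows "ring (group_ring G)"
proof -
  interpret group G by fact
  let ?Z = "group_ring G"
  have mult: "(f \<otimes>\<^bsub>?Z\<^esub> g) x =
      (if x \<in> carrier G then \<Sum>y\<in>carrier G. f y * g (inv\<^bsub>G\<^esub> y \<otimes>\<^bsub>G\<^esub> x) else 0)" for f g x
    by (simp add: group_ring_def)
  have add: "(f \<oplus>\<^bsub>?Z\<^esub> g) x = f x + g x" for f g x by (simp add: group_ring_def)
  have one: "\<one>\<^bsub>?Z\<^esub> x = (if x = \<one>\<^bsub>G\<^esub> then 1 else 0)" for x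
    by (simp add: group_ring_def indicator_def)
  have zero: "\<zero>\<^bsub>?Z\<^esub> x = 0" for x by (simp add: group_ring_def)
  have carr: "f \<in> carrier ?Z \<longleftrightarrow> (\<forall>x. x \<notin> carrier G \<longrightarrow> f x = 0)" for f
    by (simp add: group_ring_def)
  show ?thesis
  proof (rule ringI)
    show "abelian_group ?Z"
    proof (rule abelian_groupI)
      fix f assume f: "f \<in> carrier ?Z"
      show "\<exists>y\<in>carrier ?Z. y \<oplus>\<^bsub>?Z\<^esub> f = \<zero>\<^bsub>?Z\<^esub>"
        by (rule bexI[of _ "\<lambda>x. - f x"]) (use f in \<open>auto simp: carr add zero\<close>)
    qed (auto simp: carr add zero)
    show "Group.monoid ?Z"
    proof (rule monoidI)
      show "\<one>\<^bsub>?Z\<^esub> \<in> carrier ?Z" by (auto simp: carr one)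
      fix f g assume f: "f \<in> carrier ?Z"
      show "f \<otimes>\<^bsub>?Z\<^esub> g \<in> carrier ?Z" by (auto simp: carr mult)
    next
      fix f assume f: "f \<in> carrier ?Z"
      show "\<one>\<^bsub>?Z\<^esub> \<otimes>\<^bsub>?Z\<^esub> f = f"
      proof
        fix x
        have "(\<Sum>y\<in>carrier G. (if y = \<one>\<^bsub>G\<^esub> then 1 else 0) * f (inv\<^bsub>G\<^esub> y \<otimes>\<^bsub>G\<^esub> x)) = f x"
          if "x \<in> carrier G"
          using that fin by (subst sum.remove[of _ "\<one>\<^bsub>G\<^esub>"]) (auto intro!: sum.neutral)
        then show "(\<one>\<^bsub>?Z\<^esub> \<otimes>\<^bsub>?Z\<^esub> f) x = f x" using f by (simp add: mult one carr)
      qed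
      show "f \<otimes>\<^bsub>?Z\<^esub> \<one>\<^bsub>?Z\<^esub> = f"
      proof
        fix x
        have "(\<Sum>y\<in>carrier G. f y * (if inv\<^bsub>G\<^esub> y \<otimes>\<^bsub>G\<^esub> x = \<one>\<^bsub>G\<^esub> then 1 else 0)) = f x"
          if x: "x \<in> carrier G"
        proof -
          have "inv\<^bsub>G\<^esub> y \<otimes>\<^bsub>G\<^esub> x = \<one>\<^bsub>G\<^esub> \<longleftrightarrow> y = x" if "y \<in> carrier G" for y
            using that x by (metis inv_closed inv_equality inv_inv l_inv)
          then have "(\<Sum>y\<in>carrier G. f y * (if inv\<^bsub>G\<^esub> y \<otimes>\<^bsub>G\<^esub> x = \<one>\<^bsub>G\<^esub> then 1 else 0)) =
              (\<Sum>y\<in>carrier G. if y = x then f y else 0)"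
            by (intro sum.cong) auto
          then show ?thesis using fin x by simp
        qed
        then show "(f \<otimes>\<^bsub>?Z\<^esub> \<one>\<^bsub>?Z\<^esub>) x = f x" using f by (simp add: mult one carr)
      qed
    next
      fix f g h
      show "f \<otimes>\<^bsub>?Z\<^esub> g \<otimes>\<^bsub>?Z\<^esub> h = f \<otimes>\<^bsub>?Z\<^esub> (g \<otimes>\<^bsub>?Z\<^esub> h)"
      proof
        fix x
        have "(\<Sum>y\<in>carrier G. (\<Sum>z\<in>carrier G. f z * g (inv\<^bsub>G\<^esub> z \<otimes>\<^bsub>G\<^esub> y)) * h (inv\<^bsub>G\<^esub> y \<otimes>\<^bsub>G\<^esub> x)) =
            (\<Sum>z\<in>carrier G. f z * (\<Sum>w\<in>carrier G. g w * h (inv\<^bsub>G\<^esub> w \<otimes>\<^bsub>G\<^esub> (inv\<^bsub>G\<^esub> z \<otimes>\<^bsub>G\<^esub> x))))"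
          if x: "x \<in> carrier G"
        proof -
          have "(\<Sum>y\<in>carrier G. g (inv\<^bsub>G\<^esub> z \<otimes>\<^bsub>G\<^esub> y) * h (inv\<^bsub>G\<^esub> y \<otimes>\<^bsub>G\<^esub> x)) =
              (\<Sum>w\<in>carrier G. g w * h (inv\<^bsub>G\<^esub> w \<otimes>\<^bsub>G\<^esub> (inv\<^bsub>G\<^esub> z \<otimes>\<^bsub>G\<^esub> x)))"
            if z: "z \<in> carrier G" for z
          proof -
            have "inv\<^bsub>G\<^esub> w \<otimes>\<^bsub>G\<^esub> inv\<^bsub>G\<^esub> (inv\<^bsub>G\<^esub> z) \<otimes>\<^bsub>G\<^esub> (inv\<^bsub>G\<^esub> z \<otimes>\<^bsub>G\<^esub> x) = inv\<^bsub>G\<^esub> w \<otimes>\<^bsub>G\<^esub> x"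
              if "w \<in> carrier G" for w
              using that x z by (simp add: m_assoc) (simp add: m_assoc[symmetric])
            then show ?thesis
              by (intro sum.reindex_bij_witness[of _ "\<lambda>w. z \<otimes>\<^bsub>G\<^esub> w" "\<lambda>y. inv\<^bsub>G\<^esub> z \<otimes>\<^bsub>G\<^esub> y"])
                 (use x z in \<open>auto simp: m_assoc[symmetric] inv_mult_group\<close>)
          qed
          then have *: "(\<Sum>z\<in>carrier G. f z * (\<Sum>w\<in>carrier G. g w * h (inv\<^bsub>G\<^esub> w \<otimes>\<^bsub>G\<^esub> (inv\<^bsub>G\<^esub> z \<otimes>\<^bsub>G\<^esub> x)))) =
              (\<Sum>z\<in>carrier G. f z * (\<Sum>y\<in>carrier G. g (inv\<^bsub>G\<^esub> z \<otimes>\<^bsub>G\<^esub> y) * h (inv\<^bsub>G\<^esub> y \<otimes>\<^bsub>G\<^esub> x)))"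
            by simp
          show ?thesis
            unfolding * unfolding sum_distrib_left sum_distrib_right
            by (subst sum.swap) (simp only: mult.assoc)
        qed
        then show "(f \<otimes>\<^bsub>?Z\<^esub> g \<otimes>\<^bsub>?Z\<^esub> h) x = (f \<otimes>\<^bsub>?Z\<^esub> (g \<otimes>\<^bsub>?Z\<^esub> h)) x"
          by (simp add: mult)
      qed
    qed
    fix f g h
    show "(f \<oplus>\<^bsub>?Z\<^esub> g) \<otimes>\<^bsub>?Z\<^esub> h = f \<otimes>\<^bsub>?Z\<^esub> h \<oplus>\<^bsub>?Z\<^esub> g \<otimes>\<^bsub>?Z\<^esub> h"
      by (rule ext) (simp add: mult add algebra_simps sum.distrib)
    show "h \<otimes>\<^bsub>?Z\<^esub> (f \<oplus>\<^bsub>?Z\<^esub> g) = h \<otimes>\<^bsub>?Z\<^esub> f \<oplus>\<^bsub>?Z\<^esub> h \<otimes>\<^bsub>?Z\<^esub> g"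
      by (rule ext) (simp add: mult add algebra_simps sum.distrib)
  qed
qed

definition int_span :: "('a \<Rightarrow> int) set \<Rightarrow> ('a \<Rightarrow> int) set" where
  "int_span B = {(\<lambda>x. \<Sum>b\<in>B. c b * b x) | c. True}"

definition int_basis :: "('a \<Rightarrow> int) set \<Rightarrow> ('a \<Rightarrow> int) set \<Rightarrow> bool" where
  "int_basis A B \<longleftrightarrow> finite B \<and> B \<subseteq> A \<and> A = int_span B \<and>
     (\<forall>c. (\<lambda>x. \<Sum>b\<in>B. c b * b x) = (\<lambda>_. 0) \<longrightarrow> (\<forall>b\<in>B. c b = 0))"

text \<open>The function \<open>indicator X\<close> is the element \<open>\<Sum>x\<in>X. x\<close> of the group ring.\<close>

definition is_basic_partition ::
  "('a, 'b) monoid_scheme \<Rightarrow> ('a \<Rightarrow> int) set \<Rightarrow> 'a set set \<Rightarrow> bool" where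
  "is_basic_partition G A S \<longleftrightarrow>
     partition_on (carrier G) S \<and>
     int_basis A (indicator ` S) \<and>
     {\<one>\<^bsub>G\<^esub>} \<in> S \<and>
     (\<forall>X\<in>S. set_inv\<^bsub>G\<^esub> X \<in> S)"

definition S_ring :: "('a, 'b) monoid_scheme \<Rightarrow> ('a \<Rightarrow> int) set \<Rightarrow> bool" where
  "S_ring G A \<longleftrightarrow> subring A (group_ring G) \<and> (\<exists>S. is_basic_partition G A S)"

definition basic_sets :: "('a, 'b) monoid_scheme \<Rightarrow> ('a \<Rightarrow> int) set \<Rightarrow> 'a set set" where
  "basic_sets G A = (THE S. is_basic_partition G A S)"

lemma basic_partition_block:
  assumes S: "is_basic_partition G A S" and X: "X \<in> S" and x: "x \<in> X"
  shows "X = {y \<in> carrier G. \<forall>f\<in>A. f x = f y}"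
proof -
  have part: "partition_on (carrier G) S" and A: "A = int_span (indicator ` S)"
    and sub: "indicator ` S \<subseteq> A"
    using S by (auto simp: is_basic_partition_def int_basis_def)
  have XG: "X \<subseteq> carrier G"
    using part X by (auto simp: partition_on_def)
  have same: "(indicator Y :: 'a \<Rightarrow> int) x = indicator Y y" if "Y \<in> S" "y \<in> X" for Y y
    using partition_onD2[OF part] that X x by (auto simp: indicator_def disjoint_def)
  show ?thesis
  proof (intro equalityI subsetI)
    fix y assume y: "y \<in> X"
    have "f x = f y" if "f \<in> A" for f
      using that y unfolding A int_span_def by (auto intro!: sum.cong simp: same)
    then show "y \<in> {y \<in> carrier G. \<forall>f\<in>A. f x = f y}" using y XG by auto
  next
    fix y assume y: "y \<in> {y \<in> carrier G. \<forall>f\<in>A. f x = f y}"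
    have "indicator X \<in> A" using sub X by auto
    with y have "(indicator X :: 'a \<Rightarrow> int) x = indicator X y" by auto
    then show "y \<in> X" using x by (auto simp: indicator_def split: if_splits)
  qed
qed

lemma basic_partition_unique:
  assumes S: "is_basic_partition G A S" and T: "is_basic_partition G A T"
  shows "S = T"
proof -
  have *: "U \<subseteq> V" if U: "is_basic_partition G A U" and V: "is_basic_partition G A V" for U V
  proof
    fix X assume X: "X \<in> U"
    have pU: "partition_on (carrier G) U" and pV: "partition_on (carrier G) V"
      using U V by (auto simp: is_basic_partition_def)
    obtain x where x: "x \<in> X" using pU X by (metis partition_onD3 all_not_in_conv)
    then have "x \<in> \<Union>V" using pU pV X by (auto simp: partition_on_def)
    then obtain Y where Y: "Y \<in> V" "x \<in> Y" by auto
    have "X = Y"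
      using basic_partition_block[OF U X x] basic_partition_block[OF V Y] by simp
    then show "X \<in> V" using Y by simp
  qed
  show ?thesis using *[OF S T] *[OF T S] by auto
qed

lemma basic_sets_eq: "is_basic_partition G A S \<Longrightarrow> basic_sets G A = S"
  unfolding basic_sets_def by (rule the_equality, assumption, rule basic_partition_unique)


section \<open>Components of a finite commutative ring and CG-rings\<close>

definition prime_set :: "('a, 'b) ring_scheme \<Rightarrow> nat set" where
  "prime_set R = {p. Factorial_Ring.prime p \<and> p dvd Coset.order R}"

definition p_component :: "('a, 'b) ring_scheme \<Rightarrow> nat \<Rightarrow> 'a set" where
  "p_component R p = {x \<in> carrier R. \<exists>k. [(p ^ k)] \<cdot>\<^bsub>R\<^esub> x = \<zero>\<^bsub>R\<^esub>}"

lemma comm_group_sylow: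
  fixes p :: nat
  assumes "comm_group G" and fin: "finite (carrier G)" and p: "Factorial_Ring.prime p"
    and H: "subgroup H G" and cH: "card H = p ^ multiplicity p (Coset.order G)"
  shows "H = {x \<in> carrier G. \<exists>k. x [^]\<^bsub>G\<^esub> (p ^ k) = \<one>\<^bsub>G\<^esub>}"
proof -
  interpret G: comm_group G by fact
  interpret N: normal H G by (rule G.subgroup_imp_normal[OF H])
  interpret Q: group "G Mod H" by (rule N.factorgroup_is_group)
  have lag: "card (rcosets\<^bsub>G\<^esub> H) * card H = Coset.order G" using G.lagrange[OF H] .
  define m where "m = card (rcosets\<^bsub>G\<^esub> H)"
  have opos: "Coset.order G \<noteq> 0" using fin by (auto simp: order_def)
  have cop: "coprime (p ^ k) m" for k
  proof -
    have "Coset.order G = p ^ multiplicity p (Coset.order G) * m"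
      using lag cH unfolding m_def by (simp add: mult.commute)
    moreover have "\<not> is_unit p" using p by (auto simp: prime_nat_iff)
    ultimately have "\<not> p dvd m" using opos
      by (metis multiplicity_decompose mult_cancel_left nonzero_mult_div_cancel_left mult_eq_0_iff)
    then show ?thesis using p by (simp add: prime_imp_coprime coprime_power_left_iff)
  qed
  let ?P = "{x \<in> carrier G. \<exists>k. x [^]\<^bsub>G\<^esub> (p ^ k) = \<one>\<^bsub>G\<^esub>}"
  show "H = ?P"
  proof (intro equalityI subsetI)
    fix x assume x: "x \<in> H"
    then have xG: "x \<in> carrier G" using subgroup.subset[OF H] by auto
    interpret HG: group "G\<lparr>carrier := H\<rparr>" by (rule subgroup.subgroup_is_group[OF H G.is_group])
    have "x [^]\<^bsub>G\<lparr>carrier := H\<rparr>\<^esub> Coset.order (G\<lparr>carrier := H\<rparr>) = \<one>\<^bsub>G\<lparr>carrier := H\<rparr>\<^esub>"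
      by (rule HG.pow_order_eq_1) (use x in auto)
    then have "x [^]\<^bsub>G\<^esub> card H = \<one>\<^bsub>G\<^esub>"
      using G.nat_pow_consistent[of x "card H" H] by (simp add: order_def)
    then show "x \<in> ?P"
      using xG cH by auto
  next
    fix x assume "x \<in> ?P"
    then obtain k where x: "x \<in> carrier G" and k: "x [^]\<^bsub>G\<^esub> (p ^ k) = \<one>\<^bsub>G\<^esub>"
      by auto
    have hom: "group_hom G (G Mod H) (\<lambda>a. H #>\<^bsub>G\<^esub> a)"
      using N.r_coset_hom_Mod by (intro group_hom.intro group_hom_axioms.intro) (auto intro: G.is_group Q.is_group)
    have xc: "H #>\<^bsub>G\<^esub> x \<in> carrier (G Mod H)" using group_hom.hom_closed[OF hom x] .
    have e1: "(H #>\<^bsub>G\<^esub> x) [^]\<^bsub>G Mod H\<^esub> (p ^ k) = \<one>\<^bsub>G Mod H\<^esub>"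
      using group_hom.hom_nat_pow[OF hom x, of "p ^ k"] k group_hom.hom_one[OF hom] by simp
    have e2: "(H #>\<^bsub>G\<^esub> x) [^]\<^bsub>G Mod H\<^esub> m = \<one>\<^bsub>G Mod H\<^esub>"
      using Q.pow_order_eq_1[OF xc] by (simp add: m_def order_def FactGroup_def)
    have "Q.ord (H #>\<^bsub>G\<^esub> x) dvd p ^ k" "Q.ord (H #>\<^bsub>G\<^esub> x) dvd m"
      using e1 e2 Q.pow_eq_id[OF xc] by auto
    then have "Q.ord (H #>\<^bsub>G\<^esub> x) = 1"
      using cop[of k] by (metis coprime_common_divisor_nat)
    then have "(H #>\<^bsub>G\<^esub> x) = \<one>\<^bsub>G Mod H\<^esub>" using Q.ord_eq_1[OF xc] by simp
    then have "H #>\<^bsub>G\<^esub> x = H" by (simp add: FactGroup_def)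
    then show "x \<in> H" using G.coset_join1[OF _ x H] by simp
  qed
qed

text \<open>The \<open>p\<close>-component is the Sylow \<open>p\<close>-subgroup of the additive group.\<close>

lemma p_component_sylow:
  assumes "cring R" and "finite (carrier R)" and "Factorial_Ring.prime p"
    and "subgroup H (add_monoid R)" and "card H = p ^ multiplicity p (Coset.order R)"
  shows "H = p_component R p"
proof -
  interpret cring R by fact
  have "Coset.order (add_monoid R) = Coset.order R" by (simp add: order_def)
  then have "card H = p ^ multiplicity p (Coset.order (add_monoid R))" using assms by simp
  from comm_group_sylow[OF a_comm_group _ assms(3,4) this] assms(2)
  have "H = {x \<in> carrier (add_monoid R). \<exists>k. x [^]\<^bsub>add_monoid R\<^esub> (p ^ k) = \<one>\<^bsub>add_monoid R\<^esub>}"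
    by simp
  also have "\<dots> = p_component R p"
    by (simp add: p_component_def add_pow_def)
  finally show ?thesis .
qed

text \<open>The identity of the component is in general not the identity of the ambient ring.\<close>

definition p_component_one :: "('a, 'b) ring_scheme \<Rightarrow> nat \<Rightarrow> 'a" where
  "p_component_one R p =
     (THE e. e \<in> p_component R p \<and> (\<forall>x\<in>p_component R p. e \<otimes>\<^bsub>R\<^esub> x = x))"

definition p_component_ring :: "('a, 'b) ring_scheme \<Rightarrow> nat \<Rightarrow> ('a, 'b) ring_scheme" where
  "p_component_ring R p = R\<lparr>carrier := p_component R p, monoid.one := p_component_one R p\<rparr>"

definition Q_component :: "('a, 'b) ring_scheme \<Rightarrow> nat set \<Rightarrow> 'a set" where
  "Q_component R Q = {finsum R f Q | f. f \<in> (\<Pi> p\<in>Q. p_component R p)}"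

text \<open>
  The units all of whose \<open>p\<close>-components with \<open>p \<notin> Q\<close> are the identity of the
  \<open>p\<close>-component of the ring.
\<close>

definition Q_units :: "('a, 'b) ring_scheme \<Rightarrow> nat set \<Rightarrow> 'a set" where
  "Q_units R Q =
     {u \<in> Units R. \<exists>f \<in> (\<Pi> p\<in>prime_set R. p_component R p).
        u = finsum R f (prime_set R) \<and> (\<forall>p \<in> prime_set R - Q. f p = p_component_one R p)}"

definition local_ring :: "('a, 'b) ring_scheme \<Rightarrow> bool" where
  "local_ring R \<longleftrightarrow> cring R \<and> (\<exists>!M. maximalideal M R)"

definition jacobson_radical :: "('a, 'b) ring_scheme \<Rightarrow> 'a set" where
  "jacobson_radical R = carrier R \<inter> \<Inter>{M. maximalideal M R}"

definition CG_ring :: "('a, 'b) ring_scheme \<Rightarrow> bool" where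
  "CG_ring R \<longleftrightarrow> (\<forall>p \<in> prime_set R.
     local_ring (p_component_ring R p) \<and>
     jacobson_radical (p_component_ring R p) = {[p] \<cdot>\<^bsub>R\<^esub> x | x. x \<in> p_component R p})"


section \<open>S-rings over a ring\<close>

definition S_ring_over :: "('a, 'b) ring_scheme \<Rightarrow> ('a \<Rightarrow> int) set \<Rightarrow> bool" where
  "S_ring_over R A \<longleftrightarrow> S_ring (add_monoid R) A \<and>
     (\<forall>X \<in> basic_sets (add_monoid R) A. \<forall>u \<in> Units R.
        (\<lambda>x. u \<otimes>\<^bsub>R\<^esub> x) ` X \<in> basic_sets (add_monoid R) A)"

definition A_ideal :: "('a, 'b) ring_scheme \<Rightarrow> ('a \<Rightarrow> int) set \<Rightarrow> 'a set \<Rightarrow> bool" where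
  "A_ideal R A I \<longleftrightarrow> ideal I R \<and> (\<exists>T \<subseteq> basic_sets (add_monoid R) A. I = \<Union>T)"

definition max_A_ideals :: "('a, 'b) ring_scheme \<Rightarrow> ('a \<Rightarrow> int) set \<Rightarrow> 'a set set" where
  "max_A_ideals R A = {I. A_ideal R A I \<and> I \<noteq> carrier R \<and>
     (\<forall>K. A_ideal R A K \<and> K \<noteq> carrier R \<and> I \<subseteq> K \<longrightarrow> K = I)}"

definition ideal_group :: "('a, 'b) ring_scheme \<Rightarrow> 'a set \<Rightarrow> ('a, 'b) monoid_scheme" where
  "ideal_group R I = (add_monoid R)\<lparr>carrier := I\<rparr>"

definition S_ring_restrict ::
  "('a, 'b) ring_scheme \<Rightarrow> ('a \<Rightarrow> int) set \<Rightarrow> 'a set \<Rightarrow> ('a \<Rightarrow> int) set" where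
  "S_ring_restrict R A I = int_span (indicator ` {X \<in> basic_sets (add_monoid R) A. X \<subseteq> I})"

lemma basic_sets_S_ring_restrict:
  assumes R: "cring R" and fin: "finite (carrier R)" and A: "S_ring (add_monoid R) A"
    and I: "A_ideal R A I"
  shows "basic_sets (ideal_group R I) (S_ring_restrict R A I) =
           {X \<in> basic_sets (add_monoid R) A. X \<subseteq> I}"
proof (rule basic_sets_eq)
  interpret R: cring R by fact
  let ?G = "add_monoid R"
  let ?S = "basic_sets ?G A"
  let ?T = "{X \<in> ?S. X \<subseteq> I}"
  have idl: "ideal I R" using I by (simp add: A_ideal_def)
  then have sg: "subgroup I ?G" by (simp add: additive_subgroup.a_subgroup ideal.axioms(1))
  have grp: "group ?G" by (rule R.a_group)
  have bp: "is_basic_partition ?G A ?S"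
  proof -
    obtain S where S: "is_basic_partition ?G A S" using A unfolding S_ring_def by blast
    show ?thesis unfolding basic_sets_eq[OF S] by (rule S)
  qed
  then have part: "partition_on (carrier R) ?S" and basis: "int_basis A (indicator ` ?S)"
    and one: "{\<zero>\<^bsub>R\<^esub>} \<in> ?S" and inv: "\<And>X. X \<in> ?S \<Longrightarrow> set_inv\<^bsub>?G\<^esub> X \<in> ?S"
    by (auto simp: is_basic_partition_def)
  have finS: "finite ?S" using partition_onD1[OF part] fin by (simp add: finite_UnionD)
  have UT: "\<Union>?T = I"
    using I by (auto simp: A_ideal_def)
  have pT: "partition_on I ?T"
    using part UT by (auto simp: partition_on_def disjoint_def)
  have invT: "set_inv\<^bsub>?G\<^esub> X \<subseteq> I" if "X \<subseteq> I" for X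
    using subgroup.m_inv_closed[OF sg] that by (auto simp: SET_INV_def)
  have invG: "set_inv\<^bsub>ideal_group R I\<^esub> X = set_inv\<^bsub>?G\<^esub> X" if "X \<subseteq> I" for X
    unfolding SET_INV_def ideal_group_def
  proof (rule SUP_cong[OF refl])
    fix h assume "h \<in> X"
    then have "h \<in> I" using that by blast
    from group.m_inv_consistent[OF grp sg this]
    show "{inv\<^bsub>?G\<lparr>carrier := I\<rparr>\<^esub> h} = {inv\<^bsub>?G\<^esub> h}" by (rule arg_cong)
  qed
  have indep: "\<forall>b\<in>indicator ` ?T. c b = 0"
    if c: "(\<lambda>x. \<Sum>b\<in>indicator ` ?T. c b * b x) = (\<lambda>_. 0 :: int)" for c
  proof -
    define d where "d b = (if b \<in> indicator ` ?T then c b else 0)" for b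
    have "(\<Sum>b\<in>indicator ` ?S. d b * b x) = (\<Sum>b\<in>indicator ` ?T. c b * b x)" for x
      by (rule sum.mono_neutral_cong_right) (use finS in \<open>auto simp: d_def\<close>)
    then have "(\<lambda>x. \<Sum>b\<in>indicator ` ?S. d b * b x) = (\<lambda>_. 0)" using c by simp
    then have "\<forall>b\<in>indicator ` ?S. d b = 0"
      using basis unfolding int_basis_def by blast
    then show ?thesis by (auto simp: d_def)
  qed
  have sub: "B \<subseteq> int_span B" if "finite B" for B :: "('a \<Rightarrow> int) set"
  proof
    fix b assume b: "b \<in> B"
    have "b = (\<lambda>x. \<Sum>a\<in>B. (if a = b then 1 else 0) * a x)"
    proof
      fix x
      have "(\<Sum>a\<in>B. (if a = b then 1 else 0) * a x) = (\<Sum>a\<in>B. if a = b then a x else 0)"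
        by (rule sum.cong) auto
      then show "b x = (\<Sum>a\<in>B. (if a = b then 1 else 0) * a x)" using b that by simp
    qed
    then show "b \<in> int_span B"
      unfolding int_span_def mem_Collect_eq
      by (rule exI[of _ "\<lambda>a. if a = b then 1 else 0", OF conjI[OF _ TrueI]])
  qed
  have zI: "\<zero>\<^bsub>R\<^esub> \<in> I" using subgroup.one_closed[OF sg] by simp
  show "is_basic_partition (ideal_group R I) (S_ring_restrict R A I) ?T"
    unfolding is_basic_partition_def int_basis_def S_ring_restrict_def
  proof (intro conjI)
    show "partition_on (carrier (ideal_group R I)) ?T" using pT by (simp add: ideal_group_def)
    show "finite (indicator ` ?T)" using finS by auto
    show "indicator ` ?T \<subseteq> int_span (indicator ` ?T)" using finS by (intro sub) auto
    show "{\<one>\<^bsub>ideal_group R I\<^esub>} \<in> ?T" using one zI by (simp add: ideal_group_def)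
    show "\<forall>X\<in>?T. set_inv\<^bsub>ideal_group R I\<^esub> X \<in> ?T"
      using inv invT by (auto simp: invG)
    show "int_span (indicator ` ?T) = int_span (indicator ` ?T)" by (rule refl)
    show "\<forall>c. (\<lambda>x. \<Sum>b\<in>indicator ` ?T. c b * b x) = (\<lambda>_. 0 :: int) \<longrightarrow>
        (\<forall>b\<in>indicator ` ?T. c b = 0)"
    proof (rule allI, rule impI)
      fix c assume c: "(\<lambda>x. \<Sum>b\<in>indicator ` ?T. c b * b x) = (\<lambda>_. 0 :: int)"
      show "\<forall>b\<in>indicator ` ?T. c b = 0" by (rule indep[OF c])
    qed
  qed
qed

definition Q_rational :: "('a, 'b) ring_scheme \<Rightarrow> nat set \<Rightarrow> 'a set \<Rightarrow> bool" where
  "Q_rational R Q X \<longleftrightarrow> Q_units R Q <#>\<^bsub>R\<^esub> X = X"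

definition I_L :: "('a, 'b) ring_scheme \<Rightarrow> 'a set \<Rightarrow> 'a set" where
  "I_L R X = (GREATEST K. ideal K R \<and> X <+>\<^bsub>R\<^esub> K = X)"

definition satisfies_condition ::
  "('a, 'b) ring_scheme \<Rightarrow> ('a \<Rightarrow> int) set \<Rightarrow> 'a set \<Rightarrow> 'a set \<Rightarrow> bool" where
  "satisfies_condition R A I J \<longleftrightarrow> A_ideal R A I \<and> A_ideal R A J \<and> J \<subseteq> I \<and>
     (\<forall>X \<in> basic_sets (add_monoid R) A. X \<subseteq> carrier R - I \<longrightarrow> J \<subseteq> I_L R X)"

definition is_tensor ::
  "('a, 'b) ring_scheme \<Rightarrow> ('a \<Rightarrow> int) set \<Rightarrow> 'a set \<Rightarrow> 'a set \<Rightarrow> bool" where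
  "is_tensor R A I K \<longleftrightarrow>
     I <+>\<^bsub>R\<^esub> K = carrier R \<and> I \<inter> K = {\<zero>\<^bsub>R\<^esub>} \<and>
     basic_sets (add_monoid R) A =
       {X1 <+>\<^bsub>R\<^esub> X2 | X1 X2. X1 \<in> basic_sets (ideal_group R I) (S_ring_restrict R A I) \<and>
                              X2 \<in> basic_sets (ideal_group R K) (S_ring_restrict R A K)}"

definition I_star :: "('a, 'b) ring_scheme \<Rightarrow> ('a \<Rightarrow> int) set \<Rightarrow> nat set \<Rightarrow> 'a set" where
  "I_star R A Q = \<Inter>{K. A_ideal R A K \<and> Q_component R Q \<subseteq> K}"

end

(*
  Let N be the largest A-ideal under which all basic sets outside I are invariant; maximality of I
  gives N <= I, and the claim is that I /\ I* <= N. For p in Q put E = {x. p x in N} (below: tors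
  p). The elements of E in R_p but not in N form one orbit, modulo N, of the units of R_p, and a
  basic set B outside I is a union of cosets of E apart from its elements whose p-component lies
  in E. Schur's p-th power map, taken modulo N, therefore shows that the elements y with zero
  p-component such that y + E meets B without being contained in B form, modulo N, an A-set Y(B)
  (below: slice p B); by maximality Y(B) <= I. As E is not contained in N, this forces I and N to
  have the same p-component.

  Now let X be the basic set of some k in E - N with k in R_p. For every B, X + Y(B) <= B, since
  this holds for k and the number of y in Y(B) with x + y in B is the same for all x in X. For B =
  X it follows that Y(X) is an A-ideal stabilizing every B, so Y(X) <= N. The q-th power maps with
  q not in Q then force X <= R_Q + N, hence I* <= R_Q + N and I /\ I* <= N. If I /\ I* = 0, every
  basic set outside I is of the form X + X1 with a basic set X1 in I, which is the tensor
  decomposition.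
*)
theory Submission
  imports Defs "HOL-Number_Theory.Cong" "HOL-Combinatorics.Multiset_Permutations"
    "HOL-Algebra.Divisibility"
begin

section \<open>Primary idempotents of a finite commutative ring\<close>

text \<open>Schur's theorem gives information about the elements \<open>p y\<close>, whereas
  \<open>slice p B\<close> has to consist of the elements \<open>y\<close> themselves, and
  multiplication by \<open>p\<close> does not permute basic sets. The way back is
  \<open>twist p\<close>, a genuine unit of the ring that acts as \<open>p\<close> on every
  component except the \<open>p\<close>-component. On elements whose \<open>p\<close>-component lies
  in \<open>N\<close> the two multiplications agree modulo \<open>N\<close>, so there the factor
  \<open>p\<close> can be undone by a unit, and units do permute basic sets. The Galois ring
  hypothesis enters in two ways. Every element of a component is a power of \<open>p\<close> times a
  unit; this yields the single unit orbit in E outside N and the absorption of E by elements of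
  larger order modulo N. And every element of the radical is a difference of two units; this makes
  additive subgroups that are stable under units into ideals, although an S-ring over a ring is only
  required to be compatible with units.\<close>

locale finite_cring = cring R for R :: "('a, 'b) ring_scheme" (structure) +
  assumes finite_carrier: "finite (carrier R)"
begin

lemma order_pos: "0 < Coset.order R"
  using finite_carrier by (auto simp: order_def card_gt_0_iff)

lemma nat_mult_closed [simp, intro]: "x \<in> carrier R \<Longrightarrow> [(n::nat)] \<cdot> x \<in> carrier R"
  by (rule add.nat_pow_closed)

lemma nat_mult_mult: "x \<in> carrier R \<Longrightarrow> [(m::nat)] \<cdot> ([(n::nat)] \<cdot> x) = [(m * n)] \<cdot> x"
  using add.nat_pow_pow[of x m n] by (simp add: mult.commute)

lemma nat_mult_one: "x \<in> carrier R \<Longrightarrow> [(m::nat)] \<cdot> x = ([m] \<cdot> \<one>) \<otimes> x"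
  by (simp add: add_pow_ldistr)

lemma order_mult_eq_zero: "x \<in> carrier R \<Longrightarrow> [Coset.order R] \<cdot> x = \<zero>"
  using add.pow_order_eq_1[of x] by (simp add: order_def)

lemma ideal_nat_mult:
  assumes "ideal H R" "x \<in> H"
  shows "[(m::nat)] \<cdot> x \<in> H"
  using assms nat_mult_one[of x m] ideal.I_l_closed[OF assms, of "[m] \<cdot> \<one>"]
    ideal.Icarr[OF assms] by simp

text \<open>Turns congruences between integers into ring identities: the facts on
  \<open>idem\<close> below are read off from the residues of its integer coefficient.\<close>

lemma nat_mult_cong:
  assumes x: "x \<in> carrier R" and m: "[(m::nat)] \<cdot> x = \<zero>" and kl: "[k = l] (mod m)"
  shows "[k] \<cdot> x = [l] \<cdot> x"
proof -
  have *: "[(i + m * j)] \<cdot> x = [i] \<cdot> x" for i j :: nat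
    using x m nat_mult_mult[of x j m] by (simp add: add.nat_pow_mult[symmetric] mult.commute)
  from kl obtain i j where "k + m * i = l + m * j"
    unfolding cong_iff_lin_nat by (metis mult.commute)
  then show ?thesis using * by metis
qed

definition prime_part :: "nat \<Rightarrow> nat" where
  "prime_part p = p ^ multiplicity p (Coset.order R)"

lemma prime_part_dvd: "prime_part p dvd Coset.order R"
  by (simp add: prime_part_def multiplicity_dvd)

lemma coprime_prime_part:
  assumes "Factorial_Ring.prime p"
  shows "coprime (prime_part p) (Coset.order R div prime_part p)"
proof -
  have "\<not> is_unit p" using assms by (auto simp: prime_nat_iff)
  then have "\<not> p dvd Coset.order R div prime_part p"
    using order_pos unfolding prime_part_def
    by (metis multiplicity_decompose nonzero_mult_div_cancel_left mult_eq_0_iff less_numeral_extra(3))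
  then show ?thesis using assms
    by (simp add: prime_part_def prime_imp_coprime coprime_power_left_iff)
qed

text \<open>A Chinese remainder solution: multiplication by it is the identity on the
  \<open>p\<close>-component and zero on all others. For a prime \<open>p\<close> not dividing the
  order it makes \<open>idem p\<close> zero.\<close>

definition idem_coeff :: "nat \<Rightarrow> nat" where
  "idem_coeff p = (SOME c. [c = 1] (mod prime_part p) \<and>
     [c = 0] (mod (Coset.order R div prime_part p)))"

definition idem :: "nat \<Rightarrow> 'a" where
  "idem p = [idem_coeff p] \<cdot> \<one>"

lemma idem_coeff_cong:
  assumes "Factorial_Ring.prime p"
  shows "[idem_coeff p = 1] (mod prime_part p)"
    and "Coset.order R div prime_part p dvd idem_coeff p"
  using someI_ex[OF binary_chinese_remainder_nat[OF coprime_prime_part[OF assms], of 1 0]]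
  by (auto simp: idem_coeff_def cong_0_iff)

lemma idem_closed [simp, intro]: "idem p \<in> carrier R"
  by (simp add: idem_def)

lemma idem_mult: "x \<in> carrier R \<Longrightarrow> idem p \<otimes> x = [idem_coeff p] \<cdot> x"
  unfolding idem_def by (rule nat_mult_one[symmetric])

lemma prime_part_mult_idem:
  assumes p: "Factorial_Ring.prime p" and x: "x \<in> carrier R"
  shows "[prime_part p] \<cdot> (idem p \<otimes> x) = \<zero>"
proof -
  obtain t where "idem_coeff p = Coset.order R div prime_part p * t"
    using idem_coeff_cong(2)[OF p] by blast
  then have "prime_part p * idem_coeff p = t * Coset.order R"
    using prime_part_dvd[of p] by simp
  then show ?thesis
    using x order_mult_eq_zero[OF x] nat_mult_mult[OF x, of t "Coset.order R"]
    by (simp add: idem_mult nat_mult_mult)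
qed

text \<open>An element killed by a power of \<open>p\<close> is also killed by the order of the
  ring, hence by \<open>prime_part p\<close>, and modulo that number the coefficient of
  \<open>idem p\<close> is 1. From here on membership in a component is an equation.\<close>

lemma p_component_eq:
  assumes p: "Factorial_Ring.prime p"
  shows "p_component R p = {x \<in> carrier R. idem p \<otimes> x = x}"
proof (intro equalityI subsetI)
  fix x assume "x \<in> {x \<in> carrier R. idem p \<otimes> x = x}"
  then show "x \<in> p_component R p"
    using prime_part_mult_idem[OF p, of x] unfolding p_component_def prime_part_def by auto
next
  fix x assume "x \<in> p_component R p"
  then obtain k where x: "x \<in> carrier R" and k: "[(p ^ k)] \<cdot> x = \<zero>"
    by (auto simp: p_component_def)
  have g: "gcd (p ^ k) (Coset.order R) dvd prime_part p"
  proof -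
    obtain j where j: "gcd (p ^ k) (Coset.order R) = p ^ j"
      using p by (metis divides_primepow_nat gcd_dvd1)
    then have "p ^ j dvd Coset.order R" by (metis gcd_dvd2)
    then have "j \<le> multiplicity p (Coset.order R)"
      using p order_pos by (intro multiplicity_geI) auto
    then show ?thesis using j by (simp add: prime_part_def le_imp_power_dvd)
  qed
  have "add.ord x dvd p ^ k" "add.ord x dvd Coset.order R"
    using k order_mult_eq_zero[OF x] add.pow_eq_id[of x] x by auto
  then have "add.ord x dvd prime_part p" using g by (meson dvd_trans gcd_greatest)
  then have "[prime_part p] \<cdot> x = \<zero>" using add.pow_eq_id[of x] x by auto
  from nat_mult_cong[OF x this idem_coeff_cong(1)[OF p]]
  show "x \<in> {x \<in> carrier R. idem p \<otimes> x = x}" using x by (simp add: idem_mult)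
qed

lemma idem_idem:
  assumes p: "Factorial_Ring.prime p"
  shows "idem p \<otimes> idem p = idem p"
proof -
  have "[prime_part p] \<cdot> (idem p) = \<zero>" using prime_part_mult_idem[OF p, of \<one>] by simp
  from nat_mult_cong[OF idem_closed this idem_coeff_cong(1)[OF p]]
  show ?thesis by (simp add: idem_mult)
qed

lemma idem_orth:
  assumes p: "Factorial_Ring.prime p" and q: "Factorial_Ring.prime q" and "p \<noteq> q"
  shows "idem p \<otimes> idem q = \<zero>"
proof -
  have "coprime (prime_part p) (prime_part q)"
    using assms by (simp add: prime_part_def primes_coprime)
  moreover have "prime_part p dvd (Coset.order R div prime_part q) * prime_part q"
    using prime_part_dvd[of q] prime_part_dvd[of p] by simp
  ultimately have "prime_part p dvd Coset.order R div prime_part q"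
    using coprime_dvd_mult_left_iff by blast
  then have "prime_part p dvd idem_coeff q"
    using idem_coeff_cong(2)[OF q] dvd_trans by blast
  then have "(Coset.order R div prime_part p) * prime_part p dvd idem_coeff p * idem_coeff q"
    using idem_coeff_cong(2)[OF p] mult_dvd_mono by blast
  then have "Coset.order R dvd idem_coeff p * idem_coeff q"
    using prime_part_dvd[of p] by simp
  then obtain t where "idem_coeff p * idem_coeff q = t * Coset.order R"
    by (metis dvdE mult.commute)
  then show ?thesis
    using order_mult_eq_zero[of \<one>] nat_mult_mult[of \<one> t "Coset.order R"]
    by (simp add: idem_mult) (simp add: idem_def nat_mult_mult)
qed

lemma finite_prime_set: "finite (prime_set R)"
  unfolding prime_set_def
  by (rule finite_subset[of _ "{d. d dvd Coset.order R}"]) (use order_pos in auto)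

lemma prime_set_prime: "p \<in> prime_set R \<Longrightarrow> Factorial_Ring.prime p"
  by (simp add: prime_set_def)

text \<open>A prime \<open>p\<close> dividing the additive order of a nonzero \<open>x\<close> would
  divide the coefficient of \<open>idem p\<close>, which is 1 modulo \<open>p\<close>.\<close>

lemma eq_zero_if_idem_zero:
  assumes x: "x \<in> carrier R" and "\<And>p. p \<in> prime_set R \<Longrightarrow> idem p \<otimes> x = \<zero>"
  shows "x = \<zero>"
proof (rule ccontr)
  assume "x \<noteq> \<zero>"
  then have "add.ord x \<noteq> 1" using add.ord_eq_1[of x] x by simp
  then obtain p where p: "Factorial_Ring.prime p" "p dvd add.ord x"
    using prime_factor_nat by blast
  have "add.ord x dvd Coset.order R"
    using order_mult_eq_zero[OF x] add.pow_eq_id[of x] x by auto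
  then have pn: "p dvd Coset.order R" using p(2) dvd_trans by blast
  then have "p \<in> prime_set R" using p by (simp add: prime_set_def)
  with assms have "add.ord x dvd idem_coeff p"
    using add.pow_eq_id[of x] by (auto simp: idem_mult)
  then have "p dvd idem_coeff p" using p(2) dvd_trans by blast
  moreover have "p dvd prime_part p"
    unfolding prime_part_def using pn p(1) order_pos
    by (intro dvd_power) (simp add: prime_multiplicity_gt_zero_iff)
  then have "[idem_coeff p = 1] (mod p)"
    using idem_coeff_cong(1)[OF p(1)] cong_dvd_modulus_nat by blast
  ultimately have "p dvd 1" by (simp add: cong_dvd_iff)
  then show False using p(1) by auto
qed

lemma finsum_idem: "finsum R idem (prime_set R) = \<one>"
proof -
  let ?s = "finsum R idem (prime_set R)"
  have s: "?s \<in> carrier R" by (rule finsum_closed) auto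
  have "idem p \<otimes> ?s = idem p" if p: "p \<in> prime_set R" for p
  proof -
    have "idem p \<otimes> ?s = finsum R (\<lambda>q. idem p \<otimes> idem q) (prime_set R)"
      by (rule finsum_rdistr[OF finite_prime_set]) auto
    also have "\<dots> = finsum R (\<lambda>q. if p = q then idem q else \<zero>) (prime_set R)"
      by (rule finsum_cong') (use p idem_idem idem_orth prime_set_prime in auto)
    also have "\<dots> = idem p"
      using add.finprod_singleton[OF p finite_prime_set, of idem] by auto
    finally show ?thesis .
  qed
  then have "idem p \<otimes> (\<one> \<ominus> ?s) = \<zero>" if "p \<in> prime_set R" for p
    unfolding minus_eq using r_distr[OF one_closed a_inv_closed[OF s] idem_closed[of p]]
      r_minus[OF idem_closed[of p] s] that r_neg[OF idem_closed[of p]] by auto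
  then have "\<one> \<ominus> ?s = \<zero>"
    by (rule eq_zero_if_idem_zero[OF minus_closed[OF one_closed s]])
  then show ?thesis using s by (metis one_closed r_right_minus_eq)
qed

lemma finsum_idem_mult:
  assumes "x \<in> carrier R"
  shows "finsum R (\<lambda>p. idem p \<otimes> x) (prime_set R) = x"
  using finsum_ldistr[OF finite_prime_set assms, of idem] assms finsum_idem by auto

lemma additive_subgroup_finsum:
  assumes "additive_subgroup H R" and "finite P" "\<And>p. p \<in> P \<Longrightarrow> f p \<in> H"
  shows "finsum R f P \<in> H"
proof -
  interpret H: additive_subgroup H R by fact
  show ?thesis using assms(2,3)
  proof (induction P)
    case (insert p P)
    have "finsum R f (insert p P) = f p \<oplus> finsum R f P"
      by (rule finsum_insert) (use insert H.a_subset in auto)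
    then show ?case using insert by auto
  qed auto
qed

text \<open>Membership can be checked one component at a time, even in additive subgroups that are
  not yet known to be ideals.\<close>

lemma mem_if_idem_mem:
  assumes "additive_subgroup H R" "x \<in> carrier R"
    and "\<And>p. p \<in> prime_set R \<Longrightarrow> idem p \<otimes> x \<in> H"
  shows "x \<in> H"
  using additive_subgroup_finsum[OF assms(1) finite_prime_set, of "\<lambda>p. idem p \<otimes> x"] assms(2,3)
  by (simp add: finsum_idem_mult)

lemma p_component_one_eq:
  assumes p: "Factorial_Ring.prime p"
  shows "p_component_one R p = idem p"
  unfolding p_component_one_def
proof (rule the_equality)
  show "idem p \<in> p_component R p \<and> (\<forall>x\<in>p_component R p. idem p \<otimes> x = x)"
    using idem_idem[OF p] by (auto simp: p_component_eq[OF p])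
  fix e assume e: "e \<in> p_component R p \<and> (\<forall>x\<in>p_component R p. e \<otimes> x = x)"
  then have "e \<otimes> idem p = idem p" "idem p \<otimes> e = e" "e \<in> carrier R"
    using idem_idem[OF p] by (auto simp: p_component_eq[OF p])
  then show "e = idem p" using m_comm[of e "idem p"] by auto
qed

lemma p_component_ring_cring:
  assumes p: "Factorial_Ring.prime p"
  shows "cring (p_component_ring R p)"
  unfolding p_component_ring_def p_component_one_eq[OF p]
proof (rule cringI)
  let ?P = "R\<lparr>carrier := p_component R p, one := idem p\<rparr>"
  show "abelian_group ?P"
  proof (rule abelian_groupI)
    fix x assume "x \<in> carrier ?P"
    then show "\<exists>y\<in>carrier ?P. y \<oplus>\<^bsub>?P\<^esub> x = \<zero>\<^bsub>?P\<^esub>"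
      by (intro bexI[of _ "\<ominus> x"]) (auto simp: p_component_eq[OF p] r_minus l_neg)
  qed (auto simp: p_component_eq[OF p] r_distr a_ac)
  show "comm_monoid ?P"
    by (rule comm_monoidI)
      (auto simp: p_component_eq[OF p] m_assoc[symmetric] idem_idem[OF p] intro: m_comm)
  show "\<And>x y z. \<lbrakk>x \<in> carrier ?P; y \<in> carrier ?P; z \<in> carrier ?P\<rbrakk> \<Longrightarrow>
      (x \<oplus>\<^bsub>?P\<^esub> y) \<otimes>\<^bsub>?P\<^esub> z = x \<otimes>\<^bsub>?P\<^esub> z \<oplus>\<^bsub>?P\<^esub> y \<otimes>\<^bsub>?P\<^esub> z"
    by (simp add: p_component_eq[OF p] l_distr)
qed

end

section \<open>Units of a CG-ring\<close>

text \<open>Finiteness replaces Zorn's lemma: take a maximal member among the ideals that contain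
  \<open>z\<close> but not 1.\<close>

lemma (in cring) nonunit_mem_maximalideal:
  assumes fin: "finite (carrier R)" and z: "z \<in> carrier R" "z \<notin> Units R"
  shows "\<exists>M. maximalideal M R \<and> z \<in> M"
proof -
  let ?K = "{K. ideal K R \<and> z \<in> K \<and> \<one> \<notin> K}"
  have "?K \<subseteq> Pow (carrier R)" by (auto dest: ideal.Icarr)
  then have finK: "finite ?K" using fin by (meson finite_Pow_iff finite_subset)
  have "\<one> \<notin> PIdl z"
  proof
    assume "\<one> \<in> PIdl z"
    then obtain y where "y \<in> carrier R" "\<one> = y \<otimes> z" by (auto simp: cgenideal_def)
    then show False using z m_comm[of y z] unfolding Units_def by auto
  qed
  then have "PIdl z \<in> ?K" using cgenideal_ideal[OF z(1)] cgenideal_self[OF z(1)] by auto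
  then obtain M where M: "M \<in> ?K" and max: "\<And>K. K \<in> ?K \<Longrightarrow> M \<subseteq> K \<Longrightarrow> K = M"
    using finite_has_maximal[OF finK] by auto
  have "maximalideal M R"
  proof (rule maximalidealI)
    show "carrier R \<noteq> M" using M by auto
    fix J assume J: "ideal J R" "M \<subseteq> J" "J \<subseteq> carrier R"
    show "J = M \<or> J = carrier R"
    proof (cases "\<one> \<in> J")
      case True then show ?thesis using ideal.one_imp_carrier[OF J(1)] by simp
    next
      case False then show ?thesis using max[of J] J M by auto
    qed
  qed (use M in auto)
  then show ?thesis using M by auto
qed

locale finite_CG_ring = finite_cring +
  assumes CG: "CG_ring R"
begin

lemma p_component_closed: "x \<in> p_component R p \<Longrightarrow> x \<in> carrier R"
  by (simp add: p_component_def)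

lemma idem_mult_mem:
  assumes "Factorial_Ring.prime p" "x \<in> carrier R"
  shows "idem p \<otimes> x \<in> p_component R p"
  using assms idem_idem[OF assms(1)] by (simp add: p_component_eq m_assoc[symmetric])

text \<open>In a local ring the radical is the unique maximal ideal, so it contains every non-unit;
  the CG condition says that it consists of the multiples of \<open>p\<close>.\<close>

lemma p_component_nonunit:
  assumes p: "p \<in> prime_set R" and x: "x \<in> p_component R p"
    and nu: "\<And>y. y \<in> p_component R p \<Longrightarrow> x \<otimes> y \<noteq> idem p"
  shows "\<exists>z\<in>p_component R p. x = [p] \<cdot> z"
proof -
  note pp = prime_set_prime[OF p]
  let ?P = "p_component_ring R p"
  interpret P: cring ?P by (rule p_component_ring_cring[OF pp])
  have carr: "carrier ?P = p_component R p" and one: "\<one>\<^bsub>?P\<^esub> = idem p"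
    and mult: "\<And>x y. x \<otimes>\<^bsub>?P\<^esub> y = x \<otimes> y"
    by (simp_all add: p_component_ring_def p_component_one_eq[OF pp])
  have loc: "\<exists>!M. maximalideal M ?P" and jac: "jacobson_radical ?P = {[p] \<cdot> x | x. x \<in> p_component R p}"
    using CG p unfolding CG_ring_def local_ring_def by auto
  have "x \<notin> Units ?P" using nu by (auto simp: Units_def carr one mult)
  moreover have "finite (carrier ?P)"
    using finite_carrier by (rule finite_subset[rotated]) (auto simp: carr p_component_closed)
  ultimately obtain M where M: "maximalideal M ?P" "x \<in> M"
    using P.nonunit_mem_maximalideal x carr by metis
  have "jacobson_radical ?P = M"
    unfolding jacobson_radical_def using M(1) loc maximalideal.axioms(1)[OF M(1)]
    by (auto dest: ideal.Icarr)
  then show ?thesis using M(2) jac by auto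
qed

text \<open>Otherwise the identity of the component would lie in its radical, hence in a maximal
  ideal.\<close>

lemma idem_not_p_multiple:
  assumes p: "p \<in> prime_set R" and z: "z \<in> carrier R"
  shows "idem p \<noteq> [p] \<cdot> (idem p \<otimes> z)"
proof
  assume e: "idem p = [p] \<cdot> (idem p \<otimes> z)"
  note pp = prime_set_prime[OF p]
  let ?P = "p_component_ring R p"
  interpret P: cring ?P by (rule p_component_ring_cring[OF pp])
  obtain M where M: "maximalideal M ?P" and
    jac: "jacobson_radical ?P = {[p] \<cdot> x | x. x \<in> p_component R p}"
    using CG p unfolding CG_ring_def local_ring_def by auto
  interpret M: maximalideal M ?P by fact
  have "idem p \<in> jacobson_radical ?P" using e idem_mult_mem[OF pp z] unfolding jac by auto
  then have "\<one>\<^bsub>?P\<^esub> \<in> M"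
    using M by (auto simp: jacobson_radical_def p_component_ring_def p_component_one_eq[OF pp])
  then show False using M.one_imp_carrier M.I_notcarr by simp
qed

text \<open>The unit group of the \<open>p\<close>-component, embedded in the units of
  \<open>R\<close> by putting 1 in all other components.\<close>

definition comp_units :: "nat \<Rightarrow> 'a set" where
  "comp_units p = {u \<in> Units R. (\<one> \<ominus> idem p) \<otimes> u = \<one> \<ominus> idem p}"

lemma comp_units_closed: "u \<in> comp_units p \<Longrightarrow> u \<in> carrier R"
  by (auto simp: comp_units_def)

lemma idem_decomp:
  assumes "u \<in> carrier R"
  shows "u = idem p \<otimes> u \<oplus> (\<one> \<ominus> idem p) \<otimes> u"
  using l_distr[of "idem p" "\<one> \<ominus> idem p" u] assms
  by (simp add: minus_eq r_neg1 a_lcomm[of "idem p" \<one>] r_neg)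

lemma comp_units_decomp:
  assumes "u \<in> comp_units p"
  shows "u = idem p \<otimes> u \<oplus> (\<one> \<ominus> idem p)"
  using idem_decomp[OF comp_units_closed[OF assms], of p] assms by (simp add: comp_units_def)

text \<open>An element that is invertible in the component becomes a unit of the whole ring when the
  complementary idempotent is added to it.\<close>

lemma unit_or_p_multiple:
  assumes p: "p \<in> prime_set R" and x: "x \<in> p_component R p"
  shows "(\<exists>z\<in>p_component R p. x = [p] \<cdot> z) \<or> (\<exists>u\<in>comp_units p. x = idem p \<otimes> u)"
proof (cases "\<exists>y\<in>p_component R p. x \<otimes> y = idem p")
  case True
  then obtain y where y: "y \<in> p_component R p" "x \<otimes> y = idem p" by auto
  note pp = prime_set_prime[OF p]
  let ?f = "\<one> \<ominus> idem p"
  have c: "x \<in> carrier R" "y \<in> carrier R" "idem p \<otimes> x = x" "idem p \<otimes> y = y" "?f \<in> carrier R"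
    using x y by (auto simp: p_component_eq[OF pp])
  have f0: "?f \<otimes> z = \<zero>" if "z \<in> carrier R" "idem p \<otimes> z = z" for z
    using that by (simp add: minus_eq l_distr l_minus r_neg)
  have ff: "?f \<otimes> ?f = ?f"
    using idem_idem[OF pp] by (simp add: minus_eq l_distr r_distr l_minus r_minus r_neg)
  have fx: "?f \<otimes> x = \<zero>" "?f \<otimes> y = \<zero>" "x \<otimes> ?f = \<zero>" "idem p \<otimes> ?f = \<zero>"
    using f0[of x] f0[of y] f0[of "idem p"] c idem_idem[OF pp] m_comm[of ?f x] m_comm[of ?f "idem p"]
    by auto
  let ?u = "x \<oplus> ?f"
  have "?u \<otimes> (y \<oplus> ?f) = idem p \<oplus> ?f"
    using c fx ff y(2) by (simp add: l_distr r_distr)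
  also have "\<dots> = \<one>" by (simp add: minus_eq a_lcomm[of "idem p" \<one>] r_neg)
  finally have "?u \<in> Units R"
    using c m_comm[of ?u "y \<oplus> ?f"] unfolding Units_def by auto
  moreover have "?f \<otimes> ?u = ?f" using c fx ff by (simp add: r_distr)
  moreover have "x = idem p \<otimes> ?u" using c fx by (simp add: r_distr)
  ultimately show ?thesis unfolding comp_units_def by blast
next
  case False
  then show ?thesis using p_component_nonunit[OF p x] by blast
qed

text \<open>Units stay units when an element of the radical is added: if the component of the sum
  were a multiple of \<open>p\<close>, so would be that of \<open>u\<close>, and dividing by
  \<open>u\<close> also \<open>idem p\<close>.\<close>

lemma comp_units_add:
  assumes p: "p \<in> prime_set R" and u: "u \<in> comp_units p" and z: "z \<in> p_component R p"
  shows "u \<oplus> [p] \<cdot> z \<in> comp_units p"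
proof -
  note pp = prime_set_prime[OF p]
  let ?w = "u \<oplus> [p] \<cdot> z" and ?f = "\<one> \<ominus> idem p"
  have c: "u \<in> carrier R" "z \<in> carrier R" "idem p \<otimes> z = z"
    using u z by (auto simp: p_component_eq[OF pp] comp_units_closed)
  have epz: "idem p \<otimes> [p] \<cdot> z = [p] \<cdot> z" using c by (simp add: add_pow_rdistr)
  have fpz: "?f \<otimes> [p] \<cdot> z = \<zero>"
    using c epz by (simp add: minus_eq l_distr l_minus r_neg)
  have fw: "?f \<otimes> ?w = ?f" using c fpz u by (simp add: r_distr comp_units_def)
  have w: "?w \<in> carrier R" using c by simp
  consider z2 where "z2 \<in> p_component R p" "idem p \<otimes> ?w = [p] \<cdot> z2"
    | u2 where "u2 \<in> comp_units p" "idem p \<otimes> ?w = idem p \<otimes> u2"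
    using unit_or_p_multiple[OF p idem_mult_mem[OF pp w]] by auto
  then show ?thesis
  proof cases
    case 1
    then have z2: "z2 \<in> carrier R" "idem p \<otimes> z2 = z2" by (auto simp: p_component_eq[OF pp])
    obtain v where v: "v \<in> carrier R" "u \<otimes> v = \<one>" using u by (auto simp: comp_units_def Units_def)
    have "idem p \<otimes> u \<oplus> [p] \<cdot> z = [p] \<cdot> z2" using 1(2) c epz by (simp add: r_distr)
    then have "idem p \<otimes> u = [p] \<cdot> z2 \<ominus> [p] \<cdot> z"
      using c z2 by (metis add.inv_solve_right' idem_closed m_closed minus_eq nat_mult_closed)
    also have "\<dots> = [p] \<cdot> (z2 \<ominus> z)"
      using c z2 by (simp add: minus_eq add.nat_pow_distrib add.nat_pow_inv)
    finally have "idem p \<otimes> u \<otimes> v = [p] \<cdot> (z2 \<ominus> z) \<otimes> v" by simp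
    then have "idem p = [p] \<cdot> ((z2 \<ominus> z) \<otimes> v)"
      using c v z2 by (simp add: m_assoc add_pow_ldistr)
    moreover have "idem p \<otimes> ((z2 \<ominus> z) \<otimes> v) = (z2 \<ominus> z) \<otimes> v"
      using c v z2 by (simp add: minus_eq m_assoc[symmetric] r_distr r_minus)
    ultimately show ?thesis
      using idem_not_p_multiple[OF p, of "(z2 \<ominus> z) \<otimes> v"] c v z2 by simp
  next
    case 2
    then have "?w = u2"
      using idem_decomp[OF w, of p] comp_units_decomp[OF 2(1)] fw by simp
    then show ?thesis using 2 by simp
  qed
qed

text \<open>Galois rings are chain rings: factors \<open>p\<close> are split off until a unit
  remains.\<close>

lemma p_component_cases:
  assumes p: "p \<in> prime_set R" and x: "x \<in> p_component R p"
  obtains i u where "u \<in> comp_units p" "x = [(p ^ i)] \<cdot> (idem p \<otimes> u)"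
proof -
  note pp = prime_set_prime[OF p]
  have one: "\<one> \<in> comp_units p" by (simp add: comp_units_def)
  have "(\<exists>i. \<exists>u\<in>comp_units p. x = [(p ^ i)] \<cdot> (idem p \<otimes> u)) \<or>
      (\<exists>z\<in>p_component R p. x = [(p ^ j)] \<cdot> z)" for j
  proof (induction j)
    case 0
    then show ?case using x p_component_closed[OF x] by (intro disjI2 bexI[of _ x]) auto
  next
    case (Suc j)
    { fix z assume z: "z \<in> p_component R p" "x = [(p ^ j)] \<cdot> z"
      consider y where "y \<in> p_component R p" "z = [p] \<cdot> y" | u where "u \<in> comp_units p" "z = idem p \<otimes> u"
        using unit_or_p_multiple[OF p z(1)] by auto
      then have ?case
      proof cases
        case 1
        then have "x = [(p ^ Suc j)] \<cdot> y"
          using z p_component_closed by (simp add: nat_mult_mult mult.commute)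
        then show ?thesis using 1 by auto
      qed (use z in auto) }
    then show ?case using Suc by auto
  qed
  \<comment> \<open>If the splitting goes on this long, \<open>x\<close> is zero, and then the same
    power of \<open>p\<close> times \<open>idem p\<close>, with the unit 1, represents it.\<close>
  from this[of "multiplicity p (Coset.order R)"] show ?thesis
  proof (elim disjE exE bexE)
    fix z assume z: "z \<in> p_component R p" "x = [(p ^ multiplicity p (Coset.order R))] \<cdot> z"
    have zero: "[prime_part p] \<cdot> y = \<zero>" if "y \<in> p_component R p" for y
      using prime_part_mult_idem[OF pp, of y] that by (auto simp: p_component_eq[OF pp])
    have "idem p \<in> p_component R p" using idem_mult_mem[OF pp one_closed] by simp
    then have "x = [(p ^ multiplicity p (Coset.order R))] \<cdot> (idem p \<otimes> \<one>)"
      using zero[OF z(1)] zero[of "idem p"] z(2) by (simp add: prime_part_def)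
    then show thesis using that one by blast
  qed (use that in blast)
qed

lemma comp_units_subset_Q_units:
  assumes p: "p \<in> prime_set R" "p \<in> Q"
  shows "comp_units p \<subseteq> Q_units R Q"
proof
  fix u assume u: "u \<in> comp_units p"
  have c: "u \<in> carrier R" using u by (rule comp_units_closed)
  have "idem q \<otimes> u = p_component_one R q" if "q \<in> prime_set R - Q" for q
  proof -
    have pq: "Factorial_Ring.prime p" "Factorial_Ring.prime q" "q \<noteq> p"
      using that assms by (auto simp: prime_set_def)
    have "idem q \<otimes> (\<one> \<ominus> idem p) = idem q"
      using idem_orth[OF pq(2,1,3)] by (simp add: minus_eq r_distr r_minus)
    moreover have "idem q \<otimes> ((\<one> \<ominus> idem p) \<otimes> u) = idem q \<otimes> (\<one> \<ominus> idem p)"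
      using u by (simp add: comp_units_def)
    ultimately have "idem q \<otimes> u = idem q" using c by (simp add: m_assoc[symmetric])
    then show ?thesis using pq by (simp add: p_component_one_eq)
  qed
  moreover have "(\<lambda>q. idem q \<otimes> u) \<in> (\<Pi> q\<in>prime_set R. p_component R q)"
    using idem_mult_mem c by (auto simp: prime_set_def)
  moreover have "u \<in> Units R" using u by (simp add: comp_units_def)
  ultimately show "u \<in> Q_units R Q"
    using finsum_idem_mult[OF c] unfolding Q_units_def
    by (intro CollectI conjI bexI[of _ "\<lambda>q. idem q \<otimes> u"]) auto
qed

text \<open>The multipliers of \<open>H\<close> form a subring that contains all units. It also
  contains the components of every element: a component is either that of a unit, or of the form
  \<open>p z\<close>, which is the difference of the units \<open>1 + p z\<close> and 1.\<close>

lemma unit_invariant_subgroup_ideal: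
  assumes H: "additive_subgroup H R"
    and unit: "\<And>u h. u \<in> Units R \<Longrightarrow> h \<in> H \<Longrightarrow> u \<otimes> h \<in> H"
  shows "ideal H R"
proof -
  interpret H: additive_subgroup H R by fact
  define D where "D = {a \<in> carrier R. \<forall>h\<in>H. a \<otimes> h \<in> H}"
  have DC: "D \<subseteq> carrier R" by (auto simp: D_def)
  have Dneg: "\<ominus> a \<in> D" if "a \<in> D" for a
    using that by (auto simp: D_def l_minus H.a_inv_closed)
  have Dadd: "a \<oplus> b \<in> D" if "a \<in> D" "b \<in> D" for a b
    using that by (auto simp: D_def l_distr H.a_closed)
  have D0: "\<zero> \<in> D" by (auto simp: D_def)
  have Dmult: "a \<otimes> b \<in> D" if "a \<in> D" "b \<in> D" for a b
    using that by (auto simp: D_def m_assoc)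
  have Du: "u \<in> D" if "u \<in> Units R" for u
    using that unit by (auto simp: D_def)
  have Dnat: "[(k::nat)] \<cdot> \<one> \<in> D" for k
  proof (induction k)
    case (Suc k)
    then show ?case using Dadd Du[of \<one>] by simp
  qed (use D0 in simp)
  then have De: "idem p \<in> D" for p by (simp add: idem_def)
  have Dp: "additive_subgroup D R"
  proof
    show "D \<subseteq> carrier (add_monoid R)" using DC by simp
  qed (use Dadd D0 Dneg in \<open>auto simp: a_inv_def[symmetric]\<close>)
  have "a \<in> D" if a: "a \<in> carrier R" for a
  proof (rule mem_if_idem_mem[OF Dp a])
    fix p assume p: "p \<in> prime_set R"
    note pp = prime_set_prime[OF p]
    have m: "idem p \<otimes> a \<in> p_component R p" by (rule idem_mult_mem[OF pp a])
    from unit_or_p_multiple[OF p this]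
    show "idem p \<otimes> a \<in> D"
    proof (elim disjE bexE)
      fix u assume "u \<in> comp_units p" "idem p \<otimes> a = idem p \<otimes> u"
      then show ?thesis using Dmult De Du by (auto simp: comp_units_def)
    next
      fix z assume z: "z \<in> p_component R p" "idem p \<otimes> a = [p] \<cdot> z"
      have "\<one> \<in> comp_units p" by (simp add: comp_units_def)
      from comp_units_add[OF p this z(1)] have "\<one> \<oplus> [p] \<cdot> z \<in> D"
        using Du by (auto simp: comp_units_def)
      from Dadd[OF Dneg[OF Du[OF Units_one_closed]] this] show ?thesis
        using z p_component_closed[OF z(1)] r_neg1[OF one_closed, of "[p] \<cdot> z"]
        by (simp add: a_assoc[symmetric] l_neg)
    qed
  qed
  then have "a \<otimes> h \<in> H" if "a \<in> carrier R" "h \<in> H" for a h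
    using that by (auto simp: D_def)
  then show ?thesis
    using m_comm H.a_subset
    by (intro idealI[OF ring_axioms H.a_subgroup]) (metis subsetD)+
qed

end

section \<open>Counting lists modulo a prime\<close>

context abelian_group
begin

lemma add_minus_cancel_left [simp]: "x \<in> carrier G \<Longrightarrow> z \<in> carrier G \<Longrightarrow> x \<oplus> (z \<ominus> x) = z"
  by (simp add: minus_eq a_lcomm[of x z] r_neg)

lemma minus_add_cancel_right [simp]: "x \<in> carrier G \<Longrightarrow> z \<in> carrier G \<Longrightarrow> (z \<ominus> x) \<oplus> x = z"
  by (simp add: minus_eq a_assoc l_neg)

lemma add_minus_cancel_right [simp]: "x \<in> carrier G \<Longrightarrow> z \<in> carrier G \<Longrightarrow> (z \<oplus> x) \<ominus> x = z"
  by (simp add: minus_eq a_assoc r_neg)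

lemma add_minus_cancel_middle [simp]: "x \<in> carrier G \<Longrightarrow> z \<in> carrier G \<Longrightarrow> (x \<oplus> z) \<ominus> x = z"
  by (simp add: a_comm[of x z])

end

text \<open>The number of permutations is a multinomial coefficient. Its numerator is the factorial
  of \<open>p\<close>, and its denominator is prime to \<open>p\<close> because all multiplicities
  are below \<open>p\<close>.\<close>

lemma prime_dvd_card_permutations_of_multiset:
  assumes p: "Factorial_Ring.prime (p::nat)" and M: "size M = p" "\<And>x. M \<noteq> replicate_mset p x"
  shows "p dvd card (permutations_of_multiset M)"
proof -
  let ?D = "\<Prod>x\<in>set_mset M. fact (count M x) :: nat"
  have "count M x < p" for x
  proof (rule ccontr)
    assume "\<not> count M x < p"
    then have "replicate_mset p x \<subseteq># M" by (simp add: count_le_replicate_mset_subset_eq[symmetric])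
    moreover have "size (replicate_mset p x) = size M" using M by simp
    ultimately have "replicate_mset p x = M" by (metis mset_subset_size subset_mset.le_imp_less_or_eq less_irrefl)
    then show False using M(2)[of x] by simp
  qed
  then have "\<not> p dvd ?D"
    using p by (auto simp: prime_dvd_prod_iff prime_dvd_fact_iff not_le[symmetric])
  moreover have "card (permutations_of_multiset M) * ?D = fact p"
    using card_permutations_of_multiset[of M] M by simp
  moreover have "p dvd fact p" using p by (simp add: prime_dvd_fact_iff)
  ultimately show ?thesis using p by (metis prime_dvd_mult_iff)
qed

text \<open>Grouping the lists by their multiset gives classes of size divisible by
  \<open>p\<close>, apart from the constant lists. The condition is imposed on the multiset so that
  invariance under rearrangement is built in.\<close>

lemma card_lists_prime_cong:
  assumes F: "finite F" and p: "Factorial_Ring.prime (p::nat)"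
  shows "[card {xs. set xs \<subseteq> F \<and> length xs = p \<and> P (mset xs)} =
      card {x \<in> F. P (replicate_mset p x)}] (mod p)"
proof -
  let ?L = "{xs. set xs \<subseteq> F \<and> length xs = p \<and> P (mset xs)}"
  let ?C = "replicate p ` {x \<in> F. P (replicate_mset p x)}"
  let ?N = "?L - ?C"
  have p0: "p > 0" using p by (simp add: prime_gt_0_nat)
  have "?L \<subseteq> {xs. set xs \<subseteq> F \<and> length xs = p}" by auto
  then have finL: "finite ?L" using finite_lists_length_eq[OF F, of p] by (rule finite_subset)
  have CL: "?C \<subseteq> ?L" using p0 by auto
  have "card ?N = (\<Sum>M\<in>mset ` ?N. card {xs \<in> ?N. mset xs = M})"
    unfolding card_eq_sum by (rule sum.image_gen) (use finL in simp)
  also have "p dvd \<dots>"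
  proof (rule dvd_sum)
    fix M assume "M \<in> mset ` ?N"
    then obtain xs where xs: "xs \<in> ?N" "M = mset xs" by auto
    have nr: "M \<noteq> replicate_mset p x" for x
    proof
      assume M: "M = replicate_mset p x"
      then have "mset xs = mset (replicate p x)" using xs by simp
      then have "set xs = set (replicate p x)" by (rule mset_eq_setD)
      then have "xs = replicate p x"
        using xs by (intro replicate_eqI) (auto split: if_splits)
      moreover have "x \<in> F" "P (replicate_mset p x)" using xs M p0 calculation by auto
      ultimately show False using xs by auto
    qed
    have "{ys \<in> ?N. mset ys = M} = permutations_of_multiset M"
    proof (intro equalityI subsetI)
      fix ys assume "ys \<in> permutations_of_multiset M"
      then have ys: "mset ys = M" by (rule permutations_of_multisetD)
      then have "set ys = set xs" "length ys = length xs"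
        using xs mset_eq_setD mset_eq_length by metis+
      then have "ys \<in> ?L" using xs ys by auto
      moreover have "ys \<notin> ?C" using ys nr by (metis (no_types, lifting) imageE mset_replicate)
      ultimately show "ys \<in> {ys \<in> ?N. mset ys = M}" using ys by blast
    qed (auto intro: permutations_of_multisetI)
    then show "p dvd card {ys \<in> ?N. mset ys = M}"
      using prime_dvd_card_permutations_of_multiset[OF p _ nr] xs by auto
  qed
  finally have "p dvd card ?N" .
  moreover have "card ?L = card ?N + card ?C"
    using card_Diff_subset[OF finite_subset[OF CL finL] CL] card_mono[OF finL CL] by linarith
  moreover have "card ?C = card {x \<in> F. P (replicate_mset p x)}"
    using p0 by (intro card_image inj_onI) (auto simp: replicate_eq_replicate)
  ultimately show ?thesis by (simp only: cong_add_rcancel_0_nat cong_0_iff)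
qed

section \<open>S-rings over a CG-ring\<close>

locale S_ring_over_CG_ring = finite_CG_ring +
  fixes A assumes S_ring_over: "S_ring_over R A"
begin

abbreviation blocks :: "'a set set" where
  "blocks \<equiv> basic_sets (add_monoid R) A"

definition same_block :: "'a \<Rightarrow> 'a \<Rightarrow> bool" (infix "\<approx>" 50) where
  "x \<approx> y \<longleftrightarrow> (\<exists>B\<in>blocks. x \<in> B \<and> y \<in> B)"

definition A_set :: "'a set \<Rightarrow> bool" where
  "A_set X \<longleftrightarrow> (\<exists>T\<subseteq>blocks. X = \<Union>T)"

lemma basic_partition: "is_basic_partition (add_monoid R) A blocks"
proof -
  obtain S where S: "is_basic_partition (add_monoid R) A S"
    using S_ring_over unfolding S_ring_over_def S_ring_def by blast
  show ?thesis unfolding basic_sets_eq[OF S] by (rule S)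
qed

lemma blocks_partition: "partition_on (carrier R) blocks"
  using basic_partition by (simp add: is_basic_partition_def)

lemma finite_blocks: "finite blocks"
  using partition_onD1[OF blocks_partition] finite_carrier by (simp add: finite_UnionD)

lemma block_nonempty: "B \<in> blocks \<Longrightarrow> B \<noteq> {}"
  using partition_onD3[OF blocks_partition] by auto

lemma block_closed: "B \<in> blocks \<Longrightarrow> x \<in> B \<Longrightarrow> x \<in> carrier R"
  using partition_onD1[OF blocks_partition] by auto

lemma block_eq: "B \<in> blocks \<Longrightarrow> C \<in> blocks \<Longrightarrow> x \<in> B \<Longrightarrow> x \<in> C \<Longrightarrow> B = C"
  using partition_onD2[OF blocks_partition] by (auto simp: disjoint_def)

lemma block_ex:
  assumes "x \<in> carrier R"
  obtains B where "B \<in> blocks" "x \<in> B"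
  using partition_onD1[OF blocks_partition] assms by auto

lemma zero_block: "{\<zero>} \<in> blocks"
  using basic_partition by (simp add: is_basic_partition_def)

lemma same_block_refl: "x \<in> carrier R \<Longrightarrow> x \<approx> x"
  unfolding same_block_def by (metis block_ex)

lemma same_block_sym: "x \<approx> y \<Longrightarrow> y \<approx> x"
  unfolding same_block_def by blast

lemma same_block_closed: "x \<approx> y \<Longrightarrow> x \<in> carrier R" "x \<approx> y \<Longrightarrow> y \<in> carrier R"
  unfolding same_block_def using block_closed by blast+

lemma same_blockI: "B \<in> blocks \<Longrightarrow> x \<in> B \<Longrightarrow> y \<in> B \<Longrightarrow> x \<approx> y"
  unfolding same_block_def by blast

lemma same_block_iff: "B \<in> blocks \<Longrightarrow> x \<in> B \<Longrightarrow> x \<approx> y \<longleftrightarrow> y \<in> B"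
  unfolding same_block_def using block_eq by blast

lemma same_block_zero: "\<zero> \<approx> x \<longleftrightarrow> x = \<zero>"
  using same_block_iff[OF zero_block, of \<zero>] by simp

lemma same_block_unit:
  assumes "x \<approx> y" "u \<in> Units R"
  shows "u \<otimes> x \<approx> u \<otimes> y"
  using assms S_ring_over unfolding same_block_def S_ring_over_def by blast

lemma same_block_neg:
  assumes "x \<approx> y"
  shows "\<ominus> x \<approx> \<ominus> y"
proof -
  obtain B where B: "B \<in> blocks" "x \<in> B" "y \<in> B" using assms by (auto simp: same_block_def)
  then have "set_inv\<^bsub>add_monoid R\<^esub> B \<in> blocks" using basic_partition by (simp add: is_basic_partition_def)
  moreover have "\<ominus> x \<in> set_inv\<^bsub>add_monoid R\<^esub> B" "\<ominus> y \<in> set_inv\<^bsub>add_monoid R\<^esub> B"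
    using B by (auto simp: SET_INV_def a_inv_def)
  ultimately show ?thesis by (rule same_blockI)
qed

lemma A_setI:
  assumes "X \<subseteq> carrier R" "\<And>x y. x \<in> X \<Longrightarrow> x \<approx> y \<Longrightarrow> y \<in> X"
  shows "A_set X"
  unfolding A_set_def
proof (intro exI conjI)
  show "X = \<Union>{B \<in> blocks. B \<subseteq> X}"
  proof (intro equalityI subsetI)
    fix x assume x: "x \<in> X"
    then obtain B where "B \<in> blocks" "x \<in> B" using assms(1) block_ex by blast
    then show "x \<in> \<Union>{B \<in> blocks. B \<subseteq> X}" using assms(2)[OF x] same_blockI by blast
  qed auto
qed auto

lemma A_set_closed: "A_set X \<Longrightarrow> x \<in> X \<Longrightarrow> x \<in> carrier R"
  unfolding A_set_def using block_closed by blast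

lemma A_setD: "A_set X \<Longrightarrow> x \<in> X \<Longrightarrow> x \<approx> y \<Longrightarrow> y \<in> X"
  unfolding A_set_def same_block_def using block_eq by blast

lemma A_set_iff: "A_set X \<Longrightarrow> x \<approx> y \<Longrightarrow> x \<in> X \<longleftrightarrow> y \<in> X"
  using A_setD same_block_sym by blast

lemma A_set_finite: "A_set X \<Longrightarrow> finite X"
  using A_set_closed finite_carrier by (meson finite_subset subsetI)

lemma A_set_block: "B \<in> blocks \<Longrightarrow> A_set B"
  unfolding A_set_def by (intro exI[of _ "{B}"]) auto

lemma block_subset_A_set: "B \<in> blocks \<Longrightarrow> A_set X \<Longrightarrow> x \<in> B \<Longrightarrow> x \<in> X \<Longrightarrow> B \<subseteq> X"
  using A_setD same_blockI by blast

lemma A_ideal_iff: "A_ideal R A I \<longleftrightarrow> ideal I R \<and> A_set I"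
  by (simp add: A_ideal_def A_set_def)

section \<open>Convolution in the S-ring and the counts that it makes constant on basic sets\<close>

lemma mem_S_ring:
  assumes zero: "\<And>x. x \<notin> carrier R \<Longrightarrow> f x = 0" and const: "\<And>x y. x \<approx> y \<Longrightarrow> f x = f y"
  shows "f \<in> A"
proof -
  \<comment> \<open>The coefficients are indexed by indicator functions, so a point of the basic set
    is recovered as a place where the indicator is 1.\<close>
  define c :: "('a \<Rightarrow> int) \<Rightarrow> int" where "c b = f (SOME x. b x = 1)" for b
  have c: "c (indicator B) = f x" if B: "B \<in> blocks" "x \<in> B" for B x
  proof -
    have "(indicator B :: 'a \<Rightarrow> int) (SOME y. (indicator B :: 'a \<Rightarrow> int) y = 1) = 1"
      by (rule someI[of _ x]) (use B in simp)
    then have "(SOME y. (indicator B :: 'a \<Rightarrow> int) y = 1) \<in> B"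
      by (auto simp: indicator_def split: if_splits)
    then show ?thesis unfolding c_def using const same_blockI B by blast
  qed
  have inj: "inj_on (indicator :: 'a set \<Rightarrow> 'a \<Rightarrow> int) blocks"
    by (rule inj_onI) (metis indicator_eq_1_iff subset_antisym subsetI)
  have "f = (\<lambda>x. \<Sum>b\<in>indicator ` blocks. c b * b x)"
  proof
    fix x
    have "(\<Sum>b\<in>indicator ` blocks. c b * b x) = (\<Sum>B\<in>blocks. c (indicator B) * indicator B x)"
      using sum.reindex[OF inj, of "\<lambda>b. c b * b x"] by simp
    also have "\<dots> = f x"
    proof (cases "x \<in> carrier R")
      case True
      then obtain B where B: "B \<in> blocks" "x \<in> B" by (rule block_ex)
      have "(\<Sum>C\<in>blocks. c (indicator C) * indicator C x) = (\<Sum>C\<in>{B}. c (indicator C) * indicator C x)"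
        using B block_eq by (intro sum.mono_neutral_right finite_blocks) (auto simp: indicator_def)
      then show ?thesis using c[OF B] B by simp
    next
      case False
      then have "(\<Sum>C\<in>blocks. c (indicator C) * indicator C x) = 0"
        using block_closed by (intro sum.neutral) (auto simp: indicator_def)
      then show ?thesis using zero[OF False] by simp
    qed
    finally show "f x = (\<Sum>b\<in>indicator ` blocks. c b * b x)" by simp
  qed
  moreover have "A = int_span (indicator ` blocks)"
    using basic_partition by (simp add: is_basic_partition_def int_basis_def)
  ultimately show ?thesis unfolding int_span_def by blast
qed

lemma S_ring_same_block: "f \<in> A \<Longrightarrow> x \<approx> y \<Longrightarrow> f x = f y"
  unfolding same_block_def using basic_partition_block[OF basic_partition] by blast

text \<open>The sum is the value at \<open>z\<close> of the product of \<open>indicator X\<close>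
  and \<open>f\<close> in the group ring. This is where closure of the S-ring under multiplication
  enters; every later count that is constant on basic sets rests on it.\<close>

lemma same_block_convolution:
  fixes f :: "'a \<Rightarrow> int"
  assumes X: "A_set X" and f: "\<And>x y. x \<approx> y \<Longrightarrow> f x = f y" and z: "z \<approx> z'"
  shows "(\<Sum>x\<in>X. f (z \<ominus> x)) = (\<Sum>x\<in>X. f (z' \<ominus> x))"
proof -
  define g where "g x = (if x \<in> carrier R then f x else 0)" for x
  let ?Z = "group_ring (add_monoid R)"
  have gA: "g \<in> A" unfolding g_def
    by (rule mem_S_ring) (use f same_block_closed in auto)
  have XA: "indicator X \<in> A"
    by (rule mem_S_ring) (use A_set_iff[OF X] A_set_closed[OF X] in \<open>auto simp: indicator_def\<close>)
  have "subring A ?Z" using S_ring_over by (simp add: S_ring_over_def S_ring_def)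
  then have "indicator X \<otimes>\<^bsub>?Z\<^esub> g \<in> A" using XA gA by (auto intro: subringE(6))
  moreover have "(indicator X \<otimes>\<^bsub>?Z\<^esub> g) z = (\<Sum>x\<in>X. f (z \<ominus> x))" if z: "z \<in> carrier R" for z
  proof -
    have "(indicator X \<otimes>\<^bsub>?Z\<^esub> g) z = (\<Sum>x\<in>carrier R. indicator X x * g (\<ominus> x \<oplus> z))"
      using z by (simp add: group_ring_def a_inv_def)
    also have "\<dots> = (\<Sum>x\<in>X. indicator X x * g (\<ominus> x \<oplus> z))"
      using A_set_closed[OF X] by (intro sum.mono_neutral_right finite_carrier) auto
    also have "\<dots> = (\<Sum>x\<in>X. f (z \<ominus> x))"
      using A_set_closed[OF X] z by (intro sum.cong) (auto simp: g_def minus_eq a_comm)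
    finally show ?thesis .
  qed
  ultimately show ?thesis
    using S_ring_same_block[OF _ z, of "indicator X \<otimes>\<^bsub>?Z\<^esub> g"] same_block_closed[OF z] by simp
qed

lemma card_minus_same_block:
  assumes "A_set X" "A_set Y" "z \<approx> z'"
  shows "card {x \<in> X. z \<ominus> x \<in> Y} = card {x \<in> X. z' \<ominus> x \<in> Y}"
proof -
  have "(\<Sum>x\<in>X. indicator Y (z \<ominus> x) :: int) = (\<Sum>x\<in>X. indicator Y (z' \<ominus> x))"
    using assms by (intro same_block_convolution) (auto simp: indicator_def dest: A_set_iff)
  moreover have "(\<Sum>x\<in>X. indicator Y (w \<ominus> x) :: int) = int (card {x \<in> X. w \<ominus> x \<in> Y})" for w
    using A_set_finite[OF assms(1)] by (simp add: indicator_def sum.If_cases Int_def)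
  ultimately show ?thesis by simp
qed

lemma A_set_neg:
  assumes "A_set X" shows "A_set (a_inv R ` X)"
proof (rule A_setI)
  fix x y assume "x \<in> a_inv R ` X" "x \<approx> y"
  then obtain x' where "x' \<in> X" "x = \<ominus> x'" by auto
  moreover from this have "x' \<approx> \<ominus> y"
    using same_block_neg[OF \<open>x \<approx> y\<close>] A_set_closed[OF assms] by simp
  ultimately show "y \<in> a_inv R ` X"
    using A_setD[OF assms] same_block_closed(2)[OF \<open>x \<approx> y\<close>] by (intro image_eqI[of _ _ "\<ominus> y"]) auto
qed (use A_set_closed[OF assms] in auto)

text \<open>Typical use: if \<open>z + Y\<close> is contained in \<open>X\<close> for one
  \<open>z\<close>, the count is the full \<open>card Y\<close>, so the same inclusion holds for
  every element of the basic set of \<open>z\<close>.\<close>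

lemma card_plus_same_block:
  assumes X: "A_set X" and Y: "A_set Y" and z: "z \<approx> z'"
  shows "card {y \<in> Y. z \<oplus> y \<in> X} = card {y \<in> Y. z' \<oplus> y \<in> X}"
proof -
  have "card {y \<in> a_inv R ` Y. w \<ominus> y \<in> X} = card {y \<in> Y. w \<oplus> y \<in> X}" if "w \<in> carrier R" for w
  proof -
    have "{y \<in> a_inv R ` Y. w \<ominus> y \<in> X} = a_inv R ` {y \<in> Y. w \<oplus> y \<in> X}"
      using A_set_closed[OF Y] by (auto simp: minus_eq)
    moreover have "inj_on (a_inv R) {y \<in> Y. w \<oplus> y \<in> X}"
      using A_set_closed[OF Y] by (intro inj_onI) (metis (lifting) mem_Collect_eq minus_minus)
    ultimately show ?thesis by (simp add: card_image)
  qed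
  then show ?thesis
    using card_minus_same_block[OF A_set_neg[OF Y] X z] same_block_closed[OF z] by simp
qed

lemma A_set_set_add:
  assumes X: "A_set X" and Y: "A_set Y"
  shows "A_set (X <+>\<^bsub>R\<^esub> Y)"
proof (rule A_setI)
  show "X <+>\<^bsub>R\<^esub> Y \<subseteq> carrier R"
    using A_set_closed[OF X] A_set_closed[OF Y] by (auto simp: set_add_def')
  fix z z' assume "z \<in> X <+>\<^bsub>R\<^esub> Y" and z: "z \<approx> z'"
  then obtain x y where xy: "x \<in> X" "y \<in> Y" "z = x \<oplus> y" by (auto simp: set_add_def')
  then have "z \<ominus> x = y"
    using A_set_closed[OF X] A_set_closed[OF Y] by simp
  then have "x \<in> {x \<in> X. z \<ominus> x \<in> Y}" using xy by simp
  then have "card {x \<in> X. z \<ominus> x \<in> Y} \<noteq> 0" using A_set_finite[OF X] by auto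
  then have "{x \<in> X. z' \<ominus> x \<in> Y} \<noteq> {}" using card_minus_same_block[OF X Y z] by (metis card.empty)
  then obtain x' where x': "x' \<in> X" "z' \<ominus> x' \<in> Y" by auto
  moreover have "z' = x' \<oplus> (z' \<ominus> x')"
    using A_set_closed[OF X x'(1)] same_block_closed(2)[OF z] by simp
  ultimately show "z' \<in> X <+>\<^bsub>R\<^esub> Y" by (auto simp: set_add_def')
qed

lemma A_set_Inter:
  assumes "T \<noteq> {}" "\<And>X. X \<in> T \<Longrightarrow> A_set X"
  shows "A_set (\<Inter>T)"
  by (rule A_setI) (use assms A_set_closed A_setD in blast)+

lemma A_ideal_Inter:
  assumes "T \<noteq> {}" "\<And>I. I \<in> T \<Longrightarrow> A_ideal R A I"
  shows "A_ideal R A (\<Inter>T)"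
  using assms by (auto simp: A_ideal_iff intro!: i_Intersect A_set_Inter)

lemma A_ideal_carrier: "A_ideal R A (carrier R)"
  unfolding A_ideal_iff using oneideal same_block_closed by (auto intro!: A_setI)

lemma A_ideal_set_add:
  "A_ideal R A I \<Longrightarrow> A_ideal R A K \<Longrightarrow> A_ideal R A (I <+>\<^bsub>R\<^esub> K)"
  by (simp add: A_ideal_iff add_ideals A_set_set_add)

section \<open>Stabilizers of A-sets and the ideal \<open>I_L\<close>\<close>

definition stab :: "'a set \<Rightarrow> 'a set" where
  "stab X = {d \<in> carrier R. \<forall>u\<in>Units R. \<forall>x\<in>X. x \<oplus> u \<otimes> d \<in> X}"

lemma stabD: "d \<in> stab X \<Longrightarrow> x \<in> X \<Longrightarrow> x \<oplus> d \<in> X"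
  unfolding stab_def using l_one Units_one_closed by fastforce

text \<open>By finiteness the negative of an element is one of its natural multiples.\<close>

lemma additive_subgroupI_finite:
  assumes H: "H \<subseteq> carrier R" "\<zero> \<in> H" "\<And>x y. x \<in> H \<Longrightarrow> y \<in> H \<Longrightarrow> x \<oplus> y \<in> H"
  shows "additive_subgroup H R"
proof
  have mult: "[(k::nat)] \<cdot> x \<in> H" if "x \<in> H" for k x
    by (induction k) (use H that in auto)
  show "inv\<^bsub>add_monoid R\<^esub> x \<in> H" if x: "x \<in> H" for x
  proof -
    have xc: "x \<in> carrier R" using x H by auto
    have "[(Coset.order R - 1)] \<cdot> x \<oplus> x = [Suc (Coset.order R - 1)] \<cdot> x"
      by simp
    also have "\<dots> = \<zero>" using order_mult_eq_zero[OF xc] order_pos by simp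
    finally have "\<ominus> x = [(Coset.order R - 1)] \<cdot> x"
      using xc by (intro minus_equality) auto
    then show ?thesis using mult[OF x] by (simp add: a_inv_def)
  qed
qed (use H in auto)

text \<open>The quantifier over units in \<open>stab\<close> makes it invariant under units,
  although \<open>X\<close> need not be, and so it is an ideal. It is an A-set because
  \<open>u d\<close> fixes \<open>X\<close> exactly when the number of \<open>x\<close> in
  \<open>X\<close> with \<open>u d + x\<close> in \<open>X\<close> is \<open>card X\<close>, and
  this number is constant on basic sets.\<close>

lemma A_ideal_stab:
  assumes X: "A_set X"
  shows "A_ideal R A (stab X)"
  unfolding A_ideal_iff
proof
  note Xc = A_set_closed[OF X]
  have "additive_subgroup (stab X) R"
  proof (rule additive_subgroupI_finite)
    fix d d' assume d: "d \<in> stab X" "d' \<in> stab X"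
    have "x \<oplus> u \<otimes> (d \<oplus> d') \<in> X" if "x \<in> X" "u \<in> Units R" for x u
    proof -
      have "x \<oplus> u \<otimes> d \<oplus> u \<otimes> d' \<in> X" using d that by (auto simp: stab_def)
      then show ?thesis using d that Xc by (auto simp: stab_def r_distr a_assoc Units_closed)
    qed
    then show "d \<oplus> d' \<in> stab X" using d by (auto simp: stab_def)
  qed (use Xc in \<open>auto simp: stab_def\<close>)
  then show "ideal (stab X) R"
  proof (rule unit_invariant_subgroup_ideal)
    fix u d assume u: "u \<in> Units R" and d: "d \<in> stab X"
    have "x \<oplus> v \<otimes> (u \<otimes> d) \<in> X" if "x \<in> X" "v \<in> Units R" for x v
    proof -
      have "x \<oplus> (v \<otimes> u) \<otimes> d \<in> X" using d that u by (auto simp: stab_def)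
      then show ?thesis using d that u by (auto simp: stab_def m_assoc Units_closed)
    qed
    then show "u \<otimes> d \<in> stab X" using d u by (auto simp: stab_def)
  qed
  show "A_set (stab X)"
  proof (rule A_setI)
    fix d d' assume d: "d \<in> stab X" and dd: "d \<approx> d'"
    have "x \<oplus> u \<otimes> d' \<in> X" if x: "x \<in> X" and u: "u \<in> Units R" for x u
    proof -
      have "u \<otimes> d \<approx> u \<otimes> d'" using dd u by (rule same_block_unit)
      then have "card {x \<in> X. u \<otimes> d \<oplus> x \<in> X} = card {x \<in> X. u \<otimes> d' \<oplus> x \<in> X}"
        by (rule card_plus_same_block[OF X X])
      moreover have "{x \<in> X. u \<otimes> d \<oplus> x \<in> X} = X"
        using d u Xc by (auto simp: stab_def Units_closed a_comm[of "u \<otimes> d"])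
      ultimately have "{x \<in> X. u \<otimes> d' \<oplus> x \<in> X} = X"
        using A_set_finite[OF X] by (intro card_subset_eq) auto
      then have "u \<otimes> d' \<oplus> x \<in> X" using x by blast
      then show ?thesis using x u Xc same_block_closed(2)[OF dd] by (simp add: Units_closed a_comm[of x])
    qed
    then show "d' \<in> stab X" using same_block_closed(2)[OF dd] by (simp add: stab_def)
  qed (auto simp: stab_def)
qed

lemma ideal_subset_stab:
  assumes "ideal K R" "\<And>x k. x \<in> X \<Longrightarrow> k \<in> K \<Longrightarrow> x \<oplus> k \<in> X"
  shows "K \<subseteq> stab X"
  using assms(2) ideal.I_l_closed[OF assms(1)] ideal.Icarr[OF assms(1)]
  by (auto simp: stab_def)

text \<open>An ideal that fixes \<open>X\<close> contains \<open>u d\<close> together with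
  \<open>d\<close>, so it lies in \<open>stab X\<close>, which is itself such an ideal; thus the
  greatest one exists.\<close>

lemma I_L_eq_stab:
  assumes X: "A_set X"
  shows "I_L R X = stab X"
  unfolding I_L_def
proof (rule Greatest_equality)
  have id: "ideal (stab X) R" using A_ideal_stab[OF X] by (simp add: A_ideal_iff)
  then have "\<zero> \<in> stab X" by (simp add: additive_subgroup.zero_closed ideal.axioms(1))
  then have "X <+>\<^bsub>R\<^esub> stab X = X"
    using A_set_closed[OF X] stabD unfolding set_add_def' by force
  then show "ideal (stab X) R \<and> X <+>\<^bsub>R\<^esub> stab X = X" using id by simp
  fix K assume K: "ideal K R \<and> X <+>\<^bsub>R\<^esub> K = X"
  then show "K \<subseteq> stab X"
    by (intro ideal_subset_stab) (auto simp: set_add_def')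
qed

section \<open>The largest A-ideal inside an ideal\<close>

definition core :: "'a set \<Rightarrow> 'a set" where
  "core V = {x \<in> carrier R. \<forall>y. x \<approx> y \<longrightarrow> y \<in> V}"

lemma core_subset: "core V \<subseteq> V"
  using same_block_refl by (auto simp: core_def)

lemma A_set_core: "A_set (core V)"
  by (rule A_setI) (auto simp: core_def same_block_def dest: block_closed block_eq)

lemma block_subset_core: "B \<in> blocks \<Longrightarrow> B \<subseteq> V \<Longrightarrow> B \<subseteq> core V"
  using block_closed same_block_iff by (auto simp: core_def)

lemma A_set_subset_core: "A_set X \<Longrightarrow> X \<subseteq> V \<Longrightarrow> X \<subseteq> core V"
  using A_set_closed A_setD by (auto simp: core_def)

text \<open>The sum of the core with itself is an A-set inside \<open>V\<close>, hence lies in the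
  core; units permute basic sets and preserve \<open>V\<close>. Passing to the core is what allows
  maximality of an A-ideal to be applied to ideals that are not A-sets.\<close>

lemma A_ideal_core:
  assumes V: "ideal V R"
  shows "A_ideal R A (core V)"
  unfolding A_ideal_iff
proof
  interpret V: ideal V R by fact
  have "additive_subgroup (core V) R"
  proof (rule additive_subgroupI_finite)
    show "\<zero> \<in> core V" by (simp add: core_def same_block_zero)
    fix x y assume xy: "x \<in> core V" "y \<in> core V"
    have "core V <+>\<^bsub>R\<^esub> core V \<subseteq> V" using core_subset by (auto simp: set_add_def')
    then have "core V <+>\<^bsub>R\<^esub> core V \<subseteq> core V"
      by (intro A_set_subset_core A_set_set_add A_set_core)
    then show "x \<oplus> y \<in> core V" using xy by (auto simp: set_add_def')
  qed (auto simp: core_def)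
  then show "ideal (core V) R"
  proof (rule unit_invariant_subgroup_ideal)
    fix u x assume u: "u \<in> Units R" and x: "x \<in> core V"
    have xc: "x \<in> carrier R" using x by (simp add: core_def)
    have "y \<in> V" if y: "u \<otimes> x \<approx> y" for y
    proof -
      have yc: "y \<in> carrier R" using y by (rule same_block_closed)
      have "inv u \<otimes> (u \<otimes> x) \<approx> inv u \<otimes> y" using y u by (intro same_block_unit) auto
      moreover have "inv u \<otimes> (u \<otimes> x) = x"
        using u xc by (simp add: m_assoc[symmetric] Units_closed)
      ultimately have "inv u \<otimes> y \<in> V" using x by (simp add: core_def)
      then have "u \<otimes> (inv u \<otimes> y) \<in> V" using u by (rule V.I_l_closed[OF _ Units_closed])
      then show ?thesis using u yc by (simp add: m_assoc[symmetric] Units_closed)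
    qed
    then show "u \<otimes> x \<in> core V" using u xc by (auto simp: core_def)
  qed
  show "A_set (core V)" by (rule A_set_core)
qed

end

lemma (in abelian_group) minus_minus_minus:
  assumes "x \<in> carrier G" "y \<in> carrier G" "z \<in> carrier G"
  shows "(z \<ominus> x) \<ominus> (z \<ominus> y) = y \<ominus> x"
  using assms by (simp add: minus_eq minus_add a_assoc a_lcomm[of "\<ominus> x" "\<ominus> z" y] r_neg1 r_neg2 a_comm)

lemma (in abelian_group) minus_mem_cancel:
  assumes H: "additive_subgroup H G" and c: "x \<in> carrier G" "y \<in> carrier G" "z \<in> carrier G"
    and xy: "x \<ominus> y \<in> H"
  shows "x \<ominus> z \<in> H \<longleftrightarrow> y \<ominus> z \<in> H" and "z \<ominus> x \<in> H \<longleftrightarrow> z \<ominus> y \<in> H"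
proof -
  interpret H: additive_subgroup H G by fact
  have yx: "y \<ominus> x \<in> H"
    using H.a_inv_closed[OF xy] c by (simp add: minus_eq minus_add a_comm)
  have *: "a \<ominus> d \<in> H" if "a \<ominus> b \<in> H" "b \<ominus> d \<in> H" "a \<in> carrier G" "b \<in> carrier G" "d \<in> carrier G" for a b d
  proof -
    have "(a \<ominus> b) \<oplus> (b \<ominus> d) = a \<ominus> d"
      using that by (simp add: minus_eq a_assoc r_neg1)
    then show ?thesis using H.a_closed[OF that(1,2)] by simp
  qed
  show "x \<ominus> z \<in> H \<longleftrightarrow> y \<ominus> z \<in> H" "z \<ominus> x \<in> H \<longleftrightarrow> z \<ominus> y \<in> H"
    using * c xy yx by blast+
qed

context S_ring_over_CG_ring
begin

text \<open>
  Schur's theorem on \<open>p\<close>-th powers in the quotient by \<open>N\<close>: the \<open>p\<close>-tuples of cosets in \<open>X\<close> with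
  given sum are counted by a function in the S-ring, and modulo \<open>p\<close> only constant tuples matter.
\<close>

theorem card_p_multiple_cong:
  assumes p: "Factorial_Ring.prime (p::nat)" and N: "additive_subgroup N R" "A_set N"
    and X: "A_set X" "\<And>x n. x \<in> X \<Longrightarrow> n \<in> N \<Longrightarrow> x \<oplus> n \<in> X" and z: "z \<approx> z'"
  shows "[card {x \<in> X. z \<ominus> [p] \<cdot> x \<in> N} div card N = card {x \<in> X. z' \<ominus> [p] \<cdot> x \<in> N} div card N] (mod p)"
proof -
  interpret N: additive_subgroup N R by fact
  note Xc = A_set_closed[OF X(1)]
  note cancel = minus_mem_cancel[OF N(1)]
  have cardN: "card N > 0" using A_set_finite[OF N(2)] N.zero_closed card_gt_0_iff by blast
  \<comment> \<open>A coset representative, chosen by a predicate that depends only on the coset, so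
    that congruent elements have equal representatives. The set \<open>F\<close> below is then a
    transversal of \<open>N\<close> in \<open>X\<close>.\<close>
  define rep where "rep x = (SOME y. y \<in> carrier R \<and> y \<ominus> x \<in> N)" for x
  have rep: "rep x \<in> carrier R" "rep x \<ominus> x \<in> N" if "x \<in> carrier R" for x
    using someI[of "\<lambda>y. y \<in> carrier R \<and> y \<ominus> x \<in> N" x] that N.zero_closed
    unfolding rep_def by (simp_all add: minus_eq r_neg)
  have rep_eq: "rep x = rep y" if "x \<in> carrier R" "y \<in> carrier R" "x \<ominus> y \<in> N" for x y
    unfolding rep_def using cancel(2)[OF that(1,2) _ that(3)] by metis
  have rep_rep: "rep (rep x) = rep x" if "x \<in> carrier R" for x
    using rep_eq[OF rep(1)[OF that] that rep(2)[OF that]] .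
  define F where "F = rep ` X"
  have rep_X: "rep x \<in> X" if "x \<in> X" for x
    using X(2)[OF that rep(2)[OF Xc[OF that]]] Xc[OF that] rep(1)[OF Xc[OF that]] by simp
  then have FX: "F \<subseteq> X" by (auto simp: F_def)
  then have Fc: "d \<in> carrier R" if "d \<in> F" for d using that Xc by auto
  have finF: "finite F" using A_set_finite[OF X(1)] by (simp add: F_def)
  have fiber: "card {x \<in> X. rep x = d} = card N" if d: "d \<in> F" for d
  proof -
    have rd: "rep d = d" using d rep_rep Xc by (auto simp: F_def)
    have "{x \<in> X. rep x = d} = (\<lambda>n. d \<oplus> n) ` N"
    proof (intro equalityI subsetI)
      fix x assume "x \<in> {x \<in> X. rep x = d}"
      then have x: "x \<in> carrier R" "d \<ominus> x \<in> N" using rep(2) Xc by auto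
      then have "\<ominus> (d \<ominus> x) \<in> N" by (intro N.a_inv_closed)
      moreover have "x = d \<oplus> \<ominus> (d \<ominus> x)"
        using x(1) Fc[OF d] by (simp add: minus_eq minus_add r_neg1 r_neg2)
      ultimately show "x \<in> (\<lambda>n. d \<oplus> n) ` N" by blast
    next
      fix x assume "x \<in> (\<lambda>n. d \<oplus> n) ` N"
      then obtain n where n: "n \<in> N" "x = d \<oplus> n" by auto
      then have "x \<ominus> d \<in> N" "x \<in> X" using Fc[OF d] N.a_Hcarr FX X(2) d by auto
      then show "x \<in> {x \<in> X. rep x = d}" using rep_eq[of x d] rd Xc Fc[OF d] by auto
    qed
    moreover have "inj_on (\<lambda>n. d \<oplus> n) N"
      using Fc[OF d] N.a_Hcarr by (intro inj_onI) simp
    ultimately show ?thesis by (simp add: card_image)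
  qed
  have sum_rep: "(\<Sum>x\<in>X. g x) = card N * (\<Sum>d\<in>F. g d)" if "\<And>x. x \<in> X \<Longrightarrow> g (rep x) = g x"
    for g :: "'a \<Rightarrow> nat"
  proof -
    have "(\<Sum>x\<in>X. g x) = (\<Sum>d\<in>F. \<Sum>x\<in>{x \<in> X. rep x = d}. g x)"
      unfolding F_def by (rule sum.image_gen[OF A_set_finite[OF X(1)]])
    also have "\<dots> = (\<Sum>d\<in>F. card N * g d)"
    proof (rule sum.cong[OF refl])
      fix d assume d: "d \<in> F"
      have "(\<Sum>x\<in>{x \<in> X. rep x = d}. g x) = (\<Sum>x\<in>{x \<in> X. rep x = d}. g d)"
        using that by (intro sum.cong) auto
      then show "(\<Sum>x\<in>{x \<in> X. rep x = d}. g x) = card N * g d" using fiber[OF d] by simp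
    qed
    finally show ?thesis by (simp add: sum_distrib_left)
  qed
  define total where "total xs = foldr (\<oplus>) xs \<zero>" for xs
  have total_closed: "total xs \<in> carrier R" if "set xs \<subseteq> F" for xs
    using that Fc unfolding total_def by (induction xs) auto
  define T where "T n w = card {xs. set xs \<subseteq> F \<and> length xs = n \<and> w \<ominus> total xs \<in> N}" for n w
  have T_inv: "T n w = T n w'" if "w \<in> carrier R" "w' \<in> carrier R" "w \<ominus> w' \<in> N" for n w w'
    unfolding T_def using cancel(1)[OF that(1,2) total_closed that(3)]
    by (intro arg_cong[where f = card]) auto
  have T_Suc: "T (Suc n) w = (\<Sum>d\<in>F. T n (w \<ominus> d))" if w: "w \<in> carrier R" for n w
  proof -
    let ?L = "\<lambda>d. {ys. set ys \<subseteq> F \<and> length ys = n \<and> (w \<ominus> d) \<ominus> total ys \<in> N}"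
    have "{xs. set xs \<subseteq> F \<and> length xs = Suc n \<and> w \<ominus> total xs \<in> N} = (\<Union>d\<in>F. (#) d ` ?L d)"
    proof -
      have *: "w \<ominus> total (d # ys) = (w \<ominus> d) \<ominus> total ys" if "d \<in> F" "set ys \<subseteq> F" for d ys
        using Fc[OF that(1)] total_closed[OF that(2)] w
        by (simp add: total_def minus_eq minus_add a_assoc)
      show ?thesis
      proof (intro equalityI subsetI)
        fix xs assume xs: "xs \<in> {xs. set xs \<subseteq> F \<and> length xs = Suc n \<and> w \<ominus> total xs \<in> N}"
        then obtain d ys where "xs = d # ys" by (auto simp: length_Suc_conv)
        then show "xs \<in> (\<Union>d\<in>F. (#) d ` ?L d)" using xs *[of d ys] by auto
      qed (use * in auto)
    qed
    moreover have "finite (?L d)" for d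
      by (rule finite_subset[OF _ finite_lists_length_eq[OF finF, of n]]) auto
    moreover have "card (\<Union>d\<in>F. (#) d ` ?L d) = (\<Sum>d\<in>F. card ((#) d ` ?L d))"
      using calculation(2) finF by (intro card_UN_disjoint) auto
    ultimately show ?thesis by (simp add: T_def card_image)
  qed
  have T_const: "T n w = T n w'" if "w \<approx> w'" for n w w'
    using that
  proof (induction n arbitrary: w w')
    case 0
    have "T 0 v = (if v \<in> N then 1 else 0)" if "v \<in> carrier R" for v
      using that by (auto simp: T_def total_def minus_eq conj_commute cong: conj_cong)
    then show ?case using A_set_iff[OF N(2) 0] same_block_closed[OF 0] by simp
  next
    case (Suc n)
    \<comment> \<open>The transversal \<open>F\<close> is not an A-set. Multiplying by
      \<open>card N\<close> turns the sum over \<open>F\<close> into a sum over \<open>X\<close>, to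
      which \<open>same_block_convolution\<close> applies.\<close>
    have "card N * T (Suc n) v = (\<Sum>x\<in>X. T n (v \<ominus> x))" if v: "v \<in> carrier R" for v
    proof -
      have "T n (v \<ominus> rep x) = T n (v \<ominus> x)" if x: "x \<in> X" for x
      proof (rule T_inv)
        have "(v \<ominus> x) \<ominus> (v \<ominus> rep x) = rep x \<ominus> x"
          using v Xc[OF x] rep(1)[OF Xc[OF x]] by (simp add: minus_minus_minus)
        then have "v \<ominus> x \<ominus> (v \<ominus> rep x) \<in> N" using rep(2)[OF Xc[OF x]] by simp
        then show "(v \<ominus> rep x) \<ominus> (v \<ominus> x) \<in> N"
          using cancel(1)[of "v \<ominus> x" "v \<ominus> rep x" "v \<ominus> x"] v Xc[OF x] rep(1)[OF Xc[OF x]]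
            N.zero_closed by (simp add: minus_eq r_neg)
      qed (use v x Xc rep in auto)
      then show ?thesis using T_Suc[OF v] sum_rep[of "\<lambda>x. T n (v \<ominus> x)"] by simp
    qed
    moreover have "(\<Sum>x\<in>X. int (T n (w \<ominus> x))) = (\<Sum>x\<in>X. int (T n (w' \<ominus> x)))"
      using Suc by (intro same_block_convolution[OF X(1)]) auto
    then have "(\<Sum>x\<in>X. T n (w \<ominus> x)) = (\<Sum>x\<in>X. T n (w' \<ominus> x))"
      by (simp only: of_nat_sum[symmetric] of_nat_eq_iff)
    ultimately have "card N * T (Suc n) w = card N * T (Suc n) w'"
      using same_block_closed[OF Suc.prems] by simp
    then show ?case using cardN by simp
  qed
  have T_p: "[T p w = card {x \<in> X. w \<ominus> [p] \<cdot> x \<in> N} div card N] (mod p)" if w: "w \<in> carrier R" for w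
  proof -
    \<comment> \<open>By commutativity the total of a list depends only on its multiset, which
      brings the condition into the form that \<open>card_lists_prime_cong\<close> asks for.\<close>
    define P where "P M \<longleftrightarrow> (\<exists>xs. set xs \<subseteq> F \<and> mset xs = M \<and> w \<ominus> total xs \<in> N)" for M
    have P: "P (mset xs) \<longleftrightarrow> w \<ominus> total xs \<in> N" if "set xs \<subseteq> F" for xs
    proof -
      have "total ys = total xs" if "set ys \<subseteq> F" "mset ys = mset xs" for ys
        unfolding total_def using that Fc by (intro add.multlist_perm_cong) auto
      then show ?thesis using that unfolding P_def by metis
    qed
    have rep_total: "total (replicate p x) = [p] \<cdot> x" if "x \<in> carrier R" for x
    proof -
      have "foldr (\<oplus>) (replicate k x) \<zero> = [k] \<cdot> x" for k :: nat
        by (induction k) (use that in \<open>auto simp: add.nat_pow_comm a_comm\<close>)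
      then show ?thesis by (simp add: total_def)
    qed
    have "T p w = card {xs. set xs \<subseteq> F \<and> length xs = p \<and> P (mset xs)}"
      unfolding T_def using P by (intro arg_cong[where f = card]) auto
    also have "[\<dots> = card {x \<in> F. P (replicate_mset p x)}] (mod p)"
      by (rule card_lists_prime_cong[OF finF p])
    also have "{x \<in> F. P (replicate_mset p x)} = {x \<in> F. w \<ominus> [p] \<cdot> x \<in> N}"
    proof -
      have "P (replicate_mset p x) \<longleftrightarrow> w \<ominus> [p] \<cdot> x \<in> N" if "x \<in> F" for x
      proof -
        have "set (replicate p x) \<subseteq> F" using that by (auto split: if_splits)
        from P[OF this] show ?thesis using rep_total[OF Fc[OF that]] by simp
      qed
      then show ?thesis by auto
    qed
    also have "card {x \<in> F. w \<ominus> [p] \<cdot> x \<in> N} = card {x \<in> X. w \<ominus> [p] \<cdot> x \<in> N} div card N"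
    proof -
      define g :: "'a \<Rightarrow> nat" where "g x = (if w \<ominus> [p] \<cdot> x \<in> N then 1 else 0)" for x
      have "g (rep x) = g x" if x: "x \<in> X" for x
      proof -
        have c: "x \<in> carrier R" "rep x \<in> carrier R" using Xc[OF x] rep(1) by auto
        have "[p] \<cdot> (rep x \<ominus> x) \<in> N"
        proof -
          have "[(k::nat)] \<cdot> (rep x \<ominus> x) \<in> N" for k
            by (induction k) (use rep(2)[OF c(1)] in auto)
          then show ?thesis .
        qed
        moreover have "[p] \<cdot> (rep x \<ominus> x) = [p] \<cdot> rep x \<ominus> [p] \<cdot> x"
          using c by (simp add: minus_eq add.nat_pow_distrib add.nat_pow_inv)
        ultimately have "[p] \<cdot> rep x \<ominus> [p] \<cdot> x \<in> N" by simp
        from cancel(2)[OF _ _ w this] show ?thesis using c by (simp add: g_def)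
      qed
      from sum_rep[of g, OF this] have "card {x \<in> X. w \<ominus> [p] \<cdot> x \<in> N} = card N * card {x \<in> F. w \<ominus> [p] \<cdot> x \<in> N}"
        using A_set_finite[OF X(1)] finF by (simp add: g_def sum.If_cases Int_def)
      then show ?thesis using cardN by simp
    qed
    finally show ?thesis .
  qed
  show ?thesis
    using cong_trans[OF cong_sym[OF T_p[of z]]] T_p[of z'] T_const[OF z, of p] same_block_closed[OF z]
    by simp
qed

end

section \<open>Torsion modulo an ideal of a CG-ring\<close>

text \<open>The coset of \<open>x\<close> has order exactly \<open>p\<close> in the factor
  group.\<close>

lemma (in comm_group) prime_dvd_card_rcosets:
  assumes H: "subgroup H G" and p: "Factorial_Ring.prime (p::nat)"
    and x: "x \<in> carrier G" "x \<notin> H" "x [^] p \<in> H"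
  shows "p dvd card (rcosets H)"
proof -
  interpret N: normal H G by (rule subgroup_imp_normal[OF H])
  interpret Q: group "G Mod H" by (rule N.factorgroup_is_group)
  have hom: "group_hom G (G Mod H) (\<lambda>a. H #> a)"
    using N.r_coset_hom_Mod by (intro group_hom.intro group_hom_axioms.intro is_group Q.is_group)
  have xc: "H #> x \<in> carrier (G Mod H)" using group_hom.hom_closed[OF hom x(1)] .
  have "(H #> x) [^]\<^bsub>G Mod H\<^esub> p = \<one>\<^bsub>G Mod H\<^esub>"
    using group_hom.hom_nat_pow[OF hom x(1), of p] coset_join2[OF _ H x(3)] x(1)
    by (simp add: FactGroup_def)
  then have "Q.ord (H #> x) dvd p" using Q.pow_eq_id[OF xc] by simp
  moreover have "Q.ord (H #> x) \<noteq> 1"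
    using Q.ord_eq_1[OF xc] coset_join1[OF _ x(1) H] x(2) by (auto simp: FactGroup_def)
  ultimately have "Q.ord (H #> x) = p" using p by (auto simp: prime_nat_iff)
  then show ?thesis using Q.ord_dvd_group_order[OF xc] by (simp add: order_def FactGroup_def)
qed

lemma (in comm_group) prime_dvd_subgroup_index:
  assumes H: "subgroup H G" and K: "subgroup K G" and HK: "H \<subseteq> K"
    and p: "Factorial_Ring.prime (p::nat)" and x: "x \<in> K" "x \<notin> H" "x [^] p \<in> H"
  shows "p dvd card K div card H \<and> card H dvd card K"
proof (cases "finite K")
  case True
  let ?K = "G\<lparr>carrier := K\<rparr>"
  have "group ?K" by (rule subgroup_imp_group[OF K])
  then have cK: "comm_group ?K"
    using subgroup.subset[OF K] by (intro group.group_comm_groupI) (auto intro: m_comm)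
  have sub: "subgroup H ?K" by (rule subgroup_incl[OF H K HK])
  have "x [^]\<^bsub>?K\<^esub> p \<in> H" using x(3) nat_pow_consistent[of x p K] by simp
  then have "p dvd card (rcosets\<^bsub>?K\<^esub> H)"
    using comm_group.prime_dvd_card_rcosets[OF cK sub p, of x] x by simp
  moreover have "card (rcosets\<^bsub>?K\<^esub> H) * card H = card K"
    using group.lagrange[OF \<open>group ?K\<close> sub] by (simp add: order_def)
  moreover have "card H > 0"
    using subgroup.one_closed[OF H] finite_subset[OF HK True] by (auto simp: card_gt_0_iff)
  ultimately show ?thesis by (metis dvd_triv_right div_mult_self_is_m)
qed simp

context finite_CG_ring
begin

lemma idem_mult_assoc:
  assumes "Factorial_Ring.prime p" "x \<in> carrier R"
  shows "idem p \<otimes> (idem p \<otimes> x) = idem p \<otimes> x"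
  using assms idem_idem[OF assms(1)] by (simp add: m_assoc[symmetric])

text \<open>The coefficient of \<open>idem p\<close> kills the complement of the
  \<open>p\<close>-component and is prime to \<open>p\<close>. Hence \<open>a\<close> inverts
  \<open>p\<close> on all other components.\<close>

lemma idem_inverse_mod:
  assumes p: "p \<in> prime_set R"
  obtains a where "[a * p = 1] (mod idem_coeff p)"
proof -
  note pp = prime_set_prime[OF p]
  have "p dvd prime_part p"
    unfolding prime_part_def using p pp order_pos
    by (intro dvd_power) (simp add: prime_multiplicity_gt_zero_iff prime_set_def)
  then have "[idem_coeff p = 1] (mod p)"
    using idem_coeff_cong(1)[OF pp] cong_dvd_modulus_nat by blast
  then have "\<not> p dvd idem_coeff p" using pp by (metis cong_dvd_iff not_prime_unit)
  then have "coprime p (idem_coeff p)" using pp by (rule prime_imp_coprime[rotated])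
  then show thesis using cong_solve_coprime_nat[of p "idem_coeff p"] that by (auto simp: mult.commute)
qed

lemma idem_compl_mult: "x \<in> carrier R \<Longrightarrow> (\<one> \<ominus> idem p) \<otimes> x = x \<ominus> idem p \<otimes> x"
  by (simp add: minus_eq l_distr l_minus)

lemma idem_mult_compl:
  assumes "Factorial_Ring.prime p" "x \<in> carrier R"
  shows "idem p \<otimes> (x \<ominus> idem p \<otimes> x) = \<zero>"
  using assms idem_mult_assoc[OF assms] by (simp add: minus_eq r_distr r_minus r_neg)

lemma p_multiple_cancel:
  assumes p: "p \<in> prime_set R" and H: "ideal H R" and x: "x \<in> carrier R"
    and px: "[p] \<cdot> x \<in> H"
  shows "x \<ominus> idem p \<otimes> x \<in> H"
proof -
  note pp = prime_set_prime[OF p]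
  obtain a where a: "[a * p = 1] (mod idem_coeff p)" using idem_inverse_mod[OF p] .
  let ?y = "x \<ominus> idem p \<otimes> x"
  have y: "?y \<in> carrier R" using x by simp
  have "[idem_coeff p] \<cdot> ?y = \<zero>" using idem_mult_compl[OF pp x] idem_mult[OF y, of p] by simp
  from nat_mult_cong[OF y this a] have "?y = [a] \<cdot> ([p] \<cdot> ?y)" using y by (simp add: nat_mult_mult)
  moreover have "[p] \<cdot> ?y = (\<one> \<ominus> idem p) \<otimes> [p] \<cdot> x"
    using x by (simp add: idem_compl_mult[symmetric] add_pow_rdistr)
  then have "[p] \<cdot> ?y \<in> H" using ideal.I_l_closed[OF H px, of "\<one> \<ominus> idem p"] by simp
  ultimately show ?thesis using ideal_nat_mult[OF H] by metis
qed

text \<open>Equal to \<open>1\<close> in the \<open>p\<close>-component and to \<open>p\<close> in the other ones.\<close>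

definition twist :: "nat \<Rightarrow> 'a" where
  "twist p = idem p \<oplus> [p] \<cdot> (\<one> \<ominus> idem p)"

lemma twist_mult:
  assumes "x \<in> carrier R"
  shows "twist p \<otimes> x = idem p \<otimes> x \<oplus> [p] \<cdot> (x \<ominus> idem p \<otimes> x)"
  using assms by (simp add: twist_def l_distr add_pow_ldistr idem_compl_mult)

text \<open>The inverse keeps 1 in the \<open>p\<close>-component and has in the others the integer
  \<open>a\<close> that inverts \<open>p\<close> modulo the coefficient of
  \<open>idem p\<close>.\<close>

lemma twist_unit:
  assumes p: "p \<in> prime_set R"
  shows "twist p \<in> Units R"
proof -
  note pp = prime_set_prime[OF p]
  obtain a where a: "[a * p = 1] (mod idem_coeff p)" using idem_inverse_mod[OF p] .
  let ?f = "\<one> \<ominus> idem p"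
  have f: "?f \<in> carrier R" by simp
  have ef: "idem p \<otimes> ?f = \<zero>" using idem_mult_compl[OF pp one_closed] by simp
  then have "[idem_coeff p] \<cdot> ?f = \<zero>" using idem_mult[OF f, of p] by simp
  from nat_mult_cong[OF f this a] have pf: "[p] \<cdot> ([a] \<cdot> ?f) = ?f"
    using f by (simp add: nat_mult_mult mult.commute)
  have e1: "idem p \<otimes> (idem p \<oplus> [a] \<cdot> ?f) = idem p"
    using ef idem_idem[OF pp] by (simp add: r_distr add_pow_rdistr)
  have "twist p \<otimes> (idem p \<oplus> [a] \<cdot> ?f) = idem p \<oplus> [p] \<cdot> ((idem p \<oplus> [a] \<cdot> ?f) \<ominus> idem p)"
    using twist_mult[of "idem p \<oplus> [a] \<cdot> ?f" p] e1 by simp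
  also have "\<dots> = \<one>" using pf by simp
  finally show ?thesis
    using m_comm[of "twist p" "idem p \<oplus> [a] \<cdot> ?f"] unfolding Units_def
    by (intro CollectI conjI bexI[of _ "idem p \<oplus> [a] \<cdot> ?f"]) (auto simp: twist_def)
qed

lemma comp_units_mult:
  assumes "u \<in> comp_units p" "v \<in> comp_units p"
  shows "u \<otimes> v \<in> comp_units p"
  using assms by (auto simp: comp_units_def m_assoc[symmetric] Units_closed)

lemma comp_units_inv:
  assumes u: "u \<in> comp_units p"
  shows "inv u \<in> comp_units p"
proof -
  have U: "u \<in> Units R" using u by (simp add: comp_units_def)
  have "(\<one> \<ominus> idem p) \<otimes> u \<otimes> inv u = (\<one> \<ominus> idem p) \<otimes> inv u"
    using u by (simp add: comp_units_def)
  then show ?thesis using U by (simp add: comp_units_def m_assoc Units_closed)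
qed

lemma comp_units_fix:
  assumes u: "u \<in> comp_units p" and x: "x \<in> carrier R" "idem p \<otimes> x = \<zero>"
  shows "u \<otimes> x = x"
proof -
  have uc: "u \<in> carrier R" using u by (rule comp_units_closed)
  have *: "(\<one> \<ominus> idem p) \<otimes> x = x" using x idem_compl_mult[OF x(1), of p] by (simp add: minus_eq[of x])
  have "u \<otimes> x = u \<otimes> ((\<one> \<ominus> idem p) \<otimes> x)" using * by simp
  also have "\<dots> = ((\<one> \<ominus> idem p) \<otimes> u) \<otimes> x"
    using uc x(1) by (simp add: m_assoc[symmetric] m_comm)
  also have "\<dots> = x" using u * by (simp add: comp_units_def)
  finally show ?thesis .
qed

section \<open>Elements killed by p modulo an ideal, and unit orbits on them\<close>

definition p_torsion :: "nat \<Rightarrow> 'a set \<Rightarrow> 'a set" where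
  "p_torsion p H = {x \<in> carrier R. [p] \<cdot> x \<in> H}"

lemma ideal_preimage:
  assumes H: "ideal H R" and a: "a \<in> carrier R"
  shows "ideal {x \<in> carrier R. a \<otimes> x \<in> H} R"
proof -
  interpret H: ideal H R by fact
  have sub: "additive_subgroup {x \<in> carrier R. a \<otimes> x \<in> H} R"
  proof
    fix x assume "x \<in> {x \<in> carrier R. a \<otimes> x \<in> H}"
    then show "inv\<^bsub>add_monoid R\<^esub> x \<in> {x \<in> carrier R. a \<otimes> x \<in> H}"
      using a H.a_inv_closed by (auto simp: a_inv_def[symmetric] r_minus)
  qed (use a in \<open>auto simp: r_distr\<close>)
  show ?thesis
  proof (rule idealI[OF ring_axioms additive_subgroup.a_subgroup[OF sub]])
    fix x b assume x: "x \<in> {x \<in> carrier R. a \<otimes> x \<in> H}" and b: "b \<in> carrier R"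
    then have "a \<otimes> (x \<otimes> b) \<in> H" using a H.I_r_closed[of "a \<otimes> x" b] by (simp add: m_assoc)
    then show "x \<otimes> b \<in> {x \<in> carrier R. a \<otimes> x \<in> H}" "b \<otimes> x \<in> {x \<in> carrier R. a \<otimes> x \<in> H}"
      using x b m_comm[of b x] by auto
  qed
qed

lemma p_torsion_ideal:
  assumes "ideal H R"
  shows "ideal (p_torsion p H) R"
proof -
  have "p_torsion p H = {x \<in> carrier R. ([p] \<cdot> \<one>) \<otimes> x \<in> H}"
    by (auto simp: p_torsion_def nat_mult_one[symmetric])
  then show ?thesis using ideal_preimage[OF assms, of "[p] \<cdot> \<one>"] by simp
qed

lemma subset_p_torsion: "ideal H R \<Longrightarrow> H \<subseteq> p_torsion p H"
  unfolding p_torsion_def using ideal_nat_mult ideal.Icarr by auto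

lemma p_torsion_minus_idem:
  "p \<in> prime_set R \<Longrightarrow> ideal H R \<Longrightarrow> x \<in> p_torsion p H \<Longrightarrow> x \<ominus> idem p \<otimes> x \<in> H"
  unfolding p_torsion_def using p_multiple_cancel by blast

text \<open>Multiply \<open>x\<close> by the highest power of \<open>p\<close> that still leaves it
  outside \<open>H\<close>.\<close>

lemma p_torsion_exists:
  assumes p: "p \<in> prime_set R" and H: "ideal H R" and x: "x \<in> p_component R p" "x \<notin> H"
  obtains j where "[(p ^ j)] \<cdot> x \<in> p_torsion p H" "[(p ^ j)] \<cdot> x \<notin> H"
proof -
  note pp = prime_set_prime[OF p]
  have xc: "x \<in> carrier R" "idem p \<otimes> x = x" using x by (auto simp: p_component_eq[OF pp])
  define j where "j = (LEAST j. [(p ^ j)] \<cdot> x \<in> H)"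
  have "[(p ^ multiplicity p (Coset.order R))] \<cdot> x \<in> H"
    using prime_part_mult_idem[OF pp xc(1)] xc(2) H
    by (simp add: prime_part_def additive_subgroup.zero_closed ideal.axioms(1))
  then have j: "[(p ^ j)] \<cdot> x \<in> H" unfolding j_def by (rule LeastI)
  have "[(p ^ 0)] \<cdot> x \<notin> H" using x xc by simp
  then obtain i where i: "j = Suc i" using j by (cases j) auto
  then have "[(p ^ i)] \<cdot> x \<notin> H" unfolding j_def using not_less_Least[of i] by (metis lessI)
  moreover have "[(p ^ i)] \<cdot> x \<in> p_torsion p H"
    using j i xc by (simp add: p_torsion_def nat_mult_mult)
  ultimately show thesis using that by blast
qed

text \<open>Membership of \<open>p ^ i\<close> times a unit in an ideal depends on the exponent
  alone and persists for larger exponents. This allows elements of a component to be compared by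
  their exponents.\<close>

lemma p_component_unit_multiple:
  assumes H: "ideal H R" and u: "u \<in> comp_units p" and v: "v \<in> comp_units p"
    and m: "[(p ^ i)] \<cdot> (idem p \<otimes> u) \<in> H" and ij: "i \<le> j"
  shows "[(p ^ j)] \<cdot> (idem p \<otimes> v) \<in> H"
proof -
  have U: "u \<in> Units R" "u \<in> carrier R" "v \<in> carrier R"
    using u v by (auto simp: comp_units_def)
  have "(v \<otimes> inv u) \<otimes> [(p ^ i)] \<cdot> (idem p \<otimes> u) \<in> H"
    using m U by (intro ideal.I_l_closed[OF H]) auto
  moreover have "(v \<otimes> inv u) \<otimes> (idem p \<otimes> u) = idem p \<otimes> v"
  proof -
    have "(v \<otimes> inv u) \<otimes> (idem p \<otimes> u) = idem p \<otimes> v \<otimes> (inv u \<otimes> u)"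
      using U by (simp add: m_ac del: Units_l_inv Units_r_inv)
    then show ?thesis using U by simp
  qed
  ultimately have "[(p ^ i)] \<cdot> (idem p \<otimes> v) \<in> H" using U by (simp add: add_pow_rdistr)
  then have "[(p ^ (j - i))] \<cdot> ([(p ^ i)] \<cdot> (idem p \<otimes> v)) \<in> H" by (rule ideal_nat_mult[OF H])
  then show ?thesis using ij U by (simp add: nat_mult_mult power_add[symmetric])
qed

text \<open>Written as a power of \<open>p\<close> times a unit, both elements have the same
  exponent, namely the last one whose power stays outside \<open>H\<close>. So they differ by a unit
  factor.\<close>

lemma p_torsion_orbit:
  assumes p: "p \<in> prime_set R" and H: "ideal H R"
    and x: "x \<in> p_component R p" "x \<in> p_torsion p H" "x \<notin> H"
    and y: "y \<in> p_component R p" "y \<in> p_torsion p H" "y \<notin> H"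
  obtains u where "u \<in> comp_units p" "y = u \<otimes> x"
proof -
  obtain i u where u: "u \<in> comp_units p" "x = [(p ^ i)] \<cdot> (idem p \<otimes> u)"
    using p_component_cases[OF p x(1)] .
  obtain j v where v: "v \<in> comp_units p" "y = [(p ^ j)] \<cdot> (idem p \<otimes> v)"
    using p_component_cases[OF p y(1)] .
  have U: "u \<in> Units R" "u \<in> carrier R" "v \<in> carrier R"
    using u v by (auto simp: comp_units_def)
  have "[(p ^ Suc i)] \<cdot> (idem p \<otimes> u) \<in> H" "[(p ^ Suc j)] \<cdot> (idem p \<otimes> v) \<in> H"
    using x(2) y(2) u(2) v(2) U by (auto simp: p_torsion_def nat_mult_mult)
  then have "\<not> Suc i \<le> j" "\<not> Suc j \<le> i"
    using p_component_unit_multiple[OF H u(1) v(1)] p_component_unit_multiple[OF H v(1) u(1)]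
      x(3) y(3) u(2) v(2) by (auto simp del: power_Suc)
  then have ij: "i = j" by simp
  have "(v \<otimes> inv u) \<otimes> (idem p \<otimes> u) = idem p \<otimes> v \<otimes> (inv u \<otimes> u)"
    using U by (simp add: m_ac del: Units_l_inv Units_r_inv)
  then have "y = (v \<otimes> inv u) \<otimes> x" using u v ij U by (simp add: add_pow_rdistr)
  then show thesis using that comp_units_mult[OF v(1) comp_units_inv[OF u(1)]] by blast
qed

text \<open>The element \<open>w\<close> carries a strictly higher power of \<open>p\<close> than
  the component of \<open>x\<close>, so adding it only changes the unit factor, and that by an
  element of the radical.\<close>

lemma p_torsion_absorb:
  assumes p: "p \<in> prime_set R" and H: "ideal H R"
    and x: "x \<in> carrier R" "idem p \<otimes> x \<notin> p_torsion p H"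
    and w: "w \<in> p_component R p" "w \<in> p_torsion p H"
  obtains u where "u \<in> comp_units p" "x \<oplus> w = u \<otimes> x"
proof -
  note pp = prime_set_prime[OF p]
  obtain i u where u: "u \<in> comp_units p" "idem p \<otimes> x = [(p ^ i)] \<cdot> (idem p \<otimes> u)"
    using p_component_cases[OF p idem_mult_mem[OF pp x(1)]] .
  obtain j v where v: "v \<in> comp_units p" "w = [(p ^ j)] \<cdot> (idem p \<otimes> v)"
    using p_component_cases[OF p w(1)] .
  have U: "u \<in> Units R" "u \<in> carrier R" "v \<in> carrier R" "inv u \<in> carrier R"
    using u v by (auto simp: comp_units_def)
  have "\<not> j \<le> i"
    using p_component_unit_multiple[OF p_torsion_ideal[OF H] v(1) u(1)] w(2) x(2) u(2) v(2) by auto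
  then obtain k where k: "j = i + Suc k" by (metis add_Suc_right less_imp_Suc_add not_le)
  \<comment> \<open>Strictness of the inequality of exponents leaves one factor \<open>p\<close> to
    spare, which keeps \<open>u'\<close> a unit.\<close>
  define u' where "u' = u \<oplus> [p] \<cdot> ([(p ^ k)] \<cdot> (idem p \<otimes> v))"
  have "[(p ^ k)] \<cdot> (idem p \<otimes> v) \<in> p_component R p"
    using U idem_mult_assoc[OF pp] by (simp add: p_component_eq[OF pp] add_pow_rdistr)
  then have u': "u' \<in> comp_units p" unfolding u'_def by (rule comp_units_add[OF p u(1)])
  have "idem p \<otimes> u' = idem p \<otimes> u \<oplus> [(p ^ Suc k)] \<cdot> (idem p \<otimes> v)"
    using U idem_mult_assoc[OF pp] by (simp add: u'_def r_distr add_pow_rdistr nat_mult_mult)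
  then have "[(p ^ i)] \<cdot> (idem p \<otimes> u') = idem p \<otimes> x \<oplus> w"
    using U u(2) v(2) k
    by (simp add: add.nat_pow_distrib nat_mult_mult power_add[symmetric] del: power_Suc)
  moreover have "(u' \<otimes> inv u) \<otimes> (idem p \<otimes> x) = [(p ^ i)] \<cdot> (idem p \<otimes> u')"
  proof -
    have "(u' \<otimes> inv u) \<otimes> (idem p \<otimes> u) = idem p \<otimes> u' \<otimes> (inv u \<otimes> u)"
      using U comp_units_closed[OF u'] by (simp add: m_ac del: Units_l_inv Units_r_inv)
    then show ?thesis using u U comp_units_closed[OF u'] by (simp add: add_pow_rdistr)
  qed
  ultimately have *: "(u' \<otimes> inv u) \<otimes> (idem p \<otimes> x) = idem p \<otimes> x \<oplus> w" by simp
  have uu: "u' \<otimes> inv u \<in> comp_units p" by (rule comp_units_mult[OF u' comp_units_inv[OF u(1)]])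
  have "(u' \<otimes> inv u) \<otimes> x = (u' \<otimes> inv u) \<otimes> (idem p \<otimes> x \<oplus> (x \<ominus> idem p \<otimes> x))"
    using x by simp
  also have "\<dots> = (u' \<otimes> inv u) \<otimes> (idem p \<otimes> x) \<oplus> (u' \<otimes> inv u) \<otimes> (x \<ominus> idem p \<otimes> x)"
    using x U comp_units_closed[OF u'] by (intro r_distr) auto
  also have "\<dots> = (idem p \<otimes> x \<oplus> w) \<oplus> (x \<ominus> idem p \<otimes> x)"
    using * comp_units_fix[OF uu _ idem_mult_compl[OF pp x(1)]] x by simp
  also have "\<dots> = w \<oplus> (idem p \<otimes> x \<oplus> (x \<ominus> idem p \<otimes> x))"
    using x p_component_closed[OF w(1)] by (simp add: a_ac minus_closed del: add_minus_cancel_left)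
  also have "\<dots> = x \<oplus> w" using x p_component_closed[OF w(1)] by (simp add: a_comm)
  finally show thesis using that[OF uu] by simp
qed

lemma p_torsion_card:
  assumes p: "p \<in> prime_set R" and H: "ideal H R" and x: "x \<in> p_torsion p H" "x \<notin> H"
  obtains q where "card (p_torsion p H) = card H * q" "p dvd q" "q > 0"
proof -
  note pp = prime_set_prime[OF p]
  let ?K = "p_torsion p H"
  interpret K: ideal ?K R by (rule p_torsion_ideal[OF H])
  interpret H: ideal H R by fact
  have "p dvd card ?K div card H \<and> card H dvd card ?K"
  proof (rule add.prime_dvd_subgroup_index[OF H.a_subgroup K.a_subgroup subset_p_torsion[OF H] pp x])
    show "[p] \<cdot> x \<in> H" using x(1) unfolding p_torsion_def by blast
  qed
  moreover have "card ?K > 0"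
    using K.zero_closed finite_subset[OF K.a_subset finite_carrier] by (auto simp only: card_gt_0_iff)
  ultimately show thesis
    using that[of "card ?K div card H"] by (metis dvd_mult_div_cancel mult_0_right not_gr_zero)
qed

end

section \<open>Basic sets outside a maximal A-ideal\<close>

lemma (in finite_CG_ring) p_component_subset_Q_component:
  assumes p: "p \<in> Q" and Q: "Q \<subseteq> prime_set R"
  shows "p_component R p \<subseteq> Q_component R Q"
proof
  fix x assume x: "x \<in> p_component R p"
  have fin: "finite Q" using Q finite_prime_set by (rule finite_subset)
  let ?f = "\<lambda>q. if p = q then x else \<zero>"
  have "finsum R ?f Q = x"
    using add.finprod_singleton[OF p fin, of "\<lambda>_. x"] p_component_closed[OF x] by auto
  moreover have "?f \<in> (\<Pi> q\<in>Q. p_component R q)"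
  proof (rule Pi_I)
    fix q assume "q \<in> Q"
    then have "Factorial_Ring.prime q" using Q prime_set_prime by auto
    then show "?f q \<in> p_component R q" using x by (auto simp: p_component_eq)
  qed
  ultimately show "x \<in> Q_component R Q" unfolding Q_component_def
    by (intro CollectI exI[of _ ?f]) auto
qed

lemma (in finite_CG_ring) idem_mem_p_component:
  "Factorial_Ring.prime p \<Longrightarrow> idem p \<in> p_component R p"
  using idem_mult_mem[of p \<one>] by simp

lemma (in finite_CG_ring) Q_component_subset_ideal:
  assumes K: "ideal K R" and Q: "Q \<subseteq> prime_set R" and e: "\<And>p. p \<in> Q \<Longrightarrow> idem p \<in> K"
  shows "Q_component R Q \<subseteq> K"
proof
  fix x assume "x \<in> Q_component R Q"
  then obtain f where f: "f \<in> (\<Pi> p\<in>Q. p_component R p)" "x = finsum R f Q"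
    by (auto simp: Q_component_def)
  have "f p \<in> K" if "p \<in> Q" for p
  proof -
    have "Factorial_Ring.prime p" using that Q prime_set_prime by auto
    then have "f p \<in> carrier R" "idem p \<otimes> f p = f p" using Pi_mem[OF f(1) that] by (simp_all add: p_component_eq)
    then show ?thesis using ideal.I_r_closed[OF K e[OF that], of "f p"] by simp
  qed
  then show "x \<in> K"
    using additive_subgroup_finsum[OF ideal.axioms(1)[OF K] finite_subset[OF Q finite_prime_set]] f(2) by blast
qed

lemma (in finite_CG_ring) order_Quot:
  assumes "ideal I R"
  shows "Coset.order (R Quot I) * card I = Coset.order R"
  using a_lagrange[OF finite_carrier ideal.axioms(1)[OF assms]] by (simp add: order_def FactRing_def)

text \<open>If \<open>idem p\<close> is outside \<open>I\<close>, one of its multiples by a power of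
  \<open>p\<close> has order \<open>p\<close> modulo \<open>I\<close>. If it is inside,
  \<open>I\<close> contains the Sylow \<open>p\<close>-subgroup of \<open>R\<close>, and no factor
  \<open>p\<close> is left for the quotient.\<close>

lemma (in finite_CG_ring) prime_set_Quot:
  assumes I: "ideal I R"
  shows "p \<in> prime_set (R Quot I) \<longleftrightarrow> p \<in> prime_set R \<and> idem p \<notin> I"
proof
  interpret I: ideal I R by fact
  assume p: "p \<in> prime_set R \<and> idem p \<notin> I"
  then have pp: "Factorial_Ring.prime p" by (simp add: prime_set_prime)
  obtain j where "[(p ^ j)] \<cdot> idem p \<in> p_torsion p I" "[(p ^ j)] \<cdot> idem p \<notin> I"
    using p_torsion_exists[OF _ I idem_mem_p_component[OF pp]] p by blast
  then have "p dvd card (rcosets\<^bsub>add_monoid R\<^esub> I)"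
    unfolding p_torsion_def
    by (intro add.prime_dvd_card_rcosets[OF I.a_subgroup pp]) auto
  then have "p dvd Coset.order (R Quot I)"
    by (simp add: order_def FactRing_def A_RCOSETS_def)
  then show "p \<in> prime_set (R Quot I)" using pp by (simp add: prime_set_def)
next
  interpret I: ideal I R by fact
  assume p: "p \<in> prime_set (R Quot I)"
  then have pp: "Factorial_Ring.prime p" and pd: "p dvd Coset.order (R Quot I)"
    by (auto simp: prime_set_def)
  have "p dvd Coset.order R" using pd order_Quot[OF I] by (metis dvd_mult2)
  moreover have "idem p \<notin> I"
  proof
    assume e: "idem p \<in> I"
    have sub: "p_component R p \<subseteq> I"
    proof
      fix x assume "x \<in> p_component R p"
      then have "x \<in> carrier R" "idem p \<otimes> x = x" by (auto simp: p_component_eq[OF pp])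
      then show "x \<in> I" using I.I_r_closed[OF e, of x] by simp
    qed
    obtain m where m: "Coset.order R = prime_part p * m" using prime_part_dvd[of p] by blast
    obtain S where S: "subgroup S (add_monoid R)" "card S = prime_part p"
      using sylow_thm[OF pp a_group, of "multiplicity p (Coset.order R)" m] m finite_carrier
      by (auto simp: order_def prime_part_def)
    have "S = p_component R p"
      using p_component_sylow[OF is_cring finite_carrier pp S(1)] S(2) by (simp add: prime_part_def)
    then have "S \<subseteq> I" using sub by simp
    have "subgroup S (add_monoid R\<lparr>carrier := I\<rparr>)"
      by (rule add.subgroup_incl[OF S(1) I.a_subgroup \<open>S \<subseteq> I\<close>])
    from group.lagrange[OF add.subgroup_imp_group[OF I.a_subgroup] this]
    have "prime_part p dvd card I" using S(2) by (simp add: order_def) (metis dvd_triv_right)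
    then have "p * prime_part p dvd Coset.order R"
      using pd order_Quot[OF I] by (metis mult_dvd_mono)
    then have "p ^ Suc (multiplicity p (Coset.order R)) dvd Coset.order R" by (simp add: prime_part_def)
    then have "Suc (multiplicity p (Coset.order R)) \<le> multiplicity p (Coset.order R)"
      using order_pos pp by (intro multiplicity_geI) auto
    then show False by simp
  qed
  ultimately show "p \<in> prime_set R \<and> idem p \<notin> I" using pp by (simp add: prime_set_def)
qed

locale max_A_ideal_setting = S_ring_over_CG_ring +
  fixes I Q
  assumes max: "I \<in> max_A_ideals R A"
    and Q: "Q = prime_set (R Quot I)"
    and rational: "\<And>B. B \<in> blocks \<Longrightarrow> B \<subseteq> carrier R - I \<Longrightarrow> Q_rational R Q B"
begin

lemma A_ideal_I: "A_ideal R A I" and I_neq: "I \<noteq> carrier R"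
  and I_max: "A_ideal R A K \<Longrightarrow> K \<noteq> carrier R \<Longrightarrow> I \<subseteq> K \<Longrightarrow> K = I"
  using max by (auto simp: max_A_ideals_def)

lemma ideal_I: "ideal I R" and A_set_I: "A_set I"
  using A_ideal_I by (auto simp: A_ideal_iff)

sublocale I: ideal I R by (rule ideal_I)

declare I.a_Hcarr [simp del]

lemma Q_subset: "Q \<subseteq> prime_set R" and Q_idem: "p \<in> Q \<Longrightarrow> idem p \<notin> I"
  and not_Q_idem: "p \<in> prime_set R \<Longrightarrow> p \<notin> Q \<Longrightarrow> idem p \<in> I"
  using prime_set_Quot[OF ideal_I] by (auto simp: Q)

lemma Q_nonempty: "Q \<noteq> {}"
proof
  assume "Q = {}"
  then have "idem p \<otimes> \<one> \<in> I" if "p \<in> prime_set R" for p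
    using not_Q_idem[OF that] by simp
  then have "\<one> \<in> I" by (rule mem_if_idem_mem[OF I.additive_subgroup_axioms one_closed])
  then show False using I.one_imp_carrier I_neq by simp
qed

section \<open>Basic sets outside \<open>I\<close> and their common stabilizer\<close>

definition outer :: "'a set set" where
  "outer = {B \<in> blocks. B \<subseteq> carrier R - I}"

lemma outerI: "B \<in> blocks \<Longrightarrow> x \<in> B \<Longrightarrow> x \<notin> I \<Longrightarrow> B \<in> outer"
  unfolding outer_def using block_closed block_subset_A_set[OF _ A_set_I] A_setD[OF A_set_I] same_blockI
  by blast

lemma outerD: "B \<in> outer \<Longrightarrow> x \<in> B \<Longrightarrow> x \<in> carrier R \<and> x \<notin> I"
  by (auto simp: outer_def)

lemma outer_block: "B \<in> outer \<Longrightarrow> B \<in> blocks"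
  by (simp add: outer_def)

lemma outer_A_set: "B \<in> outer \<Longrightarrow> A_set B"
  by (simp add: outer_def A_set_block)

lemma outer_nonempty: "outer \<noteq> {}"
proof -
  obtain x where x: "x \<in> carrier R" "x \<notin> I" using I_neq I.a_subset by blast
  then obtain B where "B \<in> blocks" "x \<in> B" by (metis block_ex)
  then show ?thesis using outerI x by blast
qed

text \<open>All uses of maximality pass through this comaximality: 1, or a point of a basic set, is
  split into a summand in \<open>I\<close> and one in \<open>K\<close>.\<close>

lemma I_add_eq_carrier:
  assumes K: "A_ideal R A K" "\<not> K \<subseteq> I"
  shows "I <+>\<^bsub>R\<^esub> K = carrier R"
proof (rule ccontr)
  assume neq: "I <+>\<^bsub>R\<^esub> K \<noteq> carrier R"
  have Kid: "ideal K R" using K by (simp add: A_ideal_iff)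
  interpret K: ideal K R by fact
  have "I \<subseteq> I <+>\<^bsub>R\<^esub> K" "K \<subseteq> I <+>\<^bsub>R\<^esub> K"
  proof -
    have "x \<oplus> \<zero> \<in> I <+>\<^bsub>R\<^esub> K" if "x \<in> I" for x
      using that K.zero_closed unfolding set_add_def' by blast
    then show "I \<subseteq> I <+>\<^bsub>R\<^esub> K" using I.a_Hcarr by auto
    have "\<zero> \<oplus> x \<in> I <+>\<^bsub>R\<^esub> K" if "x \<in> K" for x
      using that I.zero_closed unfolding set_add_def' by blast
    then show "K \<subseteq> I <+>\<^bsub>R\<^esub> K" using K.a_Hcarr by auto
  qed
  then show False using I_max[OF A_ideal_set_add[OF A_ideal_I K(1)] neq] K(2) by simp
qed

lemma mem_I_add:
  assumes "A_ideal R A K" "\<not> K \<subseteq> I" "x \<in> carrier R"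
  obtains i k where "i \<in> I" "k \<in> K" "x = i \<oplus> k"
  using I_add_eq_carrier[OF assms(1,2)] assms(3) that unfolding set_add_def' by blast

text \<open>Otherwise a point of \<open>B\<close> is \<open>i + k\<close> with \<open>i\<close> in
  \<open>I\<close> and \<open>k\<close> in the stabilizer, and subtracting \<open>k\<close> puts
  \<open>i\<close> into \<open>B\<close>.\<close>

lemma stab_outer_subset_I:
  assumes B: "B \<in> outer"
  shows "stab B \<subseteq> I"
proof (rule ccontr)
  assume n: "\<not> stab B \<subseteq> I"
  have st: "A_ideal R A (stab B)" by (rule A_ideal_stab[OF outer_A_set[OF B]])
  then interpret S: ideal "stab B" R by (simp add: A_ideal_iff)
  obtain x where x: "x \<in> B" using block_nonempty[OF outer_block[OF B]] by blast
  then obtain i k where ik: "i \<in> I" "k \<in> stab B" "x = i \<oplus> k"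
    using mem_I_add[OF st n] outerD[OF B] by blast
  then have "x \<oplus> \<ominus> k \<in> B" using stabD x S.a_inv_closed by blast
  moreover have "x \<oplus> \<ominus> k = i" using ik I.a_Hcarr S.a_Hcarr by (simp add: a_assoc r_neg)
  ultimately show False using outerD[OF B] ik by blast
qed

definition N :: "'a set" where
  "N = (\<Inter>B\<in>outer. stab B)"

lemma A_ideal_N: "A_ideal R A N"
  unfolding N_def using outer_nonempty A_ideal_stab outer_A_set by (intro A_ideal_Inter) auto

lemma ideal_N: "ideal N R" and A_set_N: "A_set N"
  using A_ideal_N by (auto simp: A_ideal_iff)

sublocale N: ideal N R by (rule ideal_N)

declare N.a_Hcarr [simp del]

lemma N_subset_I: "N \<subseteq> I"
  using outer_nonempty stab_outer_subset_I by (auto simp: N_def)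

lemma outer_add_N: "B \<in> outer \<Longrightarrow> x \<in> B \<Longrightarrow> n \<in> N \<Longrightarrow> x \<oplus> n \<in> B"
  by (auto simp: N_def intro: stabD)

lemma outer_add_N_iff:
  assumes B: "B \<in> outer" and x: "x \<in> carrier R" and n: "n \<in> N"
  shows "x \<oplus> n \<in> B \<longleftrightarrow> x \<in> B"
proof
  assume "x \<oplus> n \<in> B"
  then have "x \<oplus> n \<oplus> \<ominus> n \<in> B" using outer_add_N[OF B] n N.a_inv_closed by blast
  then show "x \<in> B" using x n N.a_Hcarr by (simp add: a_assoc r_neg)
qed (rule outer_add_N[OF B _ n])

lemma outer_cong_N:
  assumes B: "B \<in> outer" and xy: "x \<in> carrier R" "y \<in> carrier R" "x \<ominus> y \<in> N"
  shows "x \<in> B \<longleftrightarrow> y \<in> B"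
  using outer_add_N_iff[OF B xy(2,3)] xy by simp

text \<open>The form in which rationality is used: only units concentrated in a single component
  with \<open>p\<close> in \<open>Q\<close>.\<close>

lemma outer_comp_units:
  assumes B: "B \<in> outer" and p: "p \<in> Q" and u: "u \<in> comp_units p" and x: "x \<in> B"
  shows "u \<otimes> x \<in> B"
proof -
  have "Q_units R Q <#>\<^bsub>R\<^esub> B = B" using B rational by (auto simp: outer_def Q_rational_def)
  moreover have "u \<in> Q_units R Q" using comp_units_subset_Q_units p Q_subset u by blast
  ultimately show ?thesis using x unfolding set_mult_def by blast
qed

section \<open>Slices of outer basic sets for a fixed prime of \<open>Q\<close>\<close>

context
  fixes p assumes pQ: "p \<in> Q"
begin

private lemma pR: "p \<in> prime_set R" using pQ Q_subset by auto

private lemma pp: "Factorial_Ring.prime p" using pR by (rule prime_set_prime)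

definition tors :: "'a set" where "tors = p_torsion p N"

text \<open>The elements with zero \<open>p\<close>-component modulo \<open>N\<close>. Membership in
  \<open>N\<close> in place of vanishing makes the condition invariant under \<open>N\<close>, like
  the counts below.\<close>

definition off :: "'a set" where "off = {x \<in> carrier R. idem p \<otimes> x \<in> N}"

interpretation tors: ideal tors R unfolding tors_def by (rule p_torsion_ideal[OF ideal_N])

interpretation off: ideal off R
  unfolding off_def by (rule ideal_preimage[OF ideal_N idem_closed])

declare tors.a_Hcarr [simp del] off.a_Hcarr [simp del]

lemma N_subset_tors: "N \<subseteq> tors"
  unfolding tors_def by (rule subset_p_torsion[OF ideal_N])

lemma tors_minus_idem: "k \<in> tors \<Longrightarrow> k \<ominus> idem p \<otimes> k \<in> N"
  unfolding tors_def by (rule p_torsion_minus_idem[OF pR ideal_N])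

lemma tors_minus_N_nonempty:
  obtains k where "k \<in> tors" "k \<notin> N" "k \<in> p_component R p"
proof -
  have "idem p \<notin> N" using Q_idem[OF pQ] N_subset_I by auto
  then obtain j where j: "[(p ^ j)] \<cdot> idem p \<in> tors" "[(p ^ j)] \<cdot> idem p \<notin> N"
    using p_torsion_exists[OF pR ideal_N idem_mem_p_component[OF pp]] unfolding tors_def by blast
  moreover have "[(p ^ j)] \<cdot> idem p \<in> p_component R p"
    using idem_idem[OF pp] by (simp add: p_component_eq[OF pp] add_pow_rdistr)
  ultimately show thesis using that by blast
qed

text \<open>Otherwise \<open>core off\<close> is an A-ideal not inside \<open>I\<close>, so 1 is the
  sum of an element of \<open>I\<close> and one of \<open>off\<close>. Multiplication by
  \<open>idem p\<close> then puts \<open>idem p\<close> into \<open>I\<close>, against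
  \<open>p\<close> in \<open>Q\<close>.\<close>

lemma A_set_off_subset_I:
  assumes X: "A_set X" "X \<subseteq> off"
  shows "X \<subseteq> I"
proof (rule ccontr)
  assume "\<not> X \<subseteq> I"
  then have n: "\<not> core off \<subseteq> I" using A_set_subset_core[OF X] by blast
  obtain i k where ik: "i \<in> I" "k \<in> core off" "\<one> = i \<oplus> k"
    using mem_I_add[OF A_ideal_core[OF off.ideal_axioms] n one_closed] .
  have kc: "k \<in> off" "k \<in> carrier R" using ik core_subset off.a_subset by blast+
  have "idem p = idem p \<otimes> (i \<oplus> k)" using r_one[OF idem_closed[of p]] unfolding ik(3) by simp
  also have "\<dots> = idem p \<otimes> i \<oplus> idem p \<otimes> k" using ik I.a_Hcarr kc by (simp add: r_distr)
  also have "\<dots> \<in> I"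
    using I.I_l_closed[OF ik(1) idem_closed] kc(1) N_subset_I by (intro I.a_closed) (auto simp: off_def)
  finally show False using Q_idem[OF pQ] by simp
qed

text \<open>Adding the \<open>p\<close>-component of \<open>k\<close> amounts to multiplying
  \<open>x\<close> by a unit that preserves \<open>B\<close>; the rest of \<open>k\<close> lies in
  \<open>N\<close>.\<close>

lemma outer_add_tors:
  assumes B: "B \<in> outer" and x: "x \<in> B" "idem p \<otimes> x \<notin> tors" and k: "k \<in> tors"
  shows "x \<oplus> k \<in> B"
proof -
  have xc: "x \<in> carrier R" using outerD[OF B x(1)] by simp
  have kc: "k \<in> carrier R" using k tors.a_Hcarr by simp
  have w: "idem p \<otimes> k \<in> p_component R p" "idem p \<otimes> k \<in> p_torsion p N"
    using idem_mult_mem[OF pp kc] tors.I_l_closed[OF k] by (auto simp: tors_def)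
  obtain u where "u \<in> comp_units p" "x \<oplus> idem p \<otimes> k = u \<otimes> x"
    using p_torsion_absorb[OF pR ideal_N xc _ w] x(2) unfolding tors_def by blast
  then have "x \<oplus> idem p \<otimes> k \<in> B" using outer_comp_units[OF B pQ _ x(1)] by simp
  from outer_add_N[OF B this tors_minus_idem[OF k]] show ?thesis
    using xc kc by (simp add: a_assoc)
qed

text \<open>Some unit of the \<open>p\<close>-component carries the component of \<open>k\<close> to
  that of \<open>k'\<close> and fixes the part of \<open>y\<close> outside the component. Everything
  else lies in \<open>N\<close>.\<close>

lemma outer_tors_orbit:
  assumes B: "B \<in> outer" and y: "y \<in> off" and k: "k \<in> tors" "k \<notin> N" and k': "k' \<in> tors" "k' \<notin> N"
    and yk: "y \<oplus> k \<in> B"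
  shows "y \<oplus> k' \<in> B"
proof -
  let ?e = "idem p"
  have c: "y \<in> carrier R" "k \<in> carrier R" "k' \<in> carrier R" "?e \<otimes> y \<in> N"
    using y k k' tors.a_Hcarr by (auto simp: off_def)
  have comp: "?e \<otimes> h \<in> p_component R p \<and> ?e \<otimes> h \<in> p_torsion p N \<and> ?e \<otimes> h \<notin> N"
    if "h \<in> tors" "h \<notin> N" for h
  proof -
    have hc: "h \<in> carrier R" using that tors.a_Hcarr by simp
    have "?e \<otimes> h \<notin> N"
    proof
      assume "?e \<otimes> h \<in> N"
      then have "?e \<otimes> h \<oplus> (h \<ominus> ?e \<otimes> h) \<in> N" using tors_minus_idem that by blast
      then show False using that hc by simp
    qed
    then show ?thesis using idem_mult_mem[OF pp hc] tors.I_l_closed[OF that(1)] by (auto simp: tors_def)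
  qed
  obtain u where u: "u \<in> comp_units p" "?e \<otimes> k' = u \<otimes> (?e \<otimes> k)"
    using p_torsion_orbit[OF pR ideal_N] comp[OF k] comp[OF k'] by metis
  let ?y = "y \<ominus> ?e \<otimes> y"
  have eq: "(y \<oplus> h) \<in> B \<longleftrightarrow> ?y \<oplus> ?e \<otimes> h \<in> B" if h: "h \<in> tors" for h
  proof (rule outer_cong_N[OF B])
    have hc: "h \<in> carrier R" using h tors.a_Hcarr by simp
    have "(y \<oplus> h) \<ominus> (?y \<oplus> ?e \<otimes> h) = (?e \<otimes> y) \<oplus> (h \<ominus> ?e \<otimes> h)"
      using c hc by (simp add: minus_eq minus_add a_ac r_neg1 r_neg2)
    then show "(y \<oplus> h) \<ominus> (?y \<oplus> ?e \<otimes> h) \<in> N" using c(4) tors_minus_idem[OF h] by simp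
  qed (use c h tors.a_Hcarr in auto)
  have "?y \<oplus> ?e \<otimes> k \<in> B" using eq[OF k(1)] yk by simp
  then have "u \<otimes> (?y \<oplus> ?e \<otimes> k) \<in> B" by (rule outer_comp_units[OF B pQ u(1)])
  moreover have "u \<otimes> (?y \<oplus> ?e \<otimes> k) = ?y \<oplus> ?e \<otimes> k'"
    using u comp_units_closed[OF u(1)] c comp_units_fix[OF u(1) _ idem_mult_compl[OF pp c(1)]]
    by (simp add: r_distr)
  ultimately show ?thesis using eq[OF k'(1)] by simp
qed

text \<open>
  For \<open>y\<close> in \<open>off\<close>, the number of preimages of \<open>p y\<close> in \<open>B\<close> modulo \<open>N\<close> is prime to \<open>p\<close>
  precisely when \<open>y\<close> belongs to the following set.
\<close>

definition slice :: "'a set \<Rightarrow> 'a set" where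
  "slice B = {y \<in> off. (\<exists>k\<in>tors. y \<oplus> k \<in> B) \<and> (\<exists>k\<in>tors. y \<oplus> k \<notin> B)}"

text \<open>Dividing by \<open>card N\<close> counts cosets instead of elements, so that a factor
  \<open>p\<close> of \<open>card N\<close> cannot hide the residue.\<close>

private definition cnt :: "'a set \<Rightarrow> 'a \<Rightarrow> nat" where
  "cnt B z = card {x \<in> B. z \<ominus> [p] \<cdot> x \<in> N} div card N"

private lemma cnt_cong:
  assumes B: "B \<in> outer" and z: "z \<approx> z'"
  shows "p dvd cnt B z \<longleftrightarrow> p dvd cnt B z'"
  using card_p_multiple_cong[OF pp N.additive_subgroup_axioms A_set_N outer_A_set[OF B] outer_add_N[OF B] z]
  unfolding cnt_def by (rule cong_dvd_iff)

private lemma cnt_cong_N: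
  assumes "z \<in> carrier R" "z' \<in> carrier R" "z \<ominus> z' \<in> N" "B \<in> outer"
  shows "cnt B z = cnt B z'"
proof -
  have "z \<ominus> [p] \<cdot> x \<in> N \<longleftrightarrow> z' \<ominus> [p] \<cdot> x \<in> N" if "x \<in> B" for x
    using minus_mem_cancel(1)[OF N.additive_subgroup_axioms assms(1,2) _ assms(3)] that
      outerD[OF assms(4)] by simp
  then show ?thesis unfolding cnt_def by (metis (mono_tags, lifting) Collect_cong)
qed

text \<open>Two elements have the same multiple by \<open>p\<close> modulo \<open>N\<close> exactly
  when they differ by an element of \<open>tors\<close>.\<close>

private lemma cnt_p_multiple:
  assumes B: "B \<in> outer" and y: "y \<in> carrier R"
  shows "cnt B ([p] \<cdot> y) = card {k \<in> tors. y \<oplus> k \<in> B} div card N"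
proof -
  have "[p] \<cdot> y \<ominus> [p] \<cdot> x \<in> N \<longleftrightarrow> x \<ominus> y \<in> tors" if x: "x \<in> carrier R" for x
  proof -
    have "[p] \<cdot> y \<ominus> [p] \<cdot> x = \<ominus> ([p] \<cdot> (x \<ominus> y))"
      using x y by (simp add: minus_eq add.nat_pow_distrib add.nat_pow_inv minus_add a_comm)
    moreover have "\<ominus> z \<in> N \<longleftrightarrow> z \<in> N" if "z \<in> carrier R" for z
      using N.a_inv_closed[of z] N.a_inv_closed[of "\<ominus> z"] that by auto
    ultimately show ?thesis using x y by (simp add: tors_def p_torsion_def)
  qed
  then have "{x \<in> B. [p] \<cdot> y \<ominus> [p] \<cdot> x \<in> N} = {x \<in> B. x \<ominus> y \<in> tors}"
    using outerD[OF B] by blast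
  also have "\<dots> = (\<lambda>k. y \<oplus> k) ` {k \<in> tors. y \<oplus> k \<in> B}"
  proof (intro equalityI subsetI)
    fix x assume x: "x \<in> {x \<in> B. x \<ominus> y \<in> tors}"
    then have "x = y \<oplus> (x \<ominus> y)" using outerD[OF B] y by simp
    then show "x \<in> (\<lambda>k. y \<oplus> k) ` {k \<in> tors. y \<oplus> k \<in> B}" using x by force
  qed (use y tors.a_Hcarr in auto)
  finally have "card {x \<in> B. [p] \<cdot> y \<ominus> [p] \<cdot> x \<in> N} = card {k \<in> tors. y \<oplus> k \<in> B}"
    using y tors.a_Hcarr by (simp add: card_image inj_on_def)
  then show ?thesis by (simp add: cnt_def)
qed

private lemma card_tors:
  obtains q where "card tors = card N * q" "p dvd q" "q > 0" "card N > 0"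
proof -
  have "card N > 0"
    using N.zero_closed finite_subset[OF N.a_subset finite_carrier] by (auto simp only: card_gt_0_iff)
  moreover obtain k where "k \<in> tors" "k \<notin> N" using tors_minus_N_nonempty .
  ultimately show thesis using p_torsion_card[OF pR ideal_N] that unfolding tors_def by metis
qed

private lemma cnt_full:
  assumes B: "B \<in> outer" and y: "y \<in> carrier R" and all: "\<And>k. k \<in> tors \<Longrightarrow> y \<oplus> k \<in> B"
  shows "p dvd cnt B ([p] \<cdot> y)"
proof -
  have "{k \<in> tors. y \<oplus> k \<in> B} = tors" using all by auto
  moreover obtain q where "card tors = card N * q" "p dvd q" "card N > 0" using card_tors .
  ultimately show ?thesis using cnt_p_multiple[OF B y] by simp
qed

private lemma off_closed: "y \<in> off \<Longrightarrow> y \<in> carrier R"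
  by (simp add: off_def)

text \<open>Whether \<open>y + k\<close> is in \<open>B\<close> has one answer for all
  \<open>k\<close> in \<open>N\<close> and one for all \<open>k\<close> in \<open>tors - N\<close>.
  The count is therefore q, 1, q - 1 or 0, where q is the index of \<open>N\<close> in
  \<open>tors\<close> and is divisible by \<open>p\<close>; the slice is the case of two different
  answers.\<close>

private lemma p_dvd_cnt_iff:
  assumes B: "B \<in> outer" and y: "y \<in> off"
  shows "p dvd cnt B ([p] \<cdot> y) \<longleftrightarrow> y \<notin> slice B"
proof -
  have yc: "y \<in> carrier R" using y by (rule off_closed)
  obtain q where q: "card tors = card N * q" "p dvd q" "q > 0" "card N > 0" using card_tors .
  obtain k0 where k0: "k0 \<in> tors" "k0 \<notin> N" using tors_minus_N_nonempty .
  have fin: "finite tors" using tors.a_subset finite_carrier by (rule finite_subset)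
  have onN: "y \<oplus> k \<in> B \<longleftrightarrow> y \<in> B" if "k \<in> N" for k using outer_add_N_iff[OF B yc that] .
  have offN: "y \<oplus> k \<in> B \<longleftrightarrow> y \<oplus> k0 \<in> B" if "k \<in> tors" "k \<notin> N" for k
    using outer_tors_orbit[OF B y that k0] outer_tors_orbit[OF B y k0 that] by blast
  have slice: "y \<in> slice B \<longleftrightarrow> (y \<in> B) \<noteq> (y \<oplus> k0 \<in> B)"
  proof -
    have "(\<exists>k\<in>tors. y \<oplus> k \<in> B) \<longleftrightarrow> y \<in> B \<or> y \<oplus> k0 \<in> B"
      using onN offN k0 N.zero_closed N_subset_tors by blast
    moreover have "(\<exists>k\<in>tors. y \<oplus> k \<notin> B) \<longleftrightarrow> y \<notin> B \<or> y \<oplus> k0 \<notin> B"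
      using onN offN k0 N.zero_closed N_subset_tors by blast
    ultimately show ?thesis using y by (auto simp: slice_def)
  qed
  have np: "\<not> p dvd 1" "\<not> p dvd q - 1"
  proof -
    show 1: "\<not> p dvd 1" using pp by auto
    show "\<not> p dvd q - 1"
    proof
      assume "p dvd q - 1"
      then have "p dvd q - (q - 1)" using q(2) by (rule dvd_diff_nat[rotated])
      then show False using 1 q(3) by simp
    qed
  qed
  have diff: "card (tors - N) = card N * (q - 1)"
    using q(1) card_Diff_subset[OF finite_subset[OF N_subset_tors fin] N_subset_tors]
    by (simp add: diff_mult_distrib2)
  consider "y \<in> B" "y \<oplus> k0 \<in> B" | "y \<in> B" "y \<oplus> k0 \<notin> B" | "y \<notin> B" "y \<oplus> k0 \<in> B" | "y \<notin> B" "y \<oplus> k0 \<notin> B"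
    by blast
  then show ?thesis
  proof cases
    case 1
    then have "{k \<in> tors. y \<oplus> k \<in> B} = tors" using onN offN by blast
    then show ?thesis using cnt_p_multiple[OF B yc] q 1 slice by simp
  next
    case 2
    then have "{k \<in> tors. y \<oplus> k \<in> B} = N" using onN offN N_subset_tors by blast
    then show ?thesis using cnt_p_multiple[OF B yc] q 2 slice np by simp
  next
    case 3
    then have "{k \<in> tors. y \<oplus> k \<in> B} = tors - N" using onN offN by blast
    then show ?thesis using cnt_p_multiple[OF B yc] q 3 slice np diff by simp
  next
    case 4
    then have none: "{k \<in> tors. y \<oplus> k \<in> B} = {}" using onN offN by blast
    have "cnt B ([p] \<cdot> y) = 0" unfolding cnt_p_multiple[OF B yc] none by simp
    then show ?thesis using 4 slice by simp
  qed
qed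

private lemma cnt_twist:
  assumes B: "B \<in> outer" and y: "y \<in> off"
  shows "cnt B (twist p \<otimes> y) = cnt B ([p] \<cdot> y)"
proof (rule cnt_cong_N[OF _ _ _ B])
  have yc: "y \<in> carrier R" and ey: "idem p \<otimes> y \<in> N" using y by (auto simp: off_def)
  have "twist p \<otimes> y \<ominus> [p] \<cdot> y = (idem p \<otimes> y \<oplus> ([p] \<cdot> y \<ominus> [p] \<cdot> (idem p \<otimes> y))) \<ominus> [p] \<cdot> y"
    using twist_mult[OF yc, of p] yc
    by (simp add: minus_eq add.nat_pow_distrib add.nat_pow_inv)
  also have "\<dots> = idem p \<otimes> y \<ominus> [p] \<cdot> (idem p \<otimes> y)"
    using yc by (simp add: minus_eq a_assoc a_comm[of "\<ominus> ([p] \<cdot> (idem p \<otimes> y))" "\<ominus> ([p] \<cdot> y)"] r_neg2)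
  also have "\<dots> \<in> N" using ey ideal_nat_mult[OF ideal_N ey, of p] by (simp add: minus_eq)
  finally show "twist p \<otimes> y \<ominus> [p] \<cdot> y \<in> N" .
  show "twist p \<otimes> y \<in> carrier R" "[p] \<cdot> y \<in> carrier R"
    using yc Units_closed[OF twist_unit[OF pR]] by auto
qed

text \<open>A count prime to \<open>p\<close> passes from \<open>twist p y\<close> to
  \<open>twist p z\<close>. The point is that \<open>z\<close> lies in \<open>off\<close>: there is
  \<open>x\<close> in \<open>B\<close> with \<open>p x\<close> congruent to
  \<open>twist p z\<close>. Its \<open>p\<close>-component is in \<open>tors\<close>, since
  otherwise \<open>B\<close> would contain \<open>x + tors\<close> and the count would be divisible
  by \<open>p\<close>. Comparing \<open>p\<close>-components, where \<open>twist p\<close> is the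
  identity, puts that of \<open>z\<close> into \<open>N\<close>.\<close>

lemma A_set_slice:
  assumes B: "B \<in> outer"
  shows "A_set (slice B)"
proof (rule A_setI)
  show "slice B \<subseteq> carrier R" using off_closed by (auto simp: slice_def)
  fix y z assume y: "y \<in> slice B" and yz: "y \<approx> z"
  note zc = same_block_closed(2)[OF yz]
  have "twist p \<otimes> y \<approx> twist p \<otimes> z" using yz twist_unit[OF pR] by (rule same_block_unit)
  moreover have "\<not> p dvd cnt B (twist p \<otimes> y)"
    using p_dvd_cnt_iff[OF B] cnt_twist[OF B] y by (auto simp: slice_def)
  ultimately have nz: "\<not> p dvd cnt B (twist p \<otimes> z)" using cnt_cong[OF B] by blast
  then have "{x \<in> B. twist p \<otimes> z \<ominus> [p] \<cdot> x \<in> N} \<noteq> {}" unfolding cnt_def by (metis card.empty div_0 dvd_0_right)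
  then obtain x where x: "x \<in> B" "twist p \<otimes> z \<ominus> [p] \<cdot> x \<in> N" by blast
  have xc: "x \<in> carrier R" using outerD[OF B x(1)] by simp
  have tc: "twist p \<otimes> z \<in> carrier R" using zc Units_closed[OF twist_unit[OF pR]] by simp
  have "\<not> p dvd cnt B ([p] \<cdot> x)" using nz cnt_cong_N[OF tc _ x(2) B] xc by simp
  then have ex: "idem p \<otimes> x \<in> tors" using cnt_full[OF B xc] outer_add_tors[OF B x(1)] by blast
  have "idem p \<otimes> (twist p \<otimes> z \<ominus> [p] \<cdot> x) \<in> N" using x(2) by (rule N.I_l_closed) simp
  moreover have "idem p \<otimes> (twist p \<otimes> z \<ominus> [p] \<cdot> x) = idem p \<otimes> z \<ominus> [p] \<cdot> (idem p \<otimes> x)"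
  proof -
    have "idem p \<otimes> (twist p \<otimes> z) = idem p \<otimes> z"
      using twist_mult[OF zc, of p] zc idem_mult_assoc[OF pp zc] idem_mult_compl[OF pp zc]
      by (simp add: r_distr add_pow_rdistr)
    then show ?thesis using tc xc by (simp add: minus_eq r_distr r_minus add_pow_rdistr)
  qed
  moreover have "[p] \<cdot> (idem p \<otimes> x) \<in> N" using ex by (simp add: tors_def p_torsion_def)
  ultimately have "idem p \<otimes> z \<ominus> [p] \<cdot> (idem p \<otimes> x) \<oplus> [p] \<cdot> (idem p \<otimes> x) \<in> N"
    using N.a_closed by metis
  then have "z \<in> off" using zc xc by (simp add: off_def)
  then show "z \<in> slice B" using p_dvd_cnt_iff[OF B] cnt_twist[OF B] nz by simp
qed

lemma slice_subset_I: "B \<in> outer \<Longrightarrow> slice B \<subseteq> I"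
  by (rule A_set_off_subset_I[OF A_set_slice]) (auto simp: slice_def)

text \<open>For \<open>y\<close> in \<open>I\<close> the coset \<open>y + N\<close> misses
  \<open>B\<close>, so only the common answer on \<open>tors - N\<close> matters, and a single
  \<open>k\<close> decides. Slices of different basic sets can thus be tested with the same
  \<open>k\<close>.\<close>

lemma slice_iff:
  assumes B: "B \<in> outer" and k: "k \<in> tors" "k \<notin> N"
  shows "y \<in> slice B \<longleftrightarrow> y \<in> off \<and> y \<in> I \<and> y \<oplus> k \<in> B"
proof
  assume y: "y \<in> slice B"
  then have yI: "y \<in> I" and yo: "y \<in> off" using slice_subset_I[OF B] by (auto simp: slice_def)
  obtain h where h: "h \<in> tors" "y \<oplus> h \<in> B" using y by (auto simp: slice_def)
  have "h \<notin> N"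
  proof
    assume "h \<in> N"
    then have "y \<oplus> h \<in> I" using yI N_subset_I by blast
    then show False using outerD[OF B h(2)] by simp
  qed
  then show "y \<in> off \<and> y \<in> I \<and> y \<oplus> k \<in> B" using outer_tors_orbit[OF B yo h(1) _ k h(2)] yI yo by simp
next
  assume y: "y \<in> off \<and> y \<in> I \<and> y \<oplus> k \<in> B"
  then have "y \<oplus> \<zero> \<notin> B" using outerD[OF B, of y] off_closed by auto
  then show "y \<in> slice B" using y k(1) tors.zero_closed unfolding slice_def by blast
qed

text \<open>If the \<open>p\<close>-component of \<open>x\<close> is in \<open>tors\<close>, then
  \<open>x\<close> lies in a coset of \<open>tors\<close> centred in \<open>off\<close>, which meets
  \<open>B\<close> and, for want of a slice, is contained in it. All other \<open>x\<close> absorb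
  \<open>tors\<close> anyway.\<close>

lemma tors_subset_stab:
  assumes B: "B \<in> outer" and empty: "slice B = {}"
  shows "tors \<subseteq> stab B"
proof (rule ideal_subset_stab[OF tors.ideal_axioms])
  fix x k assume x: "x \<in> B" and k: "k \<in> tors"
  have xc: "x \<in> carrier R" using outerD[OF B x] by simp
  show "x \<oplus> k \<in> B"
  proof (cases "idem p \<otimes> x \<in> tors")
    case True
    let ?y = "x \<ominus> idem p \<otimes> x"
    have "?y \<in> off" using xc idem_mult_compl[OF pp xc] by (simp add: off_def)
    moreover have "?y \<oplus> idem p \<otimes> x \<in> B" using x xc by simp
    ultimately have "?y \<oplus> (idem p \<otimes> x \<oplus> k) \<in> B"
      using empty True k tors.a_closed unfolding slice_def by blast
    moreover have "?y \<oplus> (idem p \<otimes> x \<oplus> k) = x \<oplus> k"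
      using xc tors.a_Hcarr[OF k] by (simp add: a_assoc[symmetric])
    ultimately show ?thesis by simp
  qed (rule outer_add_tors[OF B x _ k])
qed

text \<open>Some \<open>B\<close> is not stabilized by \<open>tors\<close>, so its slice has a point
  \<open>y\<close>, which lies in \<open>I\<close>. If \<open>k\<close> were outside
  \<open>N\<close>, then \<open>y + k\<close> would be in \<open>B\<close>, hence outside
  \<open>I\<close>.\<close>

lemma tors_inter_I_subset_N: "tors \<inter> I \<subseteq> N"
proof
  fix k assume k: "k \<in> tors \<inter> I"
  obtain k0 where k0: "k0 \<in> tors" "k0 \<notin> N" using tors_minus_N_nonempty .
  then obtain B where B: "B \<in> outer" "k0 \<notin> stab B" by (auto simp: N_def)
  then obtain y where y: "y \<in> slice B" using tors_subset_stab k0 by blast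
  show "k \<in> N"
  proof (rule ccontr)
    assume "k \<notin> N"
    then have "y \<in> I" "y \<oplus> k \<in> B" using slice_iff[OF B(1), of k y] y k by auto
    then show False using outerD[OF B(1), of "y \<oplus> k"] k by auto
  qed
qed

text \<open>A component outside \<open>N\<close> would have a multiple by a power of
  \<open>p\<close> that is in \<open>tors\<close> but not in \<open>N\<close>, and it would still be
  in \<open>I\<close>.\<close>

lemma idem_mult_I_subset_N:
  assumes x: "x \<in> I"
  shows "idem p \<otimes> x \<in> N"
proof (rule ccontr)
  assume n: "idem p \<otimes> x \<notin> N"
  have xc: "x \<in> carrier R" using x I.a_Hcarr by blast
  obtain j where "[(p ^ j)] \<cdot> (idem p \<otimes> x) \<in> tors" "[(p ^ j)] \<cdot> (idem p \<otimes> x) \<notin> N"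
    using p_torsion_exists[OF pR ideal_N idem_mult_mem[OF pp xc] n] unfolding tors_def by blast
  moreover have "[(p ^ j)] \<cdot> (idem p \<otimes> x) \<in> I"
    using x by (intro ideal_nat_mult[OF ideal_I] I.I_l_closed) auto
  ultimately show False using tors_inter_I_subset_N by blast
qed

text \<open>Otherwise \<open>tors\<close> lies in \<open>stab B\<close>, hence in \<open>I\<close>,
  hence in \<open>N\<close>.\<close>

lemma slice_nonempty:
  assumes B: "B \<in> outer"
  shows "slice B \<noteq> {}"
proof
  assume "slice B = {}"
  then have "tors \<subseteq> I" using tors_subset_stab[OF B] stab_outer_subset_I[OF B] by blast
  then show False using tors_inter_I_subset_N tors_minus_N_nonempty by blast
qed

end

end

section \<open>The basic set of a torsion element\<close>

context max_A_ideal_setting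
begin

lemma base_block_outer:
  assumes p: "p \<in> Q" and X: "X \<in> blocks" "k \<in> X" and k: "k \<in> tors p" "k \<notin> N"
  shows "X \<in> outer"
  using outerI[OF X] tors_inter_I_subset_N[OF p] k by blast

lemma base_block_add_slice:
  assumes p: "p \<in> Q" and X: "X \<in> blocks" "k \<in> X" and k: "k \<in> tors p" "k \<notin> N"
    and B: "B \<in> outer" and x: "x \<in> X" and y: "y \<in> slice p B"
  shows "x \<oplus> y \<in> B"
proof -
  let ?Y = "slice p B"
  note AY = A_set_slice[OF p B]
  have kc: "k \<in> carrier R" and xc: "x \<in> carrier R" using X x block_closed by blast+
  have "k \<oplus> y \<in> B" if "y \<in> ?Y" for y
    using that slice_iff[OF p B k, of y] A_set_closed[OF AY that] kc by (simp add: a_comm)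
  then have "{y \<in> ?Y. k \<oplus> y \<in> B} = ?Y" by blast
  moreover have "card {y \<in> ?Y. k \<oplus> y \<in> B} = card {y \<in> ?Y. x \<oplus> y \<in> B}"
    by (rule card_plus_same_block[OF outer_A_set[OF B] AY same_blockI[OF X x]])
  ultimately have "{y \<in> ?Y. x \<oplus> y \<in> B} = ?Y"
    using A_set_finite[OF AY] by (intro card_subset_eq) auto
  then show ?thesis using y by blast
qed

lemma base_block_slice_subset_N:
  assumes p: "p \<in> Q" and X: "X \<in> blocks" "k \<in> X" and k: "k \<in> tors p" "k \<notin> N"
  shows "slice p X \<subseteq> N"
proof -
  let ?Y = "slice p X"
  have pR: "p \<in> prime_set R" using p Q_subset by auto
  have tors_ideal: "ideal (tors p) R" unfolding tors_def[OF p] by (rule p_torsion_ideal[OF ideal_N])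
  have off_ideal: "ideal (off p) R"
    unfolding off_def[OF p] by (rule ideal_preimage[OF ideal_N idem_closed])
  note Xo = base_block_outer[OF assms]
  note AY = A_set_slice[OF p Xo]
  note add = base_block_add_slice[OF assms]
  note iff = slice_iff[OF p Xo k]
  have kc: "k \<in> carrier R" using X block_closed by blast
  have Yc: "y \<in> carrier R" if "y \<in> ?Y" for y using A_set_closed[OF AY that] .
  \<comment> \<open>Rationality only covers units from the components in \<open>Q\<close>. For an
    arbitrary unit, \<open>u k\<close> is again in \<open>tors\<close> and outside \<open>N\<close>,
    so the orbit argument centred at zero puts it into \<open>X\<close>.\<close>
  have unit_X: "u \<otimes> x \<in> X" if u: "u \<in> Units R" and x: "x \<in> X" for u x
  proof -
    have uk: "u \<otimes> k \<in> tors p" using ideal.I_l_closed[OF tors_ideal k(1)] u by (simp add: Units_closed)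
    have "u \<otimes> k \<notin> N"
    proof
      assume "u \<otimes> k \<in> N"
      then have "inv u \<otimes> (u \<otimes> k) \<in> N" using u by (rule N.I_l_closed[OF _ Units_inv_closed])
      then show False using k(2) u kc by (simp add: m_assoc[symmetric] Units_closed)
    qed
    then have "\<zero> \<oplus> u \<otimes> k \<in> X"
      using outer_tors_orbit[OF p Xo _ k uk, of \<zero>] X(2) kc
        additive_subgroup.zero_closed[OF ideal.axioms(1)[OF off_ideal]] by simp
    then have "u \<otimes> k \<in> X" using u kc by (simp add: Units_closed)
    moreover have "u \<otimes> k \<approx> u \<otimes> x" using same_block_unit[OF same_blockI[OF X x] u] .
    ultimately show ?thesis using same_block_iff[OF X(1)] by blast
  qed
  have zero: "\<zero> \<in> ?Y"
    using iff[of \<zero>] X(2) kc additive_subgroup.zero_closed[OF ideal.axioms(1)[OF off_ideal]] by simp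
  have "additive_subgroup ?Y R"
  proof (rule additive_subgroupI_finite)
    fix y z assume y: "y \<in> ?Y" and z: "z \<in> ?Y"
    have "(k \<oplus> y) \<oplus> z \<in> X" using add[OF Xo add[OF Xo X(2) y] z] .
    then have "(y \<oplus> z) \<oplus> k \<in> X" using Yc[OF y] Yc[OF z] kc by (simp add: a_ac)
    moreover have "y \<oplus> z \<in> off p"
      using y z iff additive_subgroup.a_closed[OF ideal.axioms(1)[OF off_ideal]] by blast
    moreover have "y \<oplus> z \<in> I" using y z iff I.a_closed by blast
    ultimately show "y \<oplus> z \<in> ?Y" using iff by blast
  qed (use zero Yc in auto)
  then have Yid: "ideal ?Y R"
  proof (rule unit_invariant_subgroup_ideal)
    fix u y assume u: "u \<in> Units R" and y: "y \<in> ?Y"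
    have uy: "u \<otimes> y \<in> off p" "u \<otimes> y \<in> I"
      using y iff ideal.I_l_closed[OF off_ideal] I.I_l_closed u by (auto simp: Units_closed)
    have yk: "y \<oplus> k \<in> X" using iff y by blast
    \<comment> \<open>The slice is tested with the fixed \<open>k\<close>, so \<open>u y + k\<close>
      is written as \<open>u\<close> times \<open>y + u^-1 k\<close>, and \<open>u^-1 k\<close> is
      as good a test element as \<open>k\<close>.\<close>
    have "u \<otimes> (y \<oplus> inv u \<otimes> k) \<in> X"
    proof (rule unit_X[OF u])
      have "inv u \<otimes> k \<in> tors p" using ideal.I_l_closed[OF tors_ideal k(1)] u by simp
      moreover have "inv u \<otimes> k \<notin> N"
      proof
        assume "inv u \<otimes> k \<in> N"
        then have "u \<otimes> (inv u \<otimes> k) \<in> N" using u by (rule N.I_l_closed[OF _ Units_closed])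
        then show False using k(2) u kc by (simp add: m_assoc[symmetric] Units_closed)
      qed
      ultimately show "y \<oplus> inv u \<otimes> k \<in> X"
        using outer_tors_orbit[OF p Xo _ k _ _ yk] iff y by blast
    qed
    moreover have "u \<otimes> (y \<oplus> inv u \<otimes> k) = u \<otimes> y \<oplus> k"
      using u Yc[OF y] kc by (simp add: r_distr m_assoc[symmetric] Units_closed)
    ultimately show "u \<otimes> y \<in> ?Y" using iff uy by simp
  qed
  have "?Y \<subseteq> stab B" if B: "B \<in> outer" for B
  proof (rule ideal_subset_stab[OF Yid])
    fix x d assume x: "x \<in> B" and d: "d \<in> ?Y"
    obtain y where y: "y \<in> slice p B" using slice_nonempty[OF p B] by blast
    have yc: "y \<in> carrier R" using A_set_closed[OF A_set_slice[OF p B] y] .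
    \<comment> \<open>A point \<open>k + y\<close> of \<open>B\<close> with \<open>y\<close> in the
      slice of \<open>B\<close> may be moved by \<open>d\<close>, because \<open>k + d\<close> is
      again in \<open>X\<close>; the count then carries this over to all points of
      \<open>B\<close>.\<close>
    have "(k \<oplus> y) \<oplus> d \<in> B" if "d \<in> ?Y" for d
    proof -
      have "(k \<oplus> d) \<oplus> y \<in> B" using add[OF B add[OF Xo X(2) that] y] .
      then show ?thesis using kc yc Yc[OF that] by (simp add: a_ac)
    qed
    then have "{d \<in> ?Y. (k \<oplus> y) \<oplus> d \<in> B} = ?Y" by blast
    moreover have "k \<oplus> y \<approx> x" using same_blockI[OF outer_block[OF B] add[OF B X(2) y] x] .
    then have "card {d \<in> ?Y. (k \<oplus> y) \<oplus> d \<in> B} = card {d \<in> ?Y. x \<oplus> d \<in> B}"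
      by (rule card_plus_same_block[OF outer_A_set[OF B] AY])
    ultimately have "{d \<in> ?Y. x \<oplus> d \<in> B} = ?Y"
      using A_set_finite[OF AY] by (intro card_subset_eq) auto
    then show "x \<oplus> d \<in> B" using d by blast
  qed
  then show ?thesis by (auto simp: N_def)
qed

text \<open>
  The \<open>q\<close>-th power map is injective modulo \<open>N\<close> on the elements of \<open>X\<close> congruent to \<open>k\<close> outside
  the \<open>q\<close>-component, so its image contains the whole block of \<open>q k\<close>; iterating kills the
  \<open>q\<close>-component.
\<close>

lemma base_block_idem_mem_N:
  assumes p: "p \<in> Q" and X: "X \<in> blocks" "k \<in> X" and k: "k \<in> tors p" "k \<notin> N"
    and kp: "k \<in> p_component R p" and q: "q \<in> prime_set R" "q \<notin> Q" and x: "x \<in> X"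
  shows "idem q \<otimes> x \<in> N"
proof -
  note Xo = base_block_outer[OF p X k]
  note pp = prime_set_prime[OF subsetD[OF Q_subset p]]
  note qp = prime_set_prime[OF q(1)]
  have pq: "p \<noteq> q" using p q by auto
  have kc: "k \<in> carrier R" and ek: "idem p \<otimes> k = k" using kp by (auto simp: p_component_eq[OF pp])
  have eqk: "idem q \<otimes> k = \<zero>"
  proof -
    have "idem q \<otimes> (idem p \<otimes> k) = \<zero>" using idem_orth[OF qp pp] pq kc by (simp add: m_assoc[symmetric])
    then show ?thesis using ek by simp
  qed
  have cardN: "card N > 0"
    using N.zero_closed finite_subset[OF N.a_subset finite_carrier] by (auto simp only: card_gt_0_iff)
  have preim: "{y \<in> X. [q] \<cdot> k \<ominus> [q] \<cdot> y \<in> N} = (\<lambda>n. k \<oplus> n) ` N"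
  proof (intro equalityI subsetI)
    fix y assume "y \<in> (\<lambda>n. k \<oplus> n) ` N"
    then obtain n where n: "n \<in> N" "y = k \<oplus> n" by auto
    have "[q] \<cdot> k \<ominus> [q] \<cdot> y = \<ominus> ([q] \<cdot> n)"
      using n kc N.a_Hcarr[OF n(1)] by (simp add: add.nat_pow_distrib minus_eq minus_add r_neg1 r_neg2)
    moreover have "\<ominus> ([q] \<cdot> n) \<in> N" using ideal_nat_mult[OF ideal_N n(1)] by simp
    ultimately show "y \<in> {y \<in> X. [q] \<cdot> k \<ominus> [q] \<cdot> y \<in> N}"
      using outer_add_N[OF Xo X(2) n(1)] n by simp
  next
    fix y assume y: "y \<in> {y \<in> X. [q] \<cdot> k \<ominus> [q] \<cdot> y \<in> N}"
    have yc: "y \<in> carrier R" using y X block_closed by blast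
    define d where "d = y \<ominus> k"
    have dc: "d \<in> carrier R" and yd: "y = k \<oplus> d" using yc kc by (simp_all add: d_def)
    have "\<ominus> ([q] \<cdot> k \<ominus> [q] \<cdot> y) \<in> N" using y by blast
    moreover have "\<ominus> ([q] \<cdot> k \<ominus> [q] \<cdot> y) = [q] \<cdot> d"
      using yc kc by (simp add: d_def minus_eq add.nat_pow_distrib add.nat_pow_inv minus_add a_comm)
    ultimately have "d \<ominus> idem q \<otimes> d \<in> N" using p_multiple_cancel[OF q(1) ideal_N dc] by simp
    \<comment> \<open>As \<open>q\<close> is outside \<open>Q\<close>, this component lies in
      \<open>I\<close>, and its \<open>p\<close>-component is zero. Since adding it to
      \<open>k\<close> stays in \<open>X\<close>, it belongs to \<open>slice p X\<close>, hence to
      \<open>N\<close>.\<close>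
    moreover have "idem q \<otimes> d \<in> N"
    proof -
      have dI: "idem q \<otimes> d \<in> I" using not_Q_idem[OF q] dc by (rule I.I_r_closed)
      have "idem p \<otimes> (idem q \<otimes> d) = \<zero>" using idem_orth[OF pp qp pq] dc by (simp add: m_assoc[symmetric])
      then have doff: "idem q \<otimes> d \<in> off p" using dc by (simp add: off_def[OF p])
      have "k \<oplus> idem q \<otimes> d \<in> X"
      proof -
        have "(k \<oplus> idem q \<otimes> d) \<oplus> (d \<ominus> idem q \<otimes> d) = y"
          using yd kc dc by (simp add: a_assoc)
        then have "(k \<oplus> idem q \<otimes> d) \<oplus> (d \<ominus> idem q \<otimes> d) \<in> X" using y by simp
        then show ?thesis
          using outer_add_N_iff[OF Xo, of "k \<oplus> idem q \<otimes> d"] kc dc \<open>d \<ominus> idem q \<otimes> d \<in> N\<close> by blast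
      qed
      then have "idem q \<otimes> d \<in> slice p X"
        using slice_iff[OF p Xo k] dI doff kc dc by (simp add: a_comm)
      then show ?thesis using base_block_slice_subset_N[OF p X k] by blast
    qed
    ultimately have "idem q \<otimes> d \<oplus> (d \<ominus> idem q \<otimes> d) \<in> N" by blast
    then have "d \<in> N" using dc by simp
    then show "y \<in> (\<lambda>n. k \<oplus> n) ` N" using yd by blast
  qed
  have card1: "card {y \<in> X. [q] \<cdot> k \<ominus> [q] \<cdot> y \<in> N} div card N = 1"
    unfolding preim using cardN kc N.a_Hcarr by (simp add: card_image inj_on_def)
  \<comment> \<open>The number of \<open>q\<close>-preimages is 1 at \<open>q k\<close>, so it is
    nonzero modulo \<open>q\<close> at \<open>twist q x\<close>, which yields \<open>x'\<close>. The
    congruence compares \<open>q\<close>-components, where \<open>twist q\<close> is the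
    identity.\<close>
  have step: "\<exists>x'\<in>X. idem q \<otimes> x \<ominus> [q] \<cdot> (idem q \<otimes> x') \<in> N" if x: "x \<in> X" for x
  proof -
    have xc: "x \<in> carrier R" using x X block_closed by blast
    \<comment> \<open>Since \<open>k\<close> has zero \<open>q\<close>-component, the unit
      \<open>twist q\<close> multiplies it by \<open>q\<close>.\<close>
    have tk: "twist q \<otimes> k = [q] \<cdot> k" using twist_mult[OF kc, of q] eqk kc by (simp add: minus_eq)
    have "[q] \<cdot> k \<approx> twist q \<otimes> x"
      using same_block_unit[OF same_blockI[OF X x] twist_unit[OF q(1)]] tk by simp
    from card_p_multiple_cong[OF qp N.additive_subgroup_axioms A_set_N outer_A_set[OF Xo] outer_add_N[OF Xo] this]
    have "[1 = card {y \<in> X. twist q \<otimes> x \<ominus> [q] \<cdot> y \<in> N} div card N] (mod q)"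
      unfolding card1 .
    moreover have "\<not> [1 = 0] (mod q)" using qp by (auto simp: cong_def)
    ultimately have "{y \<in> X. twist q \<otimes> x \<ominus> [q] \<cdot> y \<in> N} \<noteq> {}" by (metis card.empty div_0)
    then obtain x' where x': "x' \<in> X" "twist q \<otimes> x \<ominus> [q] \<cdot> x' \<in> N" by blast
    have x'c: "x' \<in> carrier R" using x' X block_closed by blast
    have tc: "twist q \<otimes> x \<in> carrier R" using xc Units_closed[OF twist_unit[OF q(1)]] by simp
    have "idem q \<otimes> (twist q \<otimes> x) = idem q \<otimes> x"
      using twist_mult[OF xc, of q] xc idem_mult_assoc[OF qp xc] idem_mult_compl[OF qp xc]
      by (simp add: r_distr add_pow_rdistr)
    then have "idem q \<otimes> (twist q \<otimes> x \<ominus> [q] \<cdot> x') = idem q \<otimes> x \<ominus> [q] \<cdot> (idem q \<otimes> x')"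
      using tc x'c by (simp add: minus_eq r_distr r_minus add_pow_rdistr)
    moreover have "idem q \<otimes> (twist q \<otimes> x \<ominus> [q] \<cdot> x') \<in> N" using x'(2) by (rule N.I_l_closed) simp
    ultimately show ?thesis using x'(1) by auto
  qed
  have "\<exists>x'\<in>X. idem q \<otimes> x \<ominus> [(q ^ m)] \<cdot> (idem q \<otimes> x') \<in> N" for m
  proof (induction m)
    case 0
    have "x \<in> carrier R" using x X block_closed by blast
    then show ?case using x by (intro bexI[of _ x]) (simp_all add: minus_eq r_neg)
  next
    case (Suc m)
    then obtain x1 where x1: "x1 \<in> X" "idem q \<otimes> x \<ominus> [(q ^ m)] \<cdot> (idem q \<otimes> x1) \<in> N" by blast
    obtain x2 where x2: "x2 \<in> X" "idem q \<otimes> x1 \<ominus> [q] \<cdot> (idem q \<otimes> x2) \<in> N" using step[OF x1(1)] by blast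
    have c: "x \<in> carrier R" "x1 \<in> carrier R" "x2 \<in> carrier R" using x x1 x2 X block_closed by blast+
    have "[(q ^ m)] \<cdot> (idem q \<otimes> x1 \<ominus> [q] \<cdot> (idem q \<otimes> x2)) \<in> N"
      by (rule ideal_nat_mult[OF ideal_N x2(2)])
    moreover have "[(q ^ m)] \<cdot> (idem q \<otimes> x1 \<ominus> [q] \<cdot> (idem q \<otimes> x2)) =
        [(q ^ m)] \<cdot> (idem q \<otimes> x1) \<ominus> [(q ^ Suc m)] \<cdot> (idem q \<otimes> x2)"
      using c by (simp add: minus_eq add.nat_pow_distrib add.nat_pow_inv nat_mult_mult mult.commute)
    ultimately have *: "[(q ^ m)] \<cdot> (idem q \<otimes> x1) \<ominus> [(q ^ Suc m)] \<cdot> (idem q \<otimes> x2) \<in> N" by simp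
    have "idem q \<otimes> x \<ominus> [(q ^ Suc m)] \<cdot> (idem q \<otimes> x2) \<in> N"
      using minus_mem_cancel(2)[OF N.additive_subgroup_axioms _ _ _ *, of "idem q \<otimes> x"] x1(2) c by simp
    then show ?case using x2(1) by blast
  qed
  then obtain x' where x': "x' \<in> X" "idem q \<otimes> x \<ominus> [prime_part q] \<cdot> (idem q \<otimes> x') \<in> N"
    unfolding prime_part_def by blast
  have "x' \<in> carrier R" "x \<in> carrier R" using x' x X block_closed by blast+
  then show ?thesis using x'(2) prime_part_mult_idem[OF qp] by (simp add: minus_eq)
qed

section \<open>The ideal \<open>I_star\<close> and the two conclusions\<close>

lemma I_star_props:
  shows "A_ideal R A (I_star R A Q)" and "Q_component R Q \<subseteq> I_star R A Q"
    and "A_ideal R A K \<Longrightarrow> Q_component R Q \<subseteq> K \<Longrightarrow> I_star R A Q \<subseteq> K"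
proof -
  have "Q_component R Q \<subseteq> carrier R"
    by (rule Q_component_subset_ideal[OF oneideal Q_subset]) simp
  then have "carrier R \<in> {K. A_ideal R A K \<and> Q_component R Q \<subseteq> K}" using A_ideal_carrier by blast
  then show "A_ideal R A (I_star R A Q)" unfolding I_star_def by (intro A_ideal_Inter) auto
qed (auto simp: I_star_def)

lemma I_inter_I_star_subset_N: "I \<inter> I_star R A Q \<subseteq> N"
proof -
  obtain p where p: "p \<in> Q" using Q_nonempty by blast
  obtain k where k: "k \<in> tors p" "k \<notin> N" "k \<in> p_component R p" using tors_minus_N_nonempty[OF p] .
  obtain X where X: "X \<in> blocks" "k \<in> X" using block_ex[OF p_component_closed[OF k(3)]] .
  \<comment> \<open>This is the sum of the \<open>Q\<close>-component and \<open>N\<close>. The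
    intersection with the carrier matters when no prime lies outside \<open>Q\<close>.\<close>
  define V where "V = (\<Inter>q\<in>prime_set R - Q. {x \<in> carrier R. idem q \<otimes> x \<in> N}) \<inter> carrier R"
  have V: "ideal V R"
  proof (cases "prime_set R - Q = {}")
    case True
    show ?thesis unfolding V_def True using oneideal by simp
  next
    case False
    then show ?thesis unfolding V_def using ideal_preimage[OF ideal_N idem_closed]
      by (intro i_intersect i_Intersect oneideal) auto
  qed
  have core: "A_ideal R A (core V)" by (rule A_ideal_core[OF V])
  then have core_ideal: "ideal (core V) R" by (simp add: A_ideal_iff)
  have NV: "N \<subseteq> core V"
    using N.I_l_closed N.a_subset by (intro A_set_subset_core[OF A_set_N]) (auto simp: V_def)
  have "X \<subseteq> V" using base_block_idem_mem_N[OF p X k] block_closed[OF X(1)] by (auto simp: V_def)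
  then have "k \<in> core V" using block_subset_core[OF X(1)] X(2) by blast
  moreover have "k \<notin> I" using tors_inter_I_subset_N[OF p] k by blast
  ultimately have nI: "\<not> core V \<subseteq> I" by blast
  obtain i v where iv: "i \<in> I" "v \<in> core V" "\<one> = i \<oplus> v" using mem_I_add[OF core nI one_closed] .
  \<comment> \<open>Multiply \<open>1 = i + v\<close> by \<open>idem r\<close>: the first term lands
    in \<open>N\<close>, because \<open>r\<close>-components of elements of \<open>I\<close>
    do.\<close>
  have "idem r \<in> core V" if r: "r \<in> Q" for r
  proof -
    have c: "i \<in> carrier R" "v \<in> carrier R" using iv I.a_Hcarr ideal.Icarr[OF core_ideal] by auto
    have "idem r = idem r \<otimes> i \<oplus> idem r \<otimes> v"
      using c r_distr[of i v "idem r"] r_one[OF idem_closed[of r]] unfolding iv(3) by simp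
    also have "\<dots> \<in> core V"
      using idem_mult_I_subset_N[OF r iv(1)] NV ideal.I_l_closed[OF core_ideal iv(2) idem_closed]
      by (intro additive_subgroup.a_closed[OF ideal.axioms(1)[OF core_ideal]]) auto
    finally show ?thesis .
  qed
  then have "Q_component R Q \<subseteq> core V" by (rule Q_component_subset_ideal[OF core_ideal Q_subset])
  then have star: "I_star R A Q \<subseteq> V" using I_star_props(3)[OF core] core_subset by blast
  show ?thesis
  proof
    fix x assume x: "x \<in> I \<inter> I_star R A Q"
    have xc: "x \<in> carrier R" using x I.a_Hcarr by blast
    show "x \<in> N"
    proof (rule mem_if_idem_mem[OF N.additive_subgroup_axioms xc])
      fix q assume q: "q \<in> prime_set R"
      show "idem q \<otimes> x \<in> N"
      proof (cases "q \<in> Q")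
        case True
        then show ?thesis using idem_mult_I_subset_N x by blast
      next
        case False
        then show ?thesis using star x q by (auto simp: V_def)
      qed
    qed
  qed
qed

theorem satisfies_condition_I_star: "satisfies_condition R A I (I \<inter> I_star R A Q)"
proof -
  have "A_ideal R A (\<Inter>{I, I_star R A Q})"
    using A_ideal_I I_star_props(1) by (intro A_ideal_Inter) auto
  moreover have "I \<inter> I_star R A Q \<subseteq> I_L R X" if "X \<in> blocks" "X \<subseteq> carrier R - I" for X
    using I_inter_I_star_subset_N that I_L_eq_stab[OF A_set_block[OF that(1)]]
    by (auto simp: N_def outer_def)
  ultimately show ?thesis using A_ideal_I by (simp add: satisfies_condition_def)
qed

theorem is_tensor_I_star:
  assumes J: "I \<inter> I_star R A Q = {\<zero>}"
  shows "is_tensor R A I (I_star R A Q)"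
proof -
  let ?S = "I_star R A Q"
  obtain p where p: "p \<in> Q" using Q_nonempty by blast
  note pp = prime_set_prime[OF subsetD[OF Q_subset p]]
  obtain k where k: "k \<in> tors p" "k \<notin> N" "k \<in> p_component R p" using tors_minus_N_nonempty[OF p] .
  obtain X where X: "X \<in> blocks" "k \<in> X" using block_ex[OF p_component_closed[OF k(3)]] .
  have Sid: "ideal ?S R" and SA: "A_set ?S" using I_star_props(1) by (auto simp: A_ideal_iff)
  interpret S: ideal ?S R by (rule Sid)
  note [simp del] = S.a_Hcarr
  have kS: "k \<in> ?S" using k(3) p_component_subset_Q_component[OF p Q_subset] I_star_props(2) by blast
  have XS: "X \<subseteq> ?S" using block_subset_A_set[OF X(1) SA X(2) kS] .
  have kI: "k \<notin> I" using tors_inter_I_subset_N[OF p] k by blast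
  then have nSI: "\<not> ?S \<subseteq> I" using kS by blast
  have uniq: "i = i' \<and> s = s'" if "i \<in> I" "i' \<in> I" "s \<in> ?S" "s' \<in> ?S" "s \<oplus> i = s' \<oplus> i'" for i i' s s'
  proof -
    have c: "i \<in> carrier R" "i' \<in> carrier R" "s \<in> carrier R" "s' \<in> carrier R"
      using that I.a_Hcarr S.a_Hcarr by auto
    have "s \<ominus> s' = i' \<ominus> i"
    proof -
      have "s = (s \<oplus> i) \<ominus> i" using c by simp
      also have "\<dots> = s' \<oplus> (i' \<ominus> i)" unfolding that(5) using c by (simp add: minus_eq a_assoc)
      finally show ?thesis using c by simp
    qed
    moreover have "s \<ominus> s' \<in> ?S" "i' \<ominus> i \<in> I" using that by (auto simp: minus_eq)
    ultimately have "s \<ominus> s' = \<zero>" "i' \<ominus> i = \<zero>" using J by auto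
    then show ?thesis using c by simp
  qed
  \<comment> \<open>The basic set \<open>Y\<close> of a point of \<open>slice p B\<close> stays
    inside the slice, so \<open>X + Y\<close> is a non-empty A-set inside \<open>B\<close> and
    therefore all of \<open>B\<close>.\<close>
  have outer_form: "\<exists>Y\<in>blocks. Y \<subseteq> I \<and> B = X <+>\<^bsub>R\<^esub> Y" if B: "B \<in> outer" for B
  proof -
    obtain y where y: "y \<in> slice p B" using slice_nonempty[OF p B] by blast
    have AY: "A_set (slice p B)" by (rule A_set_slice[OF p B])
    obtain Y where Y: "Y \<in> blocks" "y \<in> Y" using block_ex[OF A_set_closed[OF AY y]] .
    have YB: "Y \<subseteq> slice p B" using block_subset_A_set[OF Y(1) AY Y(2) y] .
    have sub: "X <+>\<^bsub>R\<^esub> Y \<subseteq> B"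
      using base_block_add_slice[OF p X k(1,2) B] YB unfolding set_add_def' by blast
    have "k \<oplus> y \<in> X <+>\<^bsub>R\<^esub> Y" using X(2) Y(2) unfolding set_add_def' by blast
    then have "B \<subseteq> X <+>\<^bsub>R\<^esub> Y"
      using block_subset_A_set[OF outer_block[OF B] A_set_set_add[OF A_set_block[OF X(1)] A_set_block[OF Y(1)]]] sub
      by blast
    then show ?thesis using sub Y YB slice_subset_I[OF p B] by blast
  qed
  have sum_block: "X1 <+>\<^bsub>R\<^esub> X2 \<in> blocks"
    if X1: "X1 \<in> blocks" "X1 \<subseteq> I" and X2: "X2 \<in> blocks" "X2 \<subseteq> ?S" for X1 X2
  proof (cases "X2 = {\<zero>}")
    case True
    then have "X1 <+>\<^bsub>R\<^esub> X2 = X1" using block_closed[OF X1(1)] unfolding set_add_def' by force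
    then show ?thesis using X1 by simp
  next
    case False
    obtain x2 where x2: "x2 \<in> X2" using block_nonempty[OF X2(1)] by blast
    have "x2 \<noteq> \<zero>" using block_eq[OF X2(1) zero_block x2] False by blast
    then have "x2 \<notin> I" using J x2 X2(2) by blast
    then have "X2 \<in> outer" by (rule outerI[OF X2(1) x2])
    then obtain Y where Y: "Y \<in> blocks" "Y \<subseteq> I" "X2 = X <+>\<^bsub>R\<^esub> Y" using outer_form by blast
    \<comment> \<open>As \<open>k\<close> and \<open>k + y\<close> both lie in
      \<open>I_star\<close>, so does \<open>y\<close>, which is also in \<open>I\<close>.
      Consequently \<open>X\<close> is the only nonzero basic set in \<open>I_star\<close>.\<close>
    have "y = \<zero>" if y: "y \<in> Y" for y
    proof -
      have "k \<oplus> y \<in> ?S" using Y(3) X(2) y X2(2) unfolding set_add_def' by blast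
      then have "k \<oplus> y \<ominus> k \<in> ?S" using kS by (simp add: minus_eq)
      then have "y \<in> ?S" using block_closed[OF Y(1) y] p_component_closed[OF k(3)] by simp
      then show ?thesis using J y Y(2) by blast
    qed
    then have "Y = {\<zero>}" using block_nonempty[OF Y(1)] by blast
    then have X2X: "X2 = X" using Y(3) block_closed[OF X(1)] unfolding set_add_def' by force
    obtain x1 where x1: "x1 \<in> X1" using block_nonempty[OF X1(1)] by blast
    have x1c: "x1 \<in> carrier R" and kc: "k \<in> carrier R"
      using block_closed[OF X1(1) x1] p_component_closed[OF k(3)] by auto
    obtain B where B: "B \<in> blocks" "k \<oplus> x1 \<in> B" using block_ex[of "k \<oplus> x1"] x1c kc by blast
    have "k \<oplus> x1 \<notin> I"
    proof
      assume "k \<oplus> x1 \<in> I"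
      then have "k \<oplus> x1 \<ominus> x1 \<in> I" using x1 X1(2) by (simp add: minus_eq subsetD)
      then show False using kI x1c kc by simp
    qed
    then have "B \<in> outer" by (rule outerI[OF B])
    then obtain Y' where Y': "Y' \<in> blocks" "Y' \<subseteq> I" "B = X <+>\<^bsub>R\<^esub> Y'" using outer_form by blast
    then obtain s y where sy: "s \<in> X" "y \<in> Y'" "k \<oplus> x1 = s \<oplus> y" using B(2) unfolding set_add_def' by blast
    \<comment> \<open>Directness of the sum compares the \<open>I\<close>-parts of
      \<open>k + x1 = s + y\<close>, which identifies \<open>Y'\<close> with
      \<open>X1\<close>.\<close>
    then have "x1 = y" using uniq[of x1 y k s] x1 X1(2) Y'(2) kS XS by blast
    then have "Y' = X1" using block_eq[OF Y'(1) X1(1)] sy(2) x1 by blast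
    moreover have "X1 <+>\<^bsub>R\<^esub> X = X <+>\<^bsub>R\<^esub> X1"
      using block_closed[OF X(1)] block_closed[OF X1(1)] a_comm unfolding set_add_def' by blast
    ultimately show ?thesis using Y'(3) B(1) X2X by simp
  qed
  have carr: "I <+>\<^bsub>R\<^esub> ?S = carrier R" by (rule I_add_eq_carrier[OF I_star_props(1) nSI])
  have "blocks = {X1 <+>\<^bsub>R\<^esub> X2 | X1 X2. X1 \<in> {X \<in> blocks. X \<subseteq> I} \<and> X2 \<in> {X \<in> blocks. X \<subseteq> ?S}}"
  proof (intro equalityI subsetI)
    fix B assume B: "B \<in> blocks"
    obtain x where x: "x \<in> B" using block_nonempty[OF B] by blast
    then obtain i s where xis: "i \<in> I" "s \<in> ?S" "x = i \<oplus> s"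
      using mem_I_add[OF I_star_props(1) nSI block_closed[OF B x]] by blast
    obtain X1 where X1: "X1 \<in> blocks" "i \<in> X1" using block_ex xis(1) I.a_Hcarr by blast
    obtain X2 where X2: "X2 \<in> blocks" "s \<in> X2" using block_ex xis(2) S.a_Hcarr by blast
    have sub: "X1 \<subseteq> I" "X2 \<subseteq> ?S"
      using block_subset_A_set[OF X1(1) A_set_I X1(2) xis(1)] block_subset_A_set[OF X2(1) SA X2(2) xis(2)] .
    have "x \<in> X1 <+>\<^bsub>R\<^esub> X2" using xis X1 X2 unfolding set_add_def' by blast
    then have "B = X1 <+>\<^bsub>R\<^esub> X2" using block_eq[OF B sum_block[OF X1(1) sub(1) X2(1) sub(2)] x] by blast
    then show "B \<in> {X1 <+>\<^bsub>R\<^esub> X2 | X1 X2. X1 \<in> {X \<in> blocks. X \<subseteq> I} \<and> X2 \<in> {X \<in> blocks. X \<subseteq> ?S}}"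
      using X1 X2 sub by blast
  qed (use sum_block in blast)
  moreover have "S_ring (add_monoid R) A" using S_ring_over by (simp add: S_ring_over_def)
  ultimately show ?thesis
    unfolding is_tensor_def
    using carr J basic_sets_S_ring_restrict[OF is_cring finite_carrier _ A_ideal_I]
      basic_sets_S_ring_restrict[OF is_cring finite_carrier _ I_star_props(1)] by simp
qed

end

theorem theorem6p1:
  fixes R :: "('a, 'b) ring_scheme" and A :: "('a \<Rightarrow> int) set" and I J Istar :: "'a set"
    and Q :: "nat set"
  assumes "cring R" and "finite (carrier R)" and "CG_ring R"
    and "S_ring_over R A"
    and "I \<in> max_A_ideals R A"
    and "Q = prime_set (R Quot I)"
    and "\<And>B. B \<in> basic_sets (add_monoid R) A \<Longrightarrow> B \<subseteq> carrier R - I \<Longrightarrow> Q_rational R Q B"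
    and "Istar = I_star R A Q"
    and "J = I \<inter> Istar"
  shows "satisfies_condition R A I J \<and>
         (J = {\<zero>\<^bsub>R\<^esub>} \<longrightarrow> is_tensor R A I Istar)"
proof -
  interpret cring R by fact
  interpret max_A_ideal_setting R A I Q
    by unfold_locales (fact assms)+
  show ?thesis using satisfies_condition_I_star is_tensor_I_star unfolding assms(8,9) by blast
qed


end
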